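(* Let $X$ be a quasi-Banach symmetric function space on $(0,1)$ with the Fatou property. The following conditions are equivalent. (i) For every symmetric quasi-Banach sequence space $E$ and for an arbitrary sequence of independent random variables $(f_k)_{k\geq0}\subset X$ we have $$\big\|\,\|(f_k)_{k\geq0}\|_E\,\big\|_X\approx_{X,E} \big\|\mu(f)\chi_{(0,1)}\big\|_X+\big\|\big(\mu(k,f)\big)_{k\geq1}\big\|_E,\qquad f=\bigoplus_{k\geq0}f_k,$$ where $\approx_{X,E}$ means that the ratio of the two sides is bounded above and below by positive constants depending only on $X$ and $E$ (and not on the sequence $(f_k)_{k\ge0}$). (ii) For every $0<p<1$ the Kruglov operator $K$ satisfies $K:X_p\to X_p$ (that is, $K$ maps $X_p$ into itself), where $X_p$ is the $p$-th power of $X$.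
   Context: Random variables are measurable functions on $(0,1)$ with Lebesgue measure $m$; $S(0,1)$ is the space of all of them. For measurable $f$ on $(0,1)$ or $(0,\infty)$ put $d_{|f|}(s)=m(\{|f|>s\})$ and $\mu(t,f)=\inf\{\lambda\ge 0: d_{|f|}(\lambda)<t\}$, $t>0$; $\mu(f)=\mu(\cdot,f)$ is the decreasing rearrangement. For a bounded sequence $\xi=(\xi_n)_{n\ge0}$, $\mu(n,\xi)=\inf\{\lambda\ge0:\mathrm{Card}\{k\ge0:|\xi_k|>\lambda\}\le n\}$, $n\ge0$. Quasi-norm: positive definite, absolutely homogeneous, and $\|x+y\|\le C(\|x\|+\|y\|)$ for some constant $C$; quasi-Banach means complete. Symmetric quasi-Banach function space $X$: a quasi-Banach space $X\subset S(0,1)$ such that $f\in X$, $g\in S(0,1)$, $|g|\le|f|$ imply $g\in X$, $\|g\|_X\le\|f\|_X$, and $f\in X$, $\mu(g)=\mu(f)$ imply $g\in X$, $\|g\|_X=\|f\|_X$. Fatou property: for every bounded sequence $(x_n)_{n\ge 0}\subset X$ with $x_n\to x$ a.e., one has $x\in X$ and $\|x\|_X\le\liminf_{n}\|x_n\|_X$. For $0<p<\infty$, $X_p=\{f\in S(0,1):|f|^{1/p}\in X\}$ with $\|f\|_{X_p}=\||f|^{1/p}\|_X^p$. Symmetric quasi-Banach sequence space $E$: a quasi-Banach space of bounded sequences such that $a\in E$, $\mu(b)\le\mu(a)$ imply $b\in E$, $\|b\|_E\le\|a\|_E$; the standard unit vectors $e_k$ lie in $E$ and are normalized by $\|e_k\|_E=1$.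 Quasi-norms of elements not in the space are taken to be $\infty$. $\|(f_k)_{k\ge0}\|_E$ denotes the function $t\mapsto\|(f_k(t))_{k\ge0}\|_E$. Disjoint sum: $\bigoplus_{k}f_k$ is the function on $(0,\infty)$ given by $\sum_k g_k$, where $g_k$ is a disjoint copy of $f_k$, e.g. $g_k(t)=f_k(t-k)\chi_{[k,k+1)}(t)$. Kruglov operator: let $(\Omega,\mathbb P)=\prod_{k=0}^\infty((0,1),m)$, identified with $(0,1)$ by a measure-preserving bijection, so that measurable functions on $\Omega$ are regarded as elements of $S(0,1)$. Let $(A_n)_{n\ge0}$ be mutually disjoint measurable subsets of $(0,1)$ with $m(A_n)=\frac1{e\cdot n!}$. For $f\in S(0,1)$, $Kf(\omega)=\sum_{n=1}^\infty\sum_{k=1}^n f(\omega_k)\chi_{A_n}(\omega_0)$.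
   Formalization: In (i) only those independent sequences are considered for which the function t ↦ ‖(f_k(t))_k‖_E is Lebesgue measurable; otherwise its X-quasi-norm is undefined (and if read as ∞, the equivalence fails, e.g. for weak ℓ_1 with an ultrafilter-limit quasi-norm). *)

theory Defs
  imports "HOL-Probability.Probability"
begin

section \<open>Quasi-Banach spaces of measurable functions\<close>

text \<open>
  Spaces are given by a carrier \<open>V\<close> of functions and a quasi-norm \<open>N\<close>, whose values outside
  \<open>V\<close> are irrelevant. We work with functions rather than classes, so definiteness is stated
  up to null sets; for \<open>M = count_space UNIV\<close> null sets are empty.
\<close>

locale quasi_banach_space =
  fixes M :: "'a measure" and V :: "('a \<Rightarrow> real) set" and N :: "('a \<Rightarrow> real) \<Rightarrow> real"
  assumes carrier_measurable: "V \<subseteq> borel_measurable M"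
    and zero_mem: "(\<lambda>x. 0) \<in> V"
    and add_mem: "\<And>f g. f \<in> V \<Longrightarrow> g \<in> V \<Longrightarrow> (\<lambda>x. f x + g x) \<in> V"
    and scale_mem: "\<And>c f. f \<in> V \<Longrightarrow> (\<lambda>x. c * f x) \<in> V"
    and nonneg: "\<And>f. f \<in> V \<Longrightarrow> 0 \<le> N f"
    and definite: "\<And>f. f \<in> V \<Longrightarrow> N f = 0 \<longleftrightarrow> (AE x in M. f x = 0)"
    and homogeneous: "\<And>c f. f \<in> V \<Longrightarrow> N (\<lambda>x. c * f x) = \<bar>c\<bar> * N f"
    and quasi_triangle: "\<exists>C. \<forall>f\<in>V. \<forall>g\<in>V. N (\<lambda>x. f x + g x) \<le> C * (N f + N g)"
    and complete: "\<And>u. (\<forall>n. u n \<in> V) \<Longrightarrow>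
        (\<forall>\<epsilon>>0. \<exists>n0. \<forall>m\<ge>n0. \<forall>n\<ge>n0. N (\<lambda>x. u m x - u n x) < \<epsilon>) \<Longrightarrow>
        (\<exists>f\<in>V. (\<lambda>n. N (\<lambda>x. u n x - f x)) \<longlonglongrightarrow> 0)"


section \<open>Decreasing rearrangements\<close>

definition distribution_fn :: "'a measure \<Rightarrow> ('a \<Rightarrow> real) \<Rightarrow> real \<Rightarrow> ennreal" where
  "distribution_fn M f s = emeasure M {x \<in> space M. \<bar>f x\<bar> > s}"

text \<open>The value is \<open>\<infinity>\<close> when the set of admissible \<open>l\<close> is empty, which can happen on \<open>(0,\<infinity>)\<close>.\<close>

definition rearrangement :: "'a measure \<Rightarrow> ('a \<Rightarrow> real) \<Rightarrow> real \<Rightarrow> ennreal" where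
  "rearrangement M f t = (INF l \<in> {l. 0 \<le> l \<and> distribution_fn M f l < ennreal t}. ennreal l)"

text \<open>For bounded sequences only; otherwise the infimum may be over the empty set.\<close>

definition seq_rearrangement :: "(nat \<Rightarrow> real) \<Rightarrow> nat \<Rightarrow> real" where
  "seq_rearrangement a n =
     Inf {l. 0 \<le> l \<and> finite {k. \<bar>a k\<bar> > l} \<and> card {k. \<bar>a k\<bar> > l} \<le> n}"


section \<open>Symmetric spaces\<close>

abbreviation unit_interval :: "real measure" where
  "unit_interval \<equiv> lebesgue_on {0<..<1}"

locale symmetric_fun_space = quasi_banach_space unit_interval X N
  for X :: "(real \<Rightarrow> real) set" and N :: "(real \<Rightarrow> real) \<Rightarrow> real" +
  assumes ideal: "\<And>f g. f \<in> X \<Longrightarrow> g \<in> borel_measurable unit_interval \<Longrightarrow>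
        (AE t in unit_interval. \<bar>g t\<bar> \<le> \<bar>f t\<bar>) \<Longrightarrow> g \<in> X \<and> N g \<le> N f"
    and symmetric: "\<And>f g. f \<in> X \<Longrightarrow> g \<in> borel_measurable unit_interval \<Longrightarrow>
        (\<forall>t>0. rearrangement unit_interval g t = rearrangement unit_interval f t) \<Longrightarrow>
        g \<in> X \<and> N g = N f"

definition fatou_property :: "(real \<Rightarrow> real) set \<Rightarrow> ((real \<Rightarrow> real) \<Rightarrow> real) \<Rightarrow> bool" where
  "fatou_property X N \<longleftrightarrow>
     (\<forall>u f. (\<forall>n. u n \<in> X) \<longrightarrow> (\<exists>B. \<forall>n. N (u n) \<le> B) \<longrightarrow> f \<in> borel_measurable unit_interval \<longrightarrow>
        (AE t in unit_interval. (\<lambda>n. u n t) \<longlonglongrightarrow> f t) \<longrightarrow>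
        f \<in> X \<and> ereal (N f) \<le> liminf (\<lambda>n. ereal (N (u n))))"

locale symmetric_seq_space = quasi_banach_space "count_space UNIV" E N
  for E :: "(nat \<Rightarrow> real) set" and N :: "(nat \<Rightarrow> real) \<Rightarrow> real" +
  assumes carrier_bounded: "\<And>a. a \<in> E \<Longrightarrow> bounded (range a)"
    and symmetric: "\<And>a b. a \<in> E \<Longrightarrow> bounded (range b) \<Longrightarrow>
        (\<forall>n. seq_rearrangement b n \<le> seq_rearrangement a n) \<Longrightarrow> b \<in> E \<and> N b \<le> N a"
    and unit_vectors: "\<And>k. indicator {k} \<in> E \<and> N (indicator {k}) = 1"

definition power_space :: "(real \<Rightarrow> real) set \<Rightarrow> real \<Rightarrow> (real \<Rightarrow> real) set" where
  "power_space X p = {f \<in> borel_measurable unit_interval. (\<lambda>t. \<bar>f t\<bar> powr (1 / p)) \<in> X}"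

text \<open>Quasi-norms of \<open>[0,\<infinity>]\<close>-valued functions and sequences, equal to \<open>\<infinity>\<close> outside the space.\<close>

definition fun_norm ::
  "(real \<Rightarrow> real) set \<Rightarrow> ((real \<Rightarrow> real) \<Rightarrow> real) \<Rightarrow> (real \<Rightarrow> ennreal) \<Rightarrow> ennreal" where
  "fun_norm X N F =
     (if (AE t in unit_interval. F t \<noteq> \<infinity>) \<and> (\<lambda>t. enn2real (F t)) \<in> X
      then ennreal (N (\<lambda>t. enn2real (F t))) else \<infinity>)"

definition seq_norm ::
  "(nat \<Rightarrow> real) set \<Rightarrow> ((nat \<Rightarrow> real) \<Rightarrow> real) \<Rightarrow> (nat \<Rightarrow> ennreal) \<Rightarrow> ennreal" where
  "seq_norm E N a =
     (if (\<forall>k. a k \<noteq> \<infinity>) \<and> (\<lambda>k. enn2real (a k)) \<in> E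
      then ennreal (N (\<lambda>k. enn2real (a k))) else \<infinity>)"

definition pointwise_seq_norm ::
  "(nat \<Rightarrow> real) set \<Rightarrow> ((nat \<Rightarrow> real) \<Rightarrow> real) \<Rightarrow> (nat \<Rightarrow> real \<Rightarrow> real) \<Rightarrow> real \<Rightarrow> ennreal" where
  "pointwise_seq_norm E N f t =
     (if (\<lambda>k. f k t) \<in> E then ennreal (N (\<lambda>k. f k t)) else \<infinity>)"

text \<open>The values at integer points, a null set, involve \<open>f k 0\<close> and are immaterial.\<close>

definition disjoint_sum :: "(nat \<Rightarrow> real \<Rightarrow> real) \<Rightarrow> real \<Rightarrow> real" where
  "disjoint_sum f t = (\<Sum>k. f k (t - real k) * indicator {real k..<real k + 1} t)"


section \<open>The Kruglov operator\<close>

text \<open>Completed, so that it is isomorphic to \<open>(0,1)\<close> with Lebesgue measurable sets.\<close>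

definition product_space :: "(nat \<Rightarrow> real) measure" where
  "product_space = completion (PiM UNIV (\<lambda>_. unit_interval))"

definition measure_preserving_bijection :: "'a measure \<Rightarrow> 'b measure \<Rightarrow> ('a \<Rightarrow> 'b) \<Rightarrow> bool" where
  "measure_preserving_bijection M M' T \<longleftrightarrow>
     bij_betw T (space M) (space M') \<and> T \<in> measurable M M' \<and>
     the_inv_into (space M) T \<in> measurable M' M \<and> distr M M' T = M'"

text \<open>The summand for \<open>n = 0\<close> is an empty sum; for disjoint \<open>A n\<close> at most one summand is nonzero.\<close>

definition kruglov :: "(nat \<Rightarrow> real set) \<Rightarrow> (real \<Rightarrow> real) \<Rightarrow> (nat \<Rightarrow> real) \<Rightarrow> real" where
  "kruglov A f \<omega> = (\<Sum>n. \<Sum>k=1..n. f (\<omega> k) * indicator (A n) (\<omega> 0))"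

end

theory Submission
  imports Defs
begin

text \<open>
  Let \<open>d(s) = (\<Sum>k. m {\<bar>f k\<bar> > s})\<close> be the distribution function of the disjoint sum and \<open>\<mu>\<close> its
  decreasing rearrangement. Quasi-norms are compared through distribution functions: if \<open>h\<close> lies
  in a symmetric space and \<open>d\<^sub>g \<le> c * d\<^sub>h\<close>, then \<open>g\<close> lies in it and its norm is at most a multiple of
  that of \<open>h\<close>, with a factor depending on \<open>c\<close> and the space only (\<open>dilation\<close>; for sequence spaces,
  with numbers of large entries in place of measures, \<open>seq_dilation_power\<close>). Both directions are
  thereby reduced to inequalities between probabilities, in which constant factors do not matter.

  The right-hand side is always at most a multiple of the left-hand side
  (\<open>johnson_schechtman_lower\<close>). The norm in \<open>E\<close> bounds every entry, and independence gives
  \<open>P(max \<bar>f k\<bar> > s) \<ge> min 1 (d s) / 4\<close>; this controls \<open>\<mu>\<close> on \<open>(0,1)\<close>. By a Chernoff bound there is an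
  event of probability at least one half on which, for all \<open>k \<ge> 1\<close> with \<open>\<mu>(2^(k+2)) > 0\<close>, more than
  \<open>2^k\<close> of the numbers \<open>\<bar>f j\<bar>\<close> exceed \<open>\<mu>(2^(k+2)) / 2\<close>. On that event the sequence \<open>\<mu>(1), \<mu>(2), \<dots>\<close> is
  dominated, up to a dilation, by the sample itself together with one entry \<open>\<mu>(1)\<close>.

  For the converse inequality, assume the condition on \<open>K\<close> (\<open>johnson_schechtman_upper\<close>). Cut every
  \<open>f k\<close> at the level \<open>\<mu>(1)\<close>. The entries above it are finite in number almost surely, and on finitely
  supported sequences the norm of \<open>E\<close> is bounded by an \<open>\<ell>\<^sub>p\<close> norm with \<open>p\<close> small
  (\<open>finite_support_lp_bound\<close>). The sum of their \<open>p\<close>-th powers is a sum of independent variables; if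
  \<open>\<nu>\<close> denotes the sum of their laws off zero, its law is at most the convolution exponential of \<open>\<nu>\<close>
  (\<open>indep_sum_exponential_bound\<close>: each factor satisfies \<open>\<delta>\<^sub>0 + \<nu>\<^sub>k \<le> exp \<nu>\<^sub>k\<close>). Since \<open>\<nu>\<close> has mass at
  most one, this is at most \<open>e\<close> times the law of \<open>K \<phi>\<close>, where \<open>\<phi>\<close> has law \<open>\<nu>\<close> off zero, and \<open>K\<close> is
  bounded on the power of \<open>X\<close> (\<open>kruglov_bounded\<close>). Below the level \<open>\<mu>(1)\<close>, a Chernoff bound gives a
  random \<open>J\<close> with \<open>P(J > j) \<le> 2 / (2^j)!\<close> such that for every \<open>i\<close> at most \<open>2^(i+2J+4)\<close> entries exceed
  \<open>\<mu>(2^i)\<close>. Hence, with a constant \<open>R\<close> depending on \<open>E\<close>, the norm of these entries is at most \<open>R^J\<close> times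
  that of \<open>\<mu>(1), \<mu>(2), \<dots>\<close>, up to a constant factor, and \<open>R^J\<close> is dominated by a power of the Poisson variable \<open>K 1\<close>
  (\<open>geometric_majorant\<close>).

  In the other direction the equivalence is applied to \<open>E = \<ell>\<^sub>p\<close> and to independent functions
  \<open>f' k\<close> that have the law of \<open>\<bar>f\<bar>^(1/p)\<close> with probability \<open>q k\<close> and vanish otherwise, where \<open>q 0 = 1\<close>
  and \<open>q k = 1 / (2k (2k+1))\<close>. The right-hand side is finite because \<open>(\<Sum>k. q k) \<le> 2\<close>. The products
  of the \<open>q k\<close> are reciprocals of factorials, so that the number of initial indices at which the
  first alternative occurs is comparable with half a Poisson variable; this gives
  \<open>P(K \<bar>f\<bar> > 2s) \<le> 2 * P((\<Sum>k. \<bar>f' k\<bar>^p) > s)\<close> and hence the claim (\<open>kruglov_maps_power_space\<close>).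
\<close>

section \<open>Distribution functions and rearrangements\<close>

lemma prob_space_unit_interval: "prob_space unit_interval"
  by (rule prob_spaceI) (simp add: emeasure_restrict_space space_restrict_space)

interpretation unit: prob_space unit_interval
  by (rule prob_space_unit_interval)

lemma emeasure_unit_interval:
  "S \<subseteq> {0<..<1} \<Longrightarrow> emeasure unit_interval S = emeasure lebesgue S"
  by (simp add: emeasure_restrict_space)

lemma sets_unit_interval_iff: "S \<in> sets unit_interval \<longleftrightarrow> S \<subseteq> {0<..<1} \<and> S \<in> sets lebesgue"
  by (subst sets_restrict_space_iff) auto

lemma distribution_fn_antimono:
  assumes "f \<in> borel_measurable M" "s \<le> s'"
  shows "distribution_fn M f s' \<le> distribution_fn M f s"
  unfolding distribution_fn_def using assms by (intro emeasure_mono) auto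

text \<open>
  Right continuity, in the form of a bound that survives the limit \<open>l \<down> s\<close>; it
  needs only continuity of the measure from below and so holds for infinite values too.
\<close>

lemma distribution_fn_right_continuous:
  assumes f[measurable]: "f \<in> borel_measurable M" and le: "\<And>l. s < l \<Longrightarrow> distribution_fn M f l \<le> c"
  shows "distribution_fn M f s \<le> c"
proof -
  let ?A = "\<lambda>n::nat. {x \<in> space M. \<bar>f x\<bar> > s + 1 / real (Suc n)}"
  have eq: "{x \<in> space M. \<bar>f x\<bar> > s} = (\<Union>n. ?A n)"
  proof (intro equalityI subsetI)
    fix x assume x: "x \<in> {x \<in> space M. \<bar>f x\<bar> > s}"
    then obtain n where "1 / real (Suc n) < \<bar>f x\<bar> - s"
      using reals_Archimedean[of "\<bar>f x\<bar> - s"] by (auto simp: inverse_eq_divide)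
    with x show "x \<in> (\<Union>n. ?A n)" by (auto intro!: exI[of _ n])
  next
    fix x assume "x \<in> (\<Union>n. ?A n)"
    then obtain n where x: "x \<in> space M" "\<bar>f x\<bar> > s + 1 / real (Suc n)" by auto
    moreover have "1 / real (Suc n) > 0" by simp
    ultimately have "\<bar>f x\<bar> > s" by linarith
    with x show "x \<in> {x \<in> space M. \<bar>f x\<bar> > s}" by simp
  qed
  have "incseq ?A"
  proof (rule incseq_SucI)
    fix n
    have "1 / real (Suc (Suc n)) \<le> 1 / real (Suc n)" by (simp add: frac_le)
    then show "?A n \<le> ?A (Suc n)" by (auto simp del: of_nat_Suc)
  qed
  then have "distribution_fn M f s = (SUP n. emeasure M (?A n))"
    unfolding distribution_fn_def eq by (subst SUP_emeasure_incseq) auto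
  also have "\<dots> \<le> c"
  proof (rule SUP_least)
    fix n show "emeasure M (?A n) \<le> c"
      using le[of "s + 1 / real (Suc n)"] by (simp add: distribution_fn_def)
  qed
  finally show ?thesis .
qed

text \<open>
  Together with the next lemma, this is the generalised inverse relation \<open>\<mu> t > s
  \<Longrightarrow> d s \<ge> t\<close> and \<open>d s > t \<Longrightarrow> \<mu> t > s\<close>.
  The two differ at \<open>d s = t\<close>, which is why superlevel sets of \<open>\<mu>\<close>
  are determined up to one endpoint only.
\<close>

lemma distribution_fn_ge_of_less_rearrangement:
  assumes "0 \<le> s" "ennreal s < rearrangement M f t"
  shows "ennreal t \<le> distribution_fn M f s"
proof (rule ccontr)
  assume "\<not> ?thesis"
  then have "s \<in> {l. 0 \<le> l \<and> distribution_fn M f l < ennreal t}" using assms by auto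
  then have "rearrangement M f t \<le> ennreal s"
    unfolding rearrangement_def by (rule INF_lower)
  with assms show False by auto
qed

lemma distribution_fn_le_of_rearrangement_le:
  assumes f: "f \<in> borel_measurable M" and "0 \<le> s" "rearrangement M f t \<le> ennreal s"
  shows "distribution_fn M f s \<le> ennreal t"
proof (rule distribution_fn_right_continuous[OF f])
  fix l assume "s < l"
  then have "rearrangement M f t < ennreal l" using assms
    by (meson ennreal_lessI le_less_trans dual_order.strict_trans1)
  then obtain l' where l': "0 \<le> l'" "distribution_fn M f l' < ennreal t" "ennreal l' < ennreal l"
    unfolding rearrangement_def by (auto simp: INF_less_iff)
  then have "l' \<le> l" by (metis ennreal_leI leD linear)
  then show "distribution_fn M f l \<le> ennreal t"
    using distribution_fn_antimono[OF f, of l' l] l' by auto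
qed

lemma rearrangement_antimono: "t \<le> t' \<Longrightarrow> rearrangement M f t' \<le> rearrangement M f t"
  unfolding rearrangement_def
  by (intro INF_superset_mono) (auto intro: less_le_trans ennreal_leI)

lemma rearrangement_mono:
  assumes "\<And>s. 0 \<le> s \<Longrightarrow> distribution_fn M f s \<le> distribution_fn M' g s"
  shows "rearrangement M f t \<le> rearrangement M' g t"
  unfolding rearrangement_def
  using assms by (intro INF_superset_mono) (auto intro: le_less_trans)

text \<open>
  The superlevel set is an interval with left end \<open>0\<close> and right end \<open>d
  s\<close>, cut at \<open>1\<close>.
\<close>

lemma rearrangement_superlevel:
  fixes M f s
  assumes f: "f \<in> borel_measurable M" and s: "0 \<le> s"
  defines "S \<equiv> {t \<in> {0<..<1}. ennreal s < rearrangement M f t}"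
  shows "S \<in> sets unit_interval" "emeasure unit_interval S = min 1 (distribution_fn M f s)"
proof -
  let ?d = "distribution_fn M f s"
  have lower: "t \<in> S" if "t \<in> {0<..<1}" "ennreal t < ?d" for t
    using distribution_fn_le_of_rearrangement_le[OF f s, of t] that by (force simp: S_def)
  have upper: "ennreal t \<le> ?d" if "t \<in> S" for t
    using distribution_fn_ge_of_less_rearrangement[OF s] that by (auto simp: S_def)
  have "S \<in> sets unit_interval \<and> emeasure unit_interval S = min 1 ?d"
  proof (cases "1 \<le> ?d")
    case True
    have "t \<in> S" if "t \<in> {0<..<1}" for t
      using that True by (intro lower) (auto intro!: less_le_trans[OF _ True] simp: ennreal_less_one_iff)
    then have "S = {0<..<1}" by (auto simp: S_def)
    then show ?thesis using True by (simp add: sets_unit_interval_iff emeasure_unit_interval min_def)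
  next
    case False
    then obtain r where r: "?d = ennreal r" "0 \<le> r" "r < 1"
      by (cases ?d) (auto simp: ennreal_less_one_iff not_le ennreal_1[symmetric] ennreal_le_iff simp del: ennreal_1)
    have 1: "{0<..<r} \<subseteq> S" using r by (auto intro!: lower simp: ennreal_less_iff)
    have 2: "S \<subseteq> {0<..r}" using upper r by (auto simp: S_def)
    from 1 2 have "S = {0<..<r} \<union> (S \<inter> {r})" by auto
    moreover have "S \<inter> {r} \<in> sets lebesgue" by (cases "r \<in> S") auto
    then have "{0<..<r} \<union> (S \<inter> {r}) \<in> sets lebesgue"
      by (intro sets.Un) auto
    ultimately have S: "S \<in> sets lebesgue" by simp
    have "ennreal r \<le> emeasure lebesgue S"
      using emeasure_mono[OF 1 S] r by simp
    moreover have "emeasure lebesgue S \<le> ennreal r"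
      using emeasure_mono[OF 2, of lebesgue] r by simp
    moreover have "S \<subseteq> {0<..<1}" by (auto simp: S_def)
    ultimately show ?thesis using S False r
      by (auto simp: sets_unit_interval_iff emeasure_unit_interval min_def)
  qed
  then show "S \<in> sets unit_interval" "emeasure unit_interval S = min 1 ?d" by auto
qed

lemma rearrangement_finiteI:
  assumes "0 \<le> l" "distribution_fn M f l < ennreal t"
  shows "rearrangement M f t < \<infinity>"
proof -
  have "rearrangement M f t \<le> ennreal l"
    unfolding rearrangement_def using assms by (intro INF_lower) auto
  then show ?thesis by (simp add: le_less_trans)
qed

lemma distribution_fn_unit_vanishes:
  assumes f[measurable]: "f \<in> borel_measurable unit_interval" and "0 < e"
  shows "\<exists>l\<ge>0. distribution_fn unit_interval f l < ennreal e"
proof -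
  let ?A = "\<lambda>n::nat. {x \<in> space unit_interval. \<bar>f x\<bar> > real n}"
  have "?A n \<in> sets unit_interval" for n by measurable
  then have "(\<lambda>n. measure unit_interval (?A n)) \<longlonglongrightarrow> measure unit_interval (\<Inter>n. ?A n)"
    by (intro unit.finite_Lim_measure_decseq) (auto simp: decseq_def simp del: space_lebesgue_on)
  moreover have "(\<Inter>n. ?A n) = {}"
  proof -
    have False if "x \<in> (\<Inter>n. ?A n)" for x
    proof -
      obtain n where "\<bar>f x\<bar> < real n" using reals_Archimedean2 by blast
      moreover have "real n < \<bar>f x\<bar>" using that by auto
      ultimately show False by simp
    qed
    then show ?thesis by blast
  qed
  ultimately have "\<forall>\<^sub>F n in sequentially. measure unit_interval (?A n) < e"
    using \<open>0 < e\<close> by (auto intro: order_tendstoD)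
  then obtain n where "measure unit_interval (?A n) < e" by (auto simp: eventually_sequentially)
  then have "distribution_fn unit_interval f (real n) < ennreal e"
    unfolding distribution_fn_def unit.emeasure_eq_measure using \<open>0 < e\<close> by (simp add: ennreal_lessI)
  then show ?thesis by (intro exI[of _ "real n"]) auto
qed

text \<open>
  The rearrangement as a real function. It equals \<open>0\<close> where the rearrangement is
  infinite, in particular at \<open>t = 0\<close>; it is used only where the rearrangement is
  finite on \<open>(0,\<infinity>)\<close>.
\<close>

definition decreasing_fun :: "'a measure \<Rightarrow> ('a \<Rightarrow> real) \<Rightarrow> real \<Rightarrow> real" where
  "decreasing_fun M f t = enn2real (rearrangement M f t)"

lemma less_decreasing_fun_iff:
  assumes "rearrangement M f t < \<infinity>" "0 \<le> s"
  shows "s < decreasing_fun M f t \<longleftrightarrow> ennreal s < rearrangement M f t"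
  using assms unfolding decreasing_fun_def
  by (cases "rearrangement M f t") (auto simp: ennreal_less_iff)

lemma
  assumes f: "f \<in> borel_measurable M" and fin: "\<And>t. 0 < t \<Longrightarrow> rearrangement M f t < \<infinity>"
  shows decreasing_fun_measurable: "decreasing_fun M f \<in> borel_measurable unit_interval"
    and distribution_fn_decreasing_fun:
      "\<And>s. 0 \<le> s \<Longrightarrow> distribution_fn unit_interval (decreasing_fun M f) s = min 1 (distribution_fn M f s)"
proof -
  have eq: "{t \<in> space unit_interval. s < decreasing_fun M f t} =
      {t \<in> {0<..<1}. ennreal s < rearrangement M f t}" if "0 \<le> s" for s
    using that fin by (auto simp: space_restrict_space less_decreasing_fun_iff)
  show "decreasing_fun M f \<in> borel_measurable unit_interval"
    unfolding borel_measurable_iff_greater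
  proof
    fix s show "{t \<in> space unit_interval. s < decreasing_fun M f t} \<in> sets unit_interval"
    proof (cases "0 \<le> s")
      case True then show ?thesis using rearrangement_superlevel(1)[OF f] eq by simp
    next
      case False
      then have "{t \<in> space unit_interval. s < decreasing_fun M f t} = space unit_interval"
        by (auto simp: decreasing_fun_def intro: less_le_trans[OF _ enn2real_nonneg])
      then show ?thesis by simp
    qed
  qed
  fix s :: real assume "0 \<le> s"
  have "\<bar>decreasing_fun M f t\<bar> = decreasing_fun M f t" for t by (simp add: decreasing_fun_def)
  then show "distribution_fn unit_interval (decreasing_fun M f) s = min 1 (distribution_fn M f s)"
    using rearrangement_superlevel(2)[OF f \<open>0 \<le> s\<close>] eq[OF \<open>0 \<le> s\<close>]
    by (simp add: distribution_fn_def)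
qed

lemma affine_measurable_lebesgue:
  "c \<noteq> 0 \<Longrightarrow> (\<lambda>x::real. a + c * x) \<in> lebesgue \<rightarrow>\<^sub>M lebesgue"
  using lebesgue_affine_measurable[where c = "\<lambda>x::real. c" and t = a] by simp

lemma affine_measurable_unit_interval:
  assumes "c \<noteq> 0" "(\<lambda>x::real. a + c * x) ` S \<subseteq> {0<..<1}"
  shows "(\<lambda>x. a + c * x) \<in> lebesgue_on S \<rightarrow>\<^sub>M unit_interval"
  using assms by (intro measurable_restrict_space3 affine_measurable_lebesgue) auto

text \<open>
  Reflection serves to place a second copy of a decreasing function at the other end of the
  interval.
\<close>

lemma emeasure_unit_interval_reflect:
  assumes S: "S \<in> sets unit_interval"
  shows "emeasure unit_interval {t \<in> {0<..<1}. 1 - t \<in> S} = emeasure unit_interval S"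
    (is "emeasure _ ?R = _")
proof -
  have S': "S \<subseteq> {0<..<1}" "S \<in> sets lebesgue" using S by (auto simp: sets_unit_interval_iff)
  have "?R = (\<lambda>x. 1 + (-1) * x) -` S \<inter> space lebesgue" using S' by auto
  also have "\<dots> \<in> sets lebesgue"
    by (rule measurable_sets[OF affine_measurable_lebesgue S'(2)]) simp
  finally have R: "?R \<in> sets lebesgue" .
  have "emeasure lebesgue S = (\<integral>\<^sup>+x. indicator S (1 + (-1) * x) \<partial>lebesgue)"
    using nn_integral_real_affine_lebesgue[of "indicator S" "-1" 1] S' by simp
  also have "\<dots> = (\<integral>\<^sup>+x. indicator ?R x \<partial>lebesgue)"
    using S' by (intro nn_integral_cong) (auto simp: indicator_def)
  also have "\<dots> = emeasure lebesgue ?R" using R by simp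
  finally have "emeasure lebesgue ?R = emeasure lebesgue S" ..
  moreover have "?R \<subseteq> {0<..<1}" by auto
  ultimately show ?thesis using S' by (simp only: emeasure_unit_interval)
qed

lemma distribution_fn_le_1: "distribution_fn unit_interval f s \<le> 1"
  unfolding distribution_fn_def unit.emeasure_eq_measure by (simp add: unit.prob_le_1)

section \<open>Quasi-norms\<close>

context quasi_banach_space begin

lemma quasi_triangle_constant:
  obtains C where "1 \<le> C" "\<And>f g. f \<in> V \<Longrightarrow> g \<in> V \<Longrightarrow> N (\<lambda>x. f x + g x) \<le> C * (N f + N g)"
proof -
  obtain C where C: "\<forall>f\<in>V. \<forall>g\<in>V. N (\<lambda>x. f x + g x) \<le> C * (N f + N g)"
    using quasi_triangle by blast
  show ?thesis
  proof (rule that[of "max 1 C"])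
    fix f g assume "f \<in> V" "g \<in> V"
    then show "N (\<lambda>x. f x + g x) \<le> max 1 C * (N f + N g)"
      using C nonneg by (intro order_trans[OF C[rule_format]] mult_right_mono) auto
  qed auto
qed

lemma diff_mem: "f \<in> V \<Longrightarrow> g \<in> V \<Longrightarrow> (\<lambda>x. f x - g x) \<in> V"
  using add_mem[OF _ scale_mem[of g "-1"], of f] by simp

lemma sum_mem: "(\<And>i::nat. i < n \<Longrightarrow> u i \<in> V) \<Longrightarrow> (\<lambda>x. \<Sum>i<n. u i x) \<in> V"
proof (induction n)
  case (Suc n)
  then show ?case using add_mem[of "\<lambda>x. \<Sum>i<n. u i x" "u n"] by simp
qed (simp add: zero_mem)

lemma quasi_norm_zero: "N (\<lambda>x. 0) = 0"
  using homogeneous[OF zero_mem, of 0] by simp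

text \<open>
  Splitting off the first summand each time lets the powers of \<open>C\<close> grow with the
  index, so that sums of geometrically decreasing terms stay under control.
\<close>

lemma quasi_norm_sum_le:
  assumes C: "1 \<le> C" "\<And>f g. f \<in> V \<Longrightarrow> g \<in> V \<Longrightarrow> N (\<lambda>x. f x + g x) \<le> C * (N f + N g)"
    and u: "\<And>i::nat. i < n \<Longrightarrow> u i \<in> V"
  shows "N (\<lambda>x. \<Sum>i<n. u i x) \<le> (\<Sum>i<n. C ^ Suc i * N (u i))"
  using u
proof (induction n arbitrary: u)
  case 0 then show ?case by (simp add: quasi_norm_zero)
next
  case (Suc n)
  have "N (\<lambda>x. \<Sum>i<Suc n. u i x) = N (\<lambda>x. u 0 x + (\<Sum>i<n. u (Suc i) x))"
    by (simp only: sum.lessThan_Suc_shift)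
  also have "\<dots> \<le> C * (N (u 0) + N (\<lambda>x. \<Sum>i<n. u (Suc i) x))"
    using Suc.prems by (intro C sum_mem) auto
  also have "\<dots> \<le> C * (N (u 0) + (\<Sum>i<n. C ^ Suc i * N (u (Suc i))))"
    using C Suc.prems by (intro mult_left_mono add_left_mono Suc.IH) auto
  also have "\<dots> = (\<Sum>i<Suc n. C ^ Suc i * N (u i))"
    by (simp only: sum.lessThan_Suc_shift) (simp add: sum_distrib_left algebra_simps)
  finally show ?case .
qed

end

section \<open>Symmetric function spaces\<close>

context symmetric_fun_space begin

lemma mem_measurable: "f \<in> X \<Longrightarrow> f \<in> borel_measurable unit_interval"
  using carrier_measurable by blast

text \<open>
  Both functions are replaced by their decreasing rearrangements, which are equimeasurable with
  them and comparable pointwise.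
\<close>

lemma dominated:
  assumes h: "h \<in> X" and g: "g \<in> borel_measurable unit_interval"
    and le: "\<And>s. 0 \<le> s \<Longrightarrow> distribution_fn unit_interval g s \<le> distribution_fn unit_interval h s"
  shows "g \<in> X \<and> N g \<le> N h"
proof -
  note hm = mem_measurable[OF h]
  have fin: "rearrangement unit_interval f t < \<infinity>" if "f \<in> borel_measurable unit_interval" "0 < t" for f t
    using distribution_fn_unit_vanishes[OF that] rearrangement_finiteI by blast
  let ?h = "decreasing_fun unit_interval h" and ?g = "decreasing_fun unit_interval g"
  have 1: "min 1 (distribution_fn unit_interval f s) = distribution_fn unit_interval f s" for f s
    unfolding distribution_fn_def unit.emeasure_eq_measure
    by (simp add: min_absorb2 unit.prob_le_1)
  have eqh: "\<forall>t>0. rearrangement unit_interval ?h t = rearrangement unit_interval h t"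
    unfolding rearrangement_def
    by (auto intro!: INF_cong simp: distribution_fn_decreasing_fun[OF hm fin[OF hm]] 1)
  have eqg: "\<forall>t>0. rearrangement unit_interval g t = rearrangement unit_interval ?g t"
    unfolding rearrangement_def
    by (auto intro!: INF_cong simp: distribution_fn_decreasing_fun[OF g fin[OF g]] 1)
  have h': "?h \<in> X" "N ?h = N h"
    using symmetric[OF h decreasing_fun_measurable[OF hm fin[OF hm]] eqh] by auto
  have "\<bar>?g t\<bar> \<le> \<bar>?h t\<bar>" if "0 < t" for t
    using rearrangement_mono[OF le, of t] fin[OF hm that]
    by (auto simp: decreasing_fun_def intro!: enn2real_mono)
  then have "AE t in unit_interval. \<bar>?g t\<bar> \<le> \<bar>?h t\<bar>"
    by (intro AE_I2) (auto simp: space_restrict_space)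
  with ideal[OF h'(1) decreasing_fun_measurable[OF g fin[OF g]]]
  have g': "?g \<in> X" "N ?g \<le> N ?h" by auto
  show ?thesis using symmetric[OF g'(1) g eqg] g' h' by auto
qed

text \<open>
  The function \<open>z t = h\<^sup>*(t) + h\<^sup>*(1 - t)\<close> works: its superlevel sets
  contain an interval of length \<open>d\<^sub>h s\<close> at each end of \<open>(0,1)\<close>.
\<close>

lemma doubling:
  assumes C: "\<And>f g. f \<in> X \<Longrightarrow> g \<in> X \<Longrightarrow> N (\<lambda>x. f x + g x) \<le> C * (N f + N g)" "1 \<le> C"
    and h: "h \<in> X"
  shows "\<exists>z\<in>X. N z \<le> 2 * C * N h \<and>
    (\<forall>s\<ge>0. min 1 (2 * distribution_fn unit_interval h s) \<le> distribution_fn unit_interval z s)"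
proof -
  note hm = mem_measurable[OF h]
  have fin: "rearrangement unit_interval h t < \<infinity>" if "0 < t" for t
    using distribution_fn_unit_vanishes[OF hm that] rearrangement_finiteI by blast
  define k where "k = decreasing_fun unit_interval h"
  define w where "w = (\<lambda>t. k (1 - t))"
  note km = decreasing_fun_measurable[OF hm fin, folded k_def]
  have dk: "distribution_fn unit_interval k s = distribution_fn unit_interval h s" if "0 \<le> s" for s
    using distribution_fn_decreasing_fun[OF hm fin that] distribution_fn_le_1[of h s]
    by (simp add: min_absorb2 k_def)
  have kX: "k \<in> X" "N k \<le> N h" using dominated[OF h km] dk by auto
  have "(\<lambda>t::real. 1 + (-1) * t) \<in> unit_interval \<rightarrow>\<^sub>M unit_interval"
    by (rule affine_measurable_unit_interval) auto
  from measurable_compose[OF this km] have wm: "w \<in> borel_measurable unit_interval"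
    by (simp add: w_def)
  have dw: "distribution_fn unit_interval w s = distribution_fn unit_interval h s" if "0 \<le> s" for s
  proof -
    have "{t \<in> space unit_interval. \<bar>w t\<bar> > s} =
        {t \<in> {0<..<1}. 1 - t \<in> {t \<in> space unit_interval. \<bar>k t\<bar> > s}}"
      by (auto simp: w_def space_restrict_space)
    moreover have "{t \<in> space unit_interval. \<bar>k t\<bar> > s} \<in> sets unit_interval"
      using km by measurable
    ultimately have "distribution_fn unit_interval w s = distribution_fn unit_interval k s"
      unfolding distribution_fn_def by (simp only: emeasure_unit_interval_reflect)
    then show ?thesis using dk[OF that] by simp
  qed
  have wX: "w \<in> X" "N w \<le> N h" using dominated[OF h wm] dw by auto
  let ?z = "\<lambda>t. k t + w t"
  have zX: "?z \<in> X" by (rule add_mem[OF kX(1) wX(1)])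
  have "N ?z \<le> C * (N k + N w)" by (rule C(1)[OF kX(1) wX(1)])
  also have "\<dots> \<le> C * (N h + N h)" using kX wX C by (intro mult_left_mono add_mono) auto
  finally have Nz: "N ?z \<le> 2 * C * N h" by simp
  have k0: "0 \<le> k t" for t by (simp add: k_def decreasing_fun_def)
  have "min 1 (2 * distribution_fn unit_interval h s) \<le> distribution_fn unit_interval ?z s" if s: "0 \<le> s" for s
  proof -
    obtain r where r: "distribution_fn unit_interval h s = ennreal r" "0 \<le> r" "r \<le> 1"
      using distribution_fn_le_1[of h s]
      by (cases "distribution_fn unit_interval h s") (auto simp: top_unique)
    have less: "s < k t" if "0 < t" "t < r" for t
    proof -
      have "\<not> rearrangement unit_interval h t \<le> ennreal s"
        using distribution_fn_le_of_rearrangement_le[OF hm s, of t] that r by auto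
      then show ?thesis unfolding k_def using less_decreasing_fun_iff[OF fin s, of t] that by auto
    qed
    \<comment> \<open>The two intervals cover everything once \<open>2 r > 1\<close>.\<close>
    let ?U = "{0<..<r} \<union> {1 - r<..<1}"
    have "?U \<subseteq> {t \<in> space unit_interval. \<bar>k t + w t\<bar> > s}"
    proof
      fix t assume t: "t \<in> ?U"
      then have "s < k t \<or> s < w t" using less[of t] less[of "1 - t"] by (auto simp: w_def)
      then have "s < k t + w t" using k0[of t] k0[of "1 - t"] by (auto simp: w_def)
      then show "t \<in> {t \<in> space unit_interval. \<bar>k t + w t\<bar> > s}"
        using t r k0[of t] k0[of "1 - t"] by (auto simp: space_restrict_space w_def)
    qed
    then have "emeasure unit_interval ?U \<le> distribution_fn unit_interval ?z s"
      unfolding distribution_fn_def using km wm by (intro emeasure_mono) measurable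
    moreover have "min 1 (2 * ennreal r) \<le> emeasure unit_interval ?U"
    proof (cases "2 * r \<le> 1")
      case True
      have "emeasure unit_interval ?U = emeasure lebesgue {0<..<r} + emeasure lebesgue {1 - r<..<1}"
        using r True by (subst emeasure_unit_interval) (auto intro!: plus_emeasure[symmetric] simp del: emeasure_completion)
      also have "\<dots> = 2 * ennreal r" using r by (simp add: mult_2)
      finally show ?thesis by (simp only: min.cobounded2)
    next
      case False
      then have "{0<..<1/2} \<union> {1/2..<1} \<subseteq> ?U" by auto
      then have "{0<..<1} \<subseteq> ?U" using False by force
      then have "?U = {0<..<1}" using r by auto
      then show ?thesis by (simp add: emeasure_unit_interval)
    qed
    ultimately show ?thesis using r by auto
  qed
  with zX Nz show ?thesis by blast
qed

lemma dilation_power: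
  assumes C: "\<And>f g. f \<in> X \<Longrightarrow> g \<in> X \<Longrightarrow> N (\<lambda>x. f x + g x) \<le> C * (N f + N g)" "1 \<le> C"
    and h: "h \<in> X" and g: "g \<in> borel_measurable unit_interval"
    and le: "\<And>s. 0 \<le> s \<Longrightarrow> distribution_fn unit_interval g s \<le> 2 ^ n * distribution_fn unit_interval h s"
  shows "g \<in> X \<and> N g \<le> (2 * C) ^ n * N h"
  using h le
proof (induction n arbitrary: h)
  case 0
  then show ?case using dominated[OF 0(1) g] by simp
next
  case (Suc n)
  obtain z where z: "z \<in> X" "N z \<le> 2 * C * N h"
    and dz: "\<And>s. 0 \<le> s \<Longrightarrow> min 1 (2 * distribution_fn unit_interval h s) \<le> distribution_fn unit_interval z s"
    using doubling[OF C Suc.prems(1)] by blast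
  have "distribution_fn unit_interval g s \<le> 2 ^ n * distribution_fn unit_interval z s" if s: "0 \<le> s" for s
  proof -
    let ?d = "distribution_fn unit_interval h s"
    have "(1::ennreal) \<le> 2 ^ n" by (simp add: one_le_power)
    then have "distribution_fn unit_interval g s \<le> 2 ^ n"
      using distribution_fn_le_1[of g s] by (rule order_trans[rotated])
    moreover have "distribution_fn unit_interval g s \<le> 2 ^ n * (2 * ?d)"
      using Suc.prems(2)[OF s] by (simp add: mult_ac)
    ultimately have "distribution_fn unit_interval g s \<le> 2 ^ n * min 1 (2 * ?d)"
      by (auto simp: min_def)
    also have "\<dots> \<le> 2 ^ n * distribution_fn unit_interval z s"
      by (intro mult_left_mono dz s) auto
    finally show ?thesis .
  qed
  from Suc.IH[OF z(1) this] have *: "g \<in> X" "N g \<le> (2 * C) ^ n * N z" by auto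
  have "(2 * C) ^ n * N z \<le> (2 * C) ^ n * (2 * C * N h)"
    using z C by (intro mult_left_mono) auto
  with * show ?case by (simp add: mult_ac)
qed

text \<open>
  A constant for the boundedness of dilation operators, phrased with distribution functions.
\<close>

definition dilation_bound :: "real \<Rightarrow> real \<Rightarrow> bool" where
  "dilation_bound c D \<longleftrightarrow> (\<forall>h\<in>X. \<forall>g\<in>borel_measurable unit_interval.
     (\<forall>s\<ge>0. distribution_fn unit_interval g s \<le> ennreal c * distribution_fn unit_interval h s) \<longrightarrow>
     g \<in> X \<and> N g \<le> D * N h)"

lemma dilation_boundD:
  assumes "dilation_bound c D" "h \<in> X" "g \<in> borel_measurable unit_interval"
    "\<And>s. 0 \<le> s \<Longrightarrow> distribution_fn unit_interval g s \<le> ennreal c * distribution_fn unit_interval h s"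
  shows "g \<in> X \<and> N g \<le> D * N h"
  using assms unfolding dilation_bound_def by blast

lemma dilation: "\<exists>D>0. dilation_bound c D"
proof -
  obtain C where C: "1 \<le> C" "\<And>f g. f \<in> X \<Longrightarrow> g \<in> X \<Longrightarrow> N (\<lambda>x. f x + g x) \<le> C * (N f + N g)"
    using quasi_triangle_constant by blast
  obtain n where n: "c < 2 ^ n" using real_arch_pow[of 2 c] by auto
  have "ennreal c \<le> ennreal (2 ^ n)" using n by (intro ennreal_leI) auto
  also have "\<dots> = 2 ^ n" by (simp flip: ennreal_power)
  finally have c: "ennreal c \<le> 2 ^ n" .
  have "dilation_bound c ((2 * C) ^ n)"
    unfolding dilation_bound_def
  proof (intro ballI impI)
    fix h g
    assume h: "h \<in> X" and g: "g \<in> borel_measurable unit_interval"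
      and le: "\<forall>s\<ge>0. distribution_fn unit_interval g s \<le> ennreal c * distribution_fn unit_interval h s"
    show "g \<in> X \<and> N g \<le> (2 * C) ^ n * N h"
    proof (rule dilation_power[OF C(2,1) h g])
      fix s :: real assume "0 \<le> s"
      with le have "distribution_fn unit_interval g s \<le> ennreal c * distribution_fn unit_interval h s" by blast
      also have "\<dots> \<le> 2 ^ n * distribution_fn unit_interval h s" by (intro mult_right_mono c) simp
      finally show "distribution_fn unit_interval g s \<le> 2 ^ n * distribution_fn unit_interval h s" .
    qed
  qed
  moreover have "0 < (2 * C) ^ n" using C by simp
  ultimately show ?thesis by blast
qed

text \<open>
  A constant \<open>v\<close> exceeded by \<open>\<bar>L\<bar>\<close> with probability one half
  is bounded by the norm of \<open>L\<close>. If the constants are not in \<open>X\<close>, then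
  \<open>v = 0\<close>.
\<close>

lemma constant_bound:
  obtains K where "0 \<le> K" "\<And>L v. L \<in> X \<Longrightarrow> 0 \<le> v \<Longrightarrow>
    1 / 2 \<le> emeasure unit_interval {t \<in> space unit_interval. v \<le> \<bar>L t\<bar>} \<Longrightarrow> v \<le> K * N L"
proof -
  obtain D where D: "0 < D" "dilation_bound 2 D"
    using dilation by blast
  have const: "(\<lambda>_. v) \<in> X \<and> N (\<lambda>_. v) \<le> D * N L"
    if L: "L \<in> X" "0 \<le> v" and half: "1 / 2 \<le> emeasure unit_interval {t \<in> space unit_interval. v \<le> \<bar>L t\<bar>}" for L v
  proof (rule dilation_boundD[OF D(2) L(1)])
    fix s :: real assume s: "0 \<le> s"
    note [measurable] = mem_measurable[OF L(1)]
    show "distribution_fn unit_interval (\<lambda>_. v) s \<le> ennreal 2 * distribution_fn unit_interval L s"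
    proof (cases "s < v")
      case True
      have "(1::ennreal) = 2 * (1 / 2)" by (simp add: ennreal_times_divide)
      also have "\<dots> \<le> 2 * emeasure unit_interval {t \<in> space unit_interval. v \<le> \<bar>L t\<bar>}"
        by (intro mult_left_mono half) auto
      also have "\<dots> \<le> 2 * distribution_fn unit_interval L s"
        unfolding distribution_fn_def using True
        by (intro mult_left_mono emeasure_mono) (force, measurable)
      finally show ?thesis using order_trans[OF distribution_fn_le_1] by simp
    next
      case False then show ?thesis using L by (simp add: distribution_fn_def)
    qed
  qed simp
  show ?thesis
  proof (cases "(\<lambda>_. 1) \<in> X")
    case True
    have "\<not> (AE x in unit_interval. (1::real) = 0)" by (simp add: unit.AE_False)
    then have pos: "0 < N (\<lambda>_. 1)" using nonneg[OF True] definite[OF True] by simp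
    show ?thesis
    proof (rule that[of "D / N (\<lambda>_. 1)"])
      show "0 \<le> D / N (\<lambda>_. 1)" using D pos by simp
      fix L v assume *: "L \<in> X" "0 \<le> v" "1 / 2 \<le> emeasure unit_interval {t \<in> space unit_interval. v \<le> \<bar>L t\<bar>}"
      have "v * N (\<lambda>_. 1) \<le> D * N L" using const[OF *] homogeneous[OF True, of v] *(2) by simp
      then show "v \<le> D / N (\<lambda>_. 1) * N L" using pos by (simp add: field_simps)
    qed
  next
    case False
    show ?thesis
    proof (rule that[of 0])
      fix L v assume *: "L \<in> X" "0 \<le> v" "1 / 2 \<le> emeasure unit_interval {t \<in> space unit_interval. v \<le> \<bar>L t\<bar>}"
      have "v = 0"
      proof (rule ccontr)
        assume "v \<noteq> 0"
        then show False using scale_mem[of "\<lambda>_. v" "1 / v"] const[OF *] False by simp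
      qed
      then show "v \<le> 0 * N L" by simp
    qed simp
  qed
qed

end

section \<open>Symmetric sequence spaces\<close>

abbreviation superlevel :: "(nat \<Rightarrow> real) \<Rightarrow> real \<Rightarrow> nat set" where
  "superlevel a s \<equiv> {k. \<bar>a k\<bar> > s}"

context symmetric_seq_space begin

text \<open>
  The hypothesis is restricted to the levels that \<open>a\<close> exceeds finitely often, since
  \<open>a\<close> need not tend to zero and \<open>card\<close> vanishes on infinite sets.
\<close>

lemma seq_dominated:
  assumes a: "a \<in> E"
    and le: "\<And>s. 0 \<le> s \<Longrightarrow> finite (superlevel a s) \<Longrightarrow>
      finite (superlevel b s) \<and> card (superlevel b s) \<le> card (superlevel a s)"
  shows "b \<in> E \<and> N b \<le> N a"
proof (rule symmetric[OF a])
  obtain l where l: "\<And>k. \<bar>a k\<bar> \<le> l" using carrier_bounded[OF a] by (auto simp: bounded_iff)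
  have l0: "0 \<le> l" using l[of 0] by simp
  have "superlevel a l = {}" using l by (auto simp: not_less)
  then have "superlevel b l = {}" using le[OF l0] by auto
  then have "\<bar>b k\<bar> \<le> l" for k by (auto simp: not_less)
  then show "bounded (range b)" by (auto simp: bounded_iff)
  show "\<forall>n. seq_rearrangement b n \<le> seq_rearrangement a n"
  proof
    fix n show "seq_rearrangement b n \<le> seq_rearrangement a n"
      unfolding seq_rearrangement_def
    proof (rule cInf_superset_mono)
      show "{l. 0 \<le> l \<and> finite (superlevel a l) \<and> card (superlevel a l) \<le> n} \<noteq> {}"
        using l0 \<open>superlevel a l = {}\<close> by (intro ex_in_conv[THEN iffD1] exI[of _ l]) simp
      show "bdd_below {l. 0 \<le> l \<and> finite (superlevel b l) \<and> card (superlevel b l) \<le> n}"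
        by (rule bdd_belowI[of _ 0]) auto
      show "{l. 0 \<le> l \<and> finite (superlevel a l) \<and> card (superlevel a l) \<le> n}
          \<subseteq> {l. 0 \<le> l \<and> finite (superlevel b l) \<and> card (superlevel b l) \<le> n}"
        using le by (auto intro: order_trans)
    qed
  qed
qed

lemma solid:
  assumes "a \<in> E" "\<And>k. \<bar>b k\<bar> \<le> \<bar>a k\<bar>"
  shows "b \<in> E \<and> N b \<le> N a"
proof (rule seq_dominated[OF assms(1)])
  fix s :: real assume "finite (superlevel a s)"
  moreover have "superlevel b s \<subseteq> superlevel a s" using assms(2) by (auto intro: less_le_trans)
  ultimately show "finite (superlevel b s) \<and> card (superlevel b s) \<le> card (superlevel a s)"
    by (auto intro: finite_subset card_mono)
qed

lemma coordinate_le: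
  assumes a: "a \<in> E"
  shows "\<bar>a k\<bar> \<le> N a"
proof -
  have "N (\<lambda>i. a k * indicator {k} i) \<le> N a"
    using solid[OF a, of "\<lambda>i. a k * indicator {k} i"] by (auto simp: indicator_def)
  then show ?thesis using homogeneous[of "indicator {k}" "a k"] unit_vectors[of k] by simp
qed

text \<open>
  Repeating every entry twice is a sum of two sequences, supported on the even and on the odd
  indices, each with the same rearrangement as \<open>a\<close>.
\<close>

lemma seq_doubling:
  assumes C: "\<And>f g. f \<in> E \<Longrightarrow> g \<in> E \<Longrightarrow> N (\<lambda>x. f x + g x) \<le> C * (N f + N g)" "1 \<le> C"
    and a: "a \<in> E"
  shows "(\<lambda>n. a (n div 2)) \<in> E \<and> N (\<lambda>n. a (n div 2)) \<le> 2 * C * N a"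
proof -
  define c0 where "c0 = (\<lambda>n. if even n then a (n div 2) else 0)"
  define c1 where "c1 = (\<lambda>n. if odd n then a (n div 2) else 0)"
  have c0: "superlevel c0 s = (\<lambda>k. 2 * k) ` superlevel a s" if "0 \<le> s" for s
    using that by (auto simp: c0_def image_iff elim!: evenE)
  have c1: "superlevel c1 s = (\<lambda>k. 2 * k + 1) ` superlevel a s" if "0 \<le> s" for s
    using that by (auto simp: c1_def image_iff elim!: oddE)
  have 0: "c0 \<in> E \<and> N c0 \<le> N a"
    by (rule seq_dominated[OF a]) (auto simp: c0 card_image inj_on_def)
  have 1: "c1 \<in> E \<and> N c1 \<le> N a"
    by (rule seq_dominated[OF a]) (auto simp: c1 card_image inj_on_def)
  have eq: "(\<lambda>n. a (n div 2)) = (\<lambda>n. c0 n + c1 n)" by (auto simp: c0_def c1_def)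
  have "N (\<lambda>n. c0 n + c1 n) \<le> C * (N c0 + N c1)" using C 0 1 by blast
  also have "\<dots> \<le> C * (N a + N a)" using C 0 1 by (intro mult_left_mono add_mono) auto
  finally show ?thesis unfolding eq using add_mem 0 1 by (auto simp: algebra_simps)
qed

lemma seq_dilation_power:
  assumes C: "\<And>f g. f \<in> E \<Longrightarrow> g \<in> E \<Longrightarrow> N (\<lambda>x. f x + g x) \<le> C * (N f + N g)" "1 \<le> C"
    and a: "a \<in> E"
    and le: "\<And>s. 0 \<le> s \<Longrightarrow> finite (superlevel a s) \<Longrightarrow>
      finite (superlevel b s) \<and> card (superlevel b s) \<le> 2 ^ n * card (superlevel a s)"
  shows "b \<in> E \<and> N b \<le> (2 * C) ^ n * N a"
  using a le
proof (induction n arbitrary: a)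
  case 0 then show ?case using seq_dominated[of a b] by simp
next
  case (Suc n)
  define c where "c = (\<lambda>n. a (n div 2))"
  have c: "c \<in> E" and Nc: "N c \<le> 2 * C * N a"
    using seq_doubling[OF C Suc.prems(1)] unfolding c_def by blast+
  have "finite (superlevel b s) \<and> card (superlevel b s) \<le> 2 ^ n * card (superlevel c s)"
    if s: "0 \<le> s" "finite (superlevel c s)" for s
  proof -
    have eq: "superlevel c s = (\<lambda>k. 2 * k) ` superlevel a s \<union> (\<lambda>k. 2 * k + 1) ` superlevel a s"
      unfolding c_def
    proof (intro equalityI subsetI)
      fix k assume k: "k \<in> superlevel (\<lambda>n. a (n div 2)) s"
      show "k \<in> (\<lambda>k. 2 * k) ` superlevel a s \<union> (\<lambda>k. 2 * k + 1) ` superlevel a s"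
      proof (cases "even k")
        case True
        then have "k = 2 * (k div 2)" by simp
        then show ?thesis using k by blast
      next
        case False
        then have "k = 2 * (k div 2) + 1" by simp
        then show ?thesis using k by blast
      qed
    qed auto
    have fin: "finite (superlevel a s)"
      using s(2) unfolding eq by (auto dest!: finite_imageD simp: inj_on_def)
    have "card (superlevel c s) = 2 * card (superlevel a s)"
      unfolding eq using fin
      by (subst card_Un_disjoint) (auto simp: card_image inj_on_def, presburger)
    then show ?thesis using Suc.prems(2)[OF s(1) fin] by simp
  qed
  note IH = Suc.IH[OF c this]
  have "0 \<le> (2 * C) ^ n" by (rule zero_le_power) (use C(2) in simp)
  then have "(2 * C) ^ n * N c \<le> (2 * C) ^ n * (2 * C * N a)"
    by (rule mult_left_mono[OF Nc])
  then have "N b \<le> (2 * C) ^ n * (2 * C * N a)" using IH by (blast intro: order_trans)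
  then have "N b \<le> (2 * C) ^ Suc n * N a" by (simp only: power_Suc2 mult.assoc)
  with IH show ?case by blast
qed

text \<open>
  Let \<open>A\<close> be the \<open>\<ell>\<^sub>p\<close> norm and \<open>r = 2 powr
  (1/p)\<close>. At most \<open>2 ^ (j + 1)\<close> entries lie between \<open>A / r^(j+1)\<close>
  and \<open>A / r^j\<close>, so by dilation this block has norm at most \<open>(2C)^(j+1) A /
  r^j\<close>. The choice \<open>r = 4 C\<^sup>2\<close> compensates both these powers and those
  lost in adding up the blocks.
\<close>

lemma finite_support_lp_bound:
  assumes C: "\<And>f g. f \<in> E \<Longrightarrow> g \<in> E \<Longrightarrow> N (\<lambda>x. f x + g x) \<le> C * (N f + N g)" "1 \<le> C"
    and p: "0 < p" "2 powr (1 / p) = 4 * C ^ 2"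
    and fin: "finite {k. a k \<noteq> 0}"
  shows "a \<in> E \<and> N a \<le> 4 * C ^ 2 * (\<Sum>k | a k \<noteq> 0. \<bar>a k\<bar> powr p) powr (1 / p)"
proof (cases "\<forall>k. a k = 0")
  case True
  then have "a = (\<lambda>_. 0)" by auto
  then show ?thesis using zero_mem quasi_norm_zero by simp
next
  case False
  define S where "S = {k. a k \<noteq> 0}"
  define T where "T = (\<Sum>k\<in>S. \<bar>a k\<bar> powr p)"
  define A where "A = T powr (1 / p)"
  define r where "r = 4 * C ^ 2"
  have r: "4 \<le> r" using C(2) by (simp add: r_def)
  have rp: "r powr p = 2" using p by (simp add: r_def powr_powr flip: p(2))
  have S: "finite S" "S \<noteq> {}" using fin False by (auto simp: S_def)
  have T: "0 < T" unfolding T_def using S by (intro sum_pos) (auto simp: S_def)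
  have A: "0 < A" "A powr p = T" using T p by (auto simp: A_def powr_powr)
  define B where "B j = {k. A / r ^ Suc j < \<bar>a k\<bar> \<and> \<bar>a k\<bar> \<le> A / r ^ j}" for j
  have BS: "B j \<subseteq> S" for j
  proof
    fix k assume "k \<in> B j"
    moreover have "0 < A / r ^ Suc j" using A r by (intro divide_pos_pos zero_less_power) auto
    ultimately show "k \<in> S" by (auto simp: B_def S_def)
  qed
  have cardB: "card (B j) \<le> 2 ^ Suc j" for j
  proof -
    have "real (card (B j)) * (A / r ^ Suc j) powr p = (\<Sum>k\<in>B j. (A / r ^ Suc j) powr p)" by simp
    also have "\<dots> \<le> (\<Sum>k\<in>B j. \<bar>a k\<bar> powr p)"
      using A r p by (intro sum_mono powr_mono2) (auto simp: B_def)
    also have "\<dots> \<le> T" unfolding T_def using BS S by (intro sum_mono2) auto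
    finally have "real (card (B j)) * (A / r ^ Suc j) powr p \<le> T" .
    moreover have "(A / r ^ Suc j) powr p = T / 2 ^ Suc j"
    proof -
      have "(r ^ Suc j) powr p = (r powr p) ^ Suc j"
        using r by (simp add: powr_powr powr_realpow[symmetric] mult.commute del: power_Suc)
      then show ?thesis using A r rp by (simp add: powr_divide)
    qed
    ultimately have "real (card (B j)) * (T / 2 ^ Suc j) \<le> T" by (simp only:)
    then have "real (card (B j)) \<le> 2 ^ Suc j" using T by (simp add: field_simps del: power_Suc)
    then have "real (card (B j)) \<le> real (2 ^ Suc j)" by simp
    then show ?thesis by (simp only: of_nat_le_iff)
  qed
  define u where "u j = (\<lambda>k. \<bar>a k\<bar> * indicator (B j) k)" for j
  have u: "u j \<in> E \<and> N (u j) \<le> (2 * C) ^ Suc j * (A / r ^ j)" for j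
  proof -
    define w where "w = A / r ^ j"
    have pos: "0 < w" using A r by (simp add: w_def)
    have Bw: "\<bar>a k\<bar> \<le> w" if "k \<in> B j" for k using that by (simp add: B_def w_def)
    let ?e = "\<lambda>k. w * indicator {0::nat} k"
    have e: "?e \<in> E" using scale_mem unit_vectors by blast
    have Ne: "N ?e = w"
      using homogeneous[of "indicator {0}" w] unit_vectors[of 0] pos by simp
    have "u j \<in> E \<and> N (u j) \<le> (2 * C) ^ Suc j * N ?e"
    proof (rule seq_dilation_power[OF C e])
      fix s :: real assume s: "0 \<le> s"
      have sub: "superlevel (u j) s \<subseteq> (if s < w then B j else {})"
      proof
        fix k assume k: "k \<in> superlevel (u j) s"
        then have "k \<in> B j" using s by (cases "k \<in> B j") (auto simp: u_def)
        then show "k \<in> (if s < w then B j else {})" using k Bw[of k] by (auto simp: u_def)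
      qed
      have e: "superlevel ?e s = (if s < w then {0} else {})"
        using s pos by (auto simp: indicator_def split: if_splits)
      have B: "finite (B j)" using BS S finite_subset by blast
      show "finite (superlevel (u j) s) \<and>
          card (superlevel (u j) s) \<le> 2 ^ Suc j * card (superlevel ?e s)"
      proof (cases "s < w")
        case True
        then have "finite (superlevel (u j) s)" "card (superlevel (u j) s) \<le> card (B j)"
          using sub B by (auto intro: finite_subset card_mono)
        then show ?thesis using cardB[of j] True e by simp
      next
        case False
        then have "superlevel (u j) s = {}" using sub by simp
        then show ?thesis by (simp only: finite.emptyI card.empty) simp
      qed
    qed
    then show ?thesis using Ne by (simp add: w_def)
  qed
  have "\<exists>n. \<forall>k\<in>S. A / r ^ n < \<bar>a k\<bar>"
  proof -
    have "\<forall>k\<in>S. \<forall>\<^sub>F n in sequentially. A / r ^ n < \<bar>a k\<bar>"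
    proof
      fix k assume "k \<in> S"
      have "(\<lambda>n. A * (1 / r) ^ n) \<longlonglongrightarrow> A * 0"
        using r by (intro tendsto_mult LIMSEQ_power_zero) auto
      then show "\<forall>\<^sub>F n in sequentially. A / r ^ n < \<bar>a k\<bar>"
        using \<open>k \<in> S\<close> by (auto intro!: order_tendstoD(2) simp: S_def power_divide)
    qed
    then have "\<forall>\<^sub>F n in sequentially. \<forall>k\<in>S. A / r ^ n < \<bar>a k\<bar>"
      using S by (intro eventually_ball_finite) auto
    then show ?thesis by (auto simp: eventually_sequentially)
  qed
  then obtain n where n: "\<And>k. k \<in> S \<Longrightarrow> A / r ^ n < \<bar>a k\<bar>" by blast
  have le: "\<bar>a k\<bar> \<le> \<bar>\<Sum>j<n. u j k\<bar>" for k
  proof (cases "k \<in> S")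
    case True
    define j where "j = (LEAST j. A / r ^ j < \<bar>a k\<bar>)"
    have j: "A / r ^ j < \<bar>a k\<bar>" unfolding j_def by (rule LeastI[of _ n]) (rule n[OF True])
    have jn: "j \<le> n" unfolding j_def by (rule Least_le) (rule n[OF True])
    have "j \<noteq> 0"
    proof
      assume "j = 0"
      then have "A < \<bar>a k\<bar>" using j by simp
      then have "T < \<bar>a k\<bar> powr p" using A p powr_less_mono2[of p A "\<bar>a k\<bar>"] by simp
      moreover have "\<bar>a k\<bar> powr p \<le> T" unfolding T_def using S True by (intro member_le_sum) auto
      ultimately show False by simp
    qed
    then obtain i where i: "j = Suc i" by (cases j) auto
    have "\<not> A / r ^ i < \<bar>a k\<bar>" using not_less_Least[of i "\<lambda>j. A / r ^ j < \<bar>a k\<bar>"] i by (simp add: j_def)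
    then have "k \<in> B i" using j i by (simp add: B_def)
    then have "\<bar>a k\<bar> = u i k" by (simp add: u_def)
    also have "\<dots> \<le> (\<Sum>j<n. u j k)" using jn i by (intro member_le_sum) (auto simp: u_def)
    finally show ?thesis by simp
  qed (auto simp: S_def)
  have sumE: "(\<lambda>k. \<Sum>j<n. u j k) \<in> E" using u by (intro sum_mem) auto
  have "N a \<le> N (\<lambda>k. \<Sum>j<n. u j k)" using solid[OF sumE le] by blast
  also have "\<dots> \<le> (\<Sum>j<n. C ^ Suc j * N (u j))"
    using u C by (intro quasi_norm_sum_le) auto
  also have "\<dots> \<le> (\<Sum>j<n. C ^ Suc j * ((2 * C) ^ Suc j * (A / r ^ j)))"
    using u C by (intro sum_mono mult_left_mono) auto
  also have "\<dots> = (\<Sum>j<n. 2 * C ^ 2 * A * (1 / 2) ^ j)"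
  proof (intro sum.cong refl)
    fix j
    have "r ^ j = 2 ^ j * (C ^ j * (2 * C) ^ j)"
      unfolding r_def power_mult_distrib[symmetric] by (simp add: power2_eq_square mult_ac)
    then show "C ^ Suc j * ((2 * C) ^ Suc j * (A / r ^ j)) = 2 * C ^ 2 * A * (1 / 2) ^ j"
      using C(2) by (simp add: field_simps power2_eq_square)
  qed
  also have "\<dots> = 2 * C ^ 2 * A * (\<Sum>j<n. (1 / 2) ^ j)" by (simp add: sum_distrib_left)
  also have "\<dots> \<le> 2 * C ^ 2 * A * 2"
  proof (intro mult_left_mono)
    have "(\<Sum>j<n. (1 / 2 :: real) ^ j) \<le> (\<Sum>j. (1 / 2) ^ j)"
      by (rule sum_le_suminf) (auto intro: summable_geometric)
    then show "(\<Sum>j<n. (1 / 2 :: real) ^ j) \<le> 2" by (simp add: suminf_geometric)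
  qed (use C A in auto)
  finally have "N a \<le> 4 * C ^ 2 * A" by simp
  moreover have "a \<in> E" using solid[OF sumE le] by blast
  ultimately show ?thesis by (simp add: A_def T_def S_def)
qed

end

section \<open>Disjoint sums\<close>

text \<open>
  On each interval \<open>(k, k + 1)\<close> the disjoint sum is a translate of \<open>f
  k\<close>; the integers form a null set.
\<close>

lemma
  fixes f :: "nat \<Rightarrow> real \<Rightarrow> real" and \<Psi> :: "real \<Rightarrow> ennreal"
  assumes f: "\<And>k. f k \<in> borel_measurable unit_interval"
  shows disjoint_sum_measurable: "disjoint_sum f \<in> borel_measurable (lebesgue_on {0<..})"
    and nn_integral_disjoint_sum: "\<Psi> \<in> borel_measurable borel \<Longrightarrow>
      (\<integral>\<^sup>+t. \<Psi> (disjoint_sum f t) \<partial>lebesgue_on {0<..}) = (\<Sum>k. \<integral>\<^sup>+t. \<Psi> (f k t) \<partial>unit_interval)"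
proof -
  define F where "F k = (\<lambda>t. f k t * indicator {0<..<1} t)" for k
  have F: "F k \<in> borel_measurable lebesgue" for k
    using f[of k] by (simp add: borel_measurable_restrict_space_iff F_def mult.commute)
  have shift: "(\<lambda>t::real. t - c) \<in> lebesgue \<rightarrow>\<^sub>M lebesgue" for c
    using affine_measurable_lebesgue[of 1 "- c"] by simp
  have F': "(\<lambda>t. F k (t - real k)) \<in> borel_measurable lebesgue" for k
    by (rule measurable_compose[OF shift F])
  have "disjoint_sum f = (\<lambda>t. \<Sum>k. F k (t - real k) + f k 0 * indicator {real k} t)"
    unfolding disjoint_sum_def F_def by (intro ext arg_cong[where f = suminf]) (auto simp: indicator_def)
  moreover have "(\<lambda>t. f k 0 * indicator {real k} t) \<in> borel_measurable lebesgue" for k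
    by (intro borel_measurable_times borel_measurable_const borel_measurable_indicator) auto
  ultimately have D: "disjoint_sum f \<in> borel_measurable lebesgue"
    using F' by (simp only:) (intro borel_measurable_suminf borel_measurable_add)
  then show "disjoint_sum f \<in> borel_measurable (lebesgue_on {0<..})"
    by (rule measurable_restrict_space1)
  assume \<Psi>[measurable]: "\<Psi> \<in> borel_measurable borel"
  let ?I = "\<lambda>k. {real k<..<real k + 1}"
  have notin: "AE t in lebesgue. t \<notin> range real"
    by (intro AE_completion AE_not_in countable_imp_null_set_lborel) auto
  have pointwise: "\<Psi> (disjoint_sum f t) * indicator {0<..} t = (\<Sum>k. \<Psi> (F k (t - real k)) * indicator (?I k) t)"
    if "t \<notin> range real" for t
  proof (cases "0 < t")
    case False
    then show ?thesis by (auto simp: indicator_def)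
  next
    case True
    define n where "n = nat \<lfloor>t\<rfloor>"
    have n: "real n < t" "t < real n + 1"
    proof -
      have "real n \<le> t" using True by (simp add: n_def)
      moreover have "real n \<noteq> t" using that by auto
      ultimately show "real n < t" by simp
      show "t < real n + 1" using True by (simp add: n_def)
    qed
    have other: "\<not> (real k \<le> t \<and> t < real k + 1)" if "k \<noteq> n" for k
    proof
      assume "real k \<le> t \<and> t < real k + 1"
      with n have "real k < real n + 1" "real n < real k + 1" by linarith+
      then have "k < Suc n" "n < Suc k" by linarith+
      with that show False by simp
    qed
    have "disjoint_sum f t = (\<Sum>k\<in>{n}. f k (t - real k) * indicator {real k..<real k + 1} t)"
      unfolding disjoint_sum_def by (rule suminf_finite) (use other in \<open>auto simp: indicator_def\<close>)
    then have "disjoint_sum f t = F n (t - real n)"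
      using n by (auto simp: F_def indicator_def)
    moreover have "(\<Sum>k. \<Psi> (F k (t - real k)) * indicator (?I k) t) =
        (\<Sum>k\<in>{n}. \<Psi> (F k (t - real k)) * indicator (?I k) t)"
      by (rule suminf_finite) (use other in \<open>auto simp: indicator_def less_imp_le\<close>)
    ultimately show ?thesis using True n by simp
  qed
  have "(\<integral>\<^sup>+t. \<Psi> (disjoint_sum f t) \<partial>lebesgue_on {0<..}) =
      (\<integral>\<^sup>+t. \<Psi> (disjoint_sum f t) * indicator {0<..} t \<partial>lebesgue)"
    by (rule nn_integral_restrict_space) auto
  also have "\<dots> = (\<integral>\<^sup>+t. (\<Sum>k. \<Psi> (F k (t - real k)) * indicator (?I k) t) \<partial>lebesgue)"
    using notin by (intro nn_integral_cong_AE) (auto simp: pointwise)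
  also have "\<dots> = (\<Sum>k. \<integral>\<^sup>+t. \<Psi> (F k (t - real k)) * indicator (?I k) t \<partial>lebesgue)"
    by (intro nn_integral_suminf borel_measurable_times_ennreal measurable_compose[OF F' \<Psi>] borel_measurable_indicator) auto
  also have "\<dots> = (\<Sum>k. \<integral>\<^sup>+t. \<Psi> (f k t) \<partial>unit_interval)"
  proof (intro arg_cong[where f = suminf] ext)
    fix k
    let ?g = "\<lambda>t. \<Psi> (F k (t - real k)) * indicator (?I k) t"
    have "(\<integral>\<^sup>+t. ?g t \<partial>lebesgue) = ennreal \<bar>1\<bar> * (\<integral>\<^sup>+t. ?g (real k + 1 * t) \<partial>lebesgue)"
      by (intro nn_integral_real_affine_lebesgue borel_measurable_times_ennreal
          measurable_compose[OF F' \<Psi>] borel_measurable_indicator) auto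
    also have "\<dots> = (\<integral>\<^sup>+t. \<Psi> (f k t) * indicator {0<..<1} t \<partial>lebesgue)"
      by (auto intro!: nn_integral_cong simp: F_def indicator_def)
    also have "\<dots> = (\<integral>\<^sup>+t. \<Psi> (f k t) \<partial>unit_interval)"
      by (rule nn_integral_restrict_space[symmetric]) auto
    finally show "(\<integral>\<^sup>+t. ?g t \<partial>lebesgue) = (\<integral>\<^sup>+t. \<Psi> (f k t) \<partial>unit_interval)" .
  qed
  finally show "(\<integral>\<^sup>+t. \<Psi> (disjoint_sum f t) \<partial>lebesgue_on {0<..}) = (\<Sum>k. \<integral>\<^sup>+t. \<Psi> (f k t) \<partial>unit_interval)" .
qed

lemma distribution_fn_eq_nn_integral:
  assumes f[measurable]: "f \<in> borel_measurable M"
  shows "distribution_fn M f s = (\<integral>\<^sup>+x. indicator {y. \<bar>y\<bar> > s} (f x) \<partial>M)"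
proof -
  have "(\<integral>\<^sup>+x. indicator {y. \<bar>y\<bar> > s} (f x) \<partial>M) = (\<integral>\<^sup>+x. indicator {x \<in> space M. \<bar>f x\<bar> > s} x \<partial>M)"
    by (intro nn_integral_cong) (auto simp: indicator_def)
  then show ?thesis by (simp add: distribution_fn_def)
qed

lemma distribution_fn_disjoint_sum:
  assumes f: "\<And>k. f k \<in> borel_measurable unit_interval"
  shows "distribution_fn (lebesgue_on {0<..}) (disjoint_sum f) s = (\<Sum>k. distribution_fn unit_interval (f k) s)"
proof -
  have "{y::real. \<bar>y\<bar> > s} \<in> sets borel" by measurable
  then have "indicator {y::real. \<bar>y\<bar> > s} \<in> borel_measurable borel"
    by (rule borel_measurable_indicator)
  from nn_integral_disjoint_sum[OF f this] show ?thesis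
    by (simp only: distribution_fn_eq_nn_integral[OF disjoint_sum_measurable[OF f]]
        distribution_fn_eq_nn_integral[OF f])
qed

text \<open>
  Functions with the same distribution function above a level have the same law there. Finiteness
  at the level makes the laws finite measures, which are determined by their values on half-lines.
\<close>

lemma nn_integral_superlevel_cong:
  fixes f :: "'a \<Rightarrow> real" and g :: "'b \<Rightarrow> real" and \<Psi> :: "real \<Rightarrow> ennreal"
  assumes f[measurable]: "f \<in> borel_measurable M" and g[measurable]: "g \<in> borel_measurable M'"
    and fin: "distribution_fn M f l < \<infinity>"
    and eq: "\<And>s. l \<le> s \<Longrightarrow> distribution_fn M f s = distribution_fn M' g s"
    and \<Psi>[measurable]: "\<Psi> \<in> borel_measurable borel"
  shows "(\<integral>\<^sup>+x. \<Psi> \<bar>f x\<bar> * indicator {y. \<bar>y\<bar> > l} (f x) \<partial>M) =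
    (\<integral>\<^sup>+x. \<Psi> \<bar>g x\<bar> * indicator {y. \<bar>y\<bar> > l} (g x) \<partial>M')"
proof -
  have ind[measurable]: "{y::real. \<bar>y\<bar> > l} \<in> sets borel" by measurable
  have tail: "emeasure (distr (density N (\<lambda>x. indicator {y. \<bar>y\<bar> > l} (h x))) borel (\<lambda>x. \<bar>h x\<bar>)) {x<..}
      = distribution_fn N h (max x l)" if h[measurable]: "h \<in> borel_measurable N"
    for N :: "'c measure" and h :: "'c \<Rightarrow> real" and x
  proof -
    have "emeasure (distr (density N (\<lambda>x. indicator {y. \<bar>y\<bar> > l} (h x))) borel (\<lambda>x. \<bar>h x\<bar>)) {x<..} =
      emeasure (density N (\<lambda>x. indicator {y. \<bar>y\<bar> > l} (h x))) ((\<lambda>x. \<bar>h x\<bar>) -` {x<..} \<inter> space N)"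
      by (subst emeasure_distr) auto
    also have "\<dots> = (\<integral>\<^sup>+y. indicator {y. \<bar>y\<bar> > l} (h y) * indicator ((\<lambda>x. \<bar>h x\<bar>) -` {x<..} \<inter> space N) y \<partial>N)"
      by (subst emeasure_density) auto
    also have "\<dots> = (\<integral>\<^sup>+y. indicator {y. \<bar>y\<bar> > max x l} (h y) \<partial>N)"
      by (intro nn_integral_cong) (auto simp: indicator_def)
    finally show ?thesis by (simp add: distribution_fn_eq_nn_integral)
  qed
  have law: "distr (density M (\<lambda>x. indicator {y. \<bar>y\<bar> > l} (f x))) borel (\<lambda>x. \<bar>f x\<bar>) =
      distr (density M' (\<lambda>x. indicator {y. \<bar>y\<bar> > l} (g x))) borel (\<lambda>x. \<bar>g x\<bar>)"
  proof (rule measure_eqI_lessThan)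
    fix x :: real
    have "distribution_fn M f (max x l) \<le> distribution_fn M f l"
      by (rule distribution_fn_antimono[OF f]) simp
    then show "emeasure (distr (density M (\<lambda>x. indicator {y. \<bar>y\<bar> > l} (f x))) borel (\<lambda>x. \<bar>f x\<bar>)) {x<..} < \<infinity>"
      using fin by (simp add: tail[OF f] le_less_trans)
    show "emeasure (distr (density M (\<lambda>x. indicator {y. \<bar>y\<bar> > l} (f x))) borel (\<lambda>x. \<bar>f x\<bar>)) {x<..} =
      emeasure (distr (density M' (\<lambda>x. indicator {y. \<bar>y\<bar> > l} (g x))) borel (\<lambda>x. \<bar>g x\<bar>)) {x<..}"
      by (simp add: tail[OF f] tail[OF g] eq)
  qed auto
  have int: "(\<integral>\<^sup>+x. \<Psi> \<bar>h x\<bar> * indicator {y. \<bar>y\<bar> > l} (h x) \<partial>N) =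
      (\<integral>\<^sup>+x. \<Psi> x \<partial>distr (density N (\<lambda>x. indicator {y. \<bar>y\<bar> > l} (h x))) borel (\<lambda>x. \<bar>h x\<bar>))"
    if h[measurable]: "h \<in> borel_measurable N" for N :: "'c measure" and h :: "'c \<Rightarrow> real"
    by (subst nn_integral_distr) (auto simp: nn_integral_density mult.commute)
  show ?thesis unfolding int[OF f] int[OF g] law ..
qed

section \<open>Sums of independent random variables\<close>

text \<open>
  The sign of \<open>\<theta>\<close> is free: positive values give upper tail bounds for the
  number of exceedances, negative ones lower tail bounds.
\<close>

lemma (in prob_space) indep_count_chernoff:
  fixes f :: "nat \<Rightarrow> 'a \<Rightarrow> real" and \<theta> c s :: real
  assumes ind: "indep_vars (\<lambda>_. borel) f UNIV"
  defines "B \<equiv> \<lambda>k. {\<omega> \<in> space M. \<bar>f k \<omega>\<bar> > s}"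
  shows "prob {\<omega> \<in> space M. \<theta> * c \<le> \<theta> * (\<Sum>k<m. indicator (B k) \<omega>)}
    \<le> exp ((exp \<theta> - 1) * (\<Sum>k<m. prob (B k)) - \<theta> * c)"
proof -
  have f[measurable]: "f k \<in> borel_measurable M" for k
    using ind by (auto simp: indep_vars_def)
  have B[measurable]: "B k \<in> sets M" for k unfolding B_def by measurable
  define Y where "Y k = (\<lambda>\<omega>. exp (\<theta> * indicator {y. \<bar>y\<bar> > s} (f k \<omega>)))" for k
  have Y: "Y k \<omega> = 1 + (exp \<theta> - 1) * indicator (B k) \<omega>" if "\<omega> \<in> space M" for k \<omega>
    using that by (auto simp: Y_def B_def indicator_def)
  have Y': "Y k \<omega> = exp (\<theta> * indicator (B k) \<omega>)" if "\<omega> \<in> space M" for k \<omega>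
    using that by (auto simp: Y_def B_def indicator_def)
  have "indep_vars (\<lambda>_. borel) Y UNIV"
    unfolding Y_def by (rule indep_vars_compose2[OF ind]) measurable
  then have indY: "indep_vars (\<lambda>_. borel) Y {..<m}" by (rule indep_vars_subset) auto
  have intY: "integrable M (Y k)" for k
    by (subst Bochner_Integration.integrable_cong[OF refl Y])
      (auto intro!: Bochner_Integration.integrable_add integrable_mult_right simp: emeasure_eq_measure)
  have EY: "expectation (Y k) \<le> exp ((exp \<theta> - 1) * prob (B k))" for k
  proof -
    have "expectation (Y k) = 1 + (exp \<theta> - 1) * prob (B k)"
      by (subst Bochner_Integration.integral_cong[OF refl Y], assumption,
          subst Bochner_Integration.integral_add) (auto simp: prob_space emeasure_eq_measure)
    also have "\<dots> \<le> exp ((exp \<theta> - 1) * prob (B k))" by (rule exp_ge_add_one_self)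
    finally show ?thesis .
  qed
  have prodE: "expectation (\<lambda>\<omega>. \<Prod>k<m. Y k \<omega>) = (\<Prod>k<m. expectation (Y k))"
    and prodI: "integrable M (\<lambda>\<omega>. \<Prod>k<m. Y k \<omega>)"
    using indep_vars_lebesgue_integral[OF _ indY intY] indep_vars_integrable[OF _ indY intY] by auto
  have pos: "0 \<le> expectation (Y k)" for k
    by (intro Bochner_Integration.integral_nonneg) (auto simp: Y_def)
  have "prob {\<omega> \<in> space M. \<theta> * c \<le> \<theta> * (\<Sum>k<m. indicator (B k) \<omega>)} * exp (\<theta> * c)
      = expectation (\<lambda>\<omega>. exp (\<theta> * c) * indicator {\<omega> \<in> space M. \<theta> * c \<le> \<theta> * (\<Sum>k<m. indicator (B k) \<omega>)} \<omega>)"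
    by simp
  also have "\<dots> \<le> expectation (\<lambda>\<omega>. \<Prod>k<m. Y k \<omega>)"
  proof (rule integral_mono[OF _ prodI])
    fix \<omega> assume "\<omega> \<in> space M"
    then have "(\<Prod>k<m. Y k \<omega>) = exp (\<theta> * (\<Sum>k<m. indicator (B k) \<omega>))"
      by (simp only: Y' exp_sum[OF finite_lessThan, symmetric] sum_distrib_left)
    then show "exp (\<theta> * c) * indicator {\<omega> \<in> space M. \<theta> * c \<le> \<theta> * (\<Sum>k<m. indicator (B k) \<omega>)} \<omega> \<le> (\<Prod>k<m. Y k \<omega>)"
      by (simp add: indicator_def)
  qed (auto intro!: integrable_mult_right simp: emeasure_eq_measure)
  also have "\<dots> \<le> (\<Prod>k<m. exp ((exp \<theta> - 1) * prob (B k)))"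
    unfolding prodE by (intro prod_mono) (auto simp: pos EY)
  also have "\<dots> = exp ((exp \<theta> - 1) * (\<Sum>k<m. prob (B k)))"
    by (simp add: exp_sum sum_distrib_left)
  finally show ?thesis by (simp only: exp_diff[of _ "\<theta> * c"] pos_le_divide_eq[OF exp_gt_zero])
qed

lemma (in prob_space) nn_integral_indep_var:
  fixes U V :: "'a \<Rightarrow> real" and G :: "real \<Rightarrow> real \<Rightarrow> ennreal"
  assumes ind: "indep_var borel U borel V"
    and G[measurable]: "case_prod G \<in> borel_measurable (borel \<Otimes>\<^sub>M borel)"
  shows "(\<integral>\<^sup>+\<omega>. G (U \<omega>) (V \<omega>) \<partial>M) = (\<integral>\<^sup>+\<omega>'. \<integral>\<^sup>+\<omega>. G (U \<omega>) (V \<omega>') \<partial>M \<partial>M)"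
proof -
  have U[measurable]: "U \<in> borel_measurable M" and V[measurable]: "V \<in> borel_measurable M"
    using ind by (auto simp: indep_var_distribution_eq)
  have law: "distr M borel U \<Otimes>\<^sub>M distr M borel V = distr M (borel \<Otimes>\<^sub>M borel) (\<lambda>x. (U x, V x))"
    using ind by (simp add: indep_var_distribution_eq)
  interpret dV: prob_space "distr M borel V" by (rule prob_space_distr) simp
  have "(\<integral>\<^sup>+\<omega>. G (U \<omega>) (V \<omega>) \<partial>M) = (\<integral>\<^sup>+z. case_prod G z \<partial>distr M (borel \<Otimes>\<^sub>M borel) (\<lambda>x. (U x, V x)))"
    by (subst nn_integral_distr) auto
  also have "\<dots> = (\<integral>\<^sup>+u. \<integral>\<^sup>+v. case_prod G (u, v) \<partial>distr M borel V \<partial>distr M borel U)"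
    unfolding law[symmetric]
    by (rule dV.nn_integral_fst[symmetric]) (auto cong: measurable_cong_sets)
  also have "\<dots> = (\<integral>\<^sup>+\<omega>. \<integral>\<^sup>+v. G (U \<omega>) v \<partial>distr M borel V \<partial>M)"
    by (subst nn_integral_distr) auto
  also have "\<dots> = (\<integral>\<^sup>+\<omega>. \<integral>\<^sup>+\<omega>'. G (U \<omega>) (V \<omega>') \<partial>M \<partial>M)"
    by (intro nn_integral_cong, subst nn_integral_distr) auto
  also have "\<dots> = (\<integral>\<^sup>+\<omega>'. \<integral>\<^sup>+\<omega>. G (U \<omega>) (V \<omega>') \<partial>M \<partial>M)"
  proof -
    interpret pair_sigma_finite M M ..
    show ?thesis by (rule Fubini'[symmetric]) measurable
  qed
  finally show ?thesis .
qed

text \<open>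
  The operator \<open>F \<mapsto> \<integral> F (x + y) d\<nu>(y)\<close>, where
  \<open>\<nu>\<close> is the law of \<open>Y\<close> off zero. Working with these operators
  replaces convolution of measures by composition.
\<close>

definition jump_operator :: "'a measure \<Rightarrow> ('a \<Rightarrow> real) \<Rightarrow> (real \<Rightarrow> ennreal) \<Rightarrow> real \<Rightarrow> ennreal" where
  "jump_operator M Y F x = (\<integral>\<^sup>+\<omega>. F (x + Y \<omega>) * indicator {\<omega>. Y \<omega> \<noteq> 0} \<omega> \<partial>M)"

definition jump_sum :: "'a measure \<Rightarrow> (nat \<Rightarrow> 'a \<Rightarrow> real) \<Rightarrow> nat \<Rightarrow> (real \<Rightarrow> ennreal) \<Rightarrow> real \<Rightarrow> ennreal" where
  "jump_sum M Y m F x = (\<Sum>k<m. jump_operator M (Y k) F x)"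

context prob_space begin

lemma jump_operator_measurable:
  assumes Y[measurable]: "Y \<in> borel_measurable M" and F[measurable]: "F \<in> borel_measurable borel"
  shows "jump_operator M Y F \<in> borel_measurable borel"
proof -
  have "(\<lambda>x. \<integral>\<^sup>+\<omega>. F (x + Y \<omega>) * indicator {y. y \<noteq> 0} (Y \<omega>) \<partial>M) \<in> borel_measurable borel"
    by measurable
  moreover have "jump_operator M Y F = (\<lambda>x. \<integral>\<^sup>+\<omega>. F (x + Y \<omega>) * indicator {y. y \<noteq> 0} (Y \<omega>) \<partial>M)"
    by (auto simp: jump_operator_def indicator_def intro!: ext nn_integral_cong)
  ultimately show ?thesis by simp
qed

lemma jump_operator_add:
  assumes Y[measurable]: "Y \<in> borel_measurable M" and F[measurable]: "F \<in> borel_measurable borel"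
    and G[measurable]: "G \<in> borel_measurable borel"
  shows "jump_operator M Y (\<lambda>y. F y + c * G y) x = jump_operator M Y F x + c * jump_operator M Y G x"
proof -
  have ind[measurable]: "indicator {\<omega>. Y \<omega> \<noteq> 0} \<in> borel_measurable M"
  proof -
    have "(\<lambda>\<omega>. indicator {y. y \<noteq> 0} (Y \<omega>) :: ennreal) \<in> borel_measurable M" by measurable
    then show ?thesis by (simp add: indicator_def[abs_def])
  qed
  show ?thesis unfolding jump_operator_def
    by (subst nn_integral_cmult[symmetric], measurable, subst nn_integral_add[symmetric], measurable)
      (auto intro!: nn_integral_cong simp: algebra_simps)
qed

lemma jump_operator_mono: "(\<And>y. F y \<le> G y) \<Longrightarrow> jump_operator M Y F x \<le> jump_operator M Y G x"
  unfolding jump_operator_def by (intro nn_integral_mono mult_right_mono) auto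

text \<open>Convolution is commutative.\<close>

lemma jump_operator_commute:
  assumes Y[measurable]: "Y \<in> borel_measurable M" and Z[measurable]: "Z \<in> borel_measurable M"
    and F[measurable]: "F \<in> borel_measurable borel"
  shows "jump_operator M Y (jump_operator M Z F) x = jump_operator M Z (jump_operator M Y F) x"
proof -
  interpret pair_sigma_finite M M ..
  have "jump_operator M Y (jump_operator M Z F) x =
      (\<integral>\<^sup>+\<omega>. \<integral>\<^sup>+\<omega>'. F (x + Y \<omega> + Z \<omega>') * indicator {y. y \<noteq> 0} (Y \<omega>) * indicator {y. y \<noteq> 0} (Z \<omega>') \<partial>M \<partial>M)"
    unfolding jump_operator_def
    by (intro nn_integral_cong, subst nn_integral_multc[symmetric])
      (auto intro!: nn_integral_cong simp: indicator_def)
  also have "\<dots> = (\<integral>\<^sup>+\<omega>'. \<integral>\<^sup>+\<omega>. F (x + Y \<omega> + Z \<omega>') * indicator {y. y \<noteq> 0} (Y \<omega>) * indicator {y. y \<noteq> 0} (Z \<omega>') \<partial>M \<partial>M)"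
    by (rule Fubini'[symmetric]) measurable
  also have "\<dots> = jump_operator M Z (jump_operator M Y F) x"
    unfolding jump_operator_def
    by (intro nn_integral_cong, subst nn_integral_multc[symmetric])
      (auto intro!: nn_integral_cong simp: indicator_def algebra_simps)
  finally show ?thesis .
qed

lemma jump_sum_measurable:
  assumes "\<And>k. Y k \<in> borel_measurable M" "F \<in> borel_measurable borel"
  shows "jump_sum M Y m F \<in> borel_measurable borel"
  unfolding jump_sum_def[abs_def] using assms by (intro borel_measurable_sum jump_operator_measurable) auto

lemma jump_sum_power_measurable:
  assumes "\<And>k. Y k \<in> borel_measurable M" "F \<in> borel_measurable borel"
  shows "(jump_sum M Y m ^^ n) F \<in> borel_measurable borel"
  using assms by (induction n) (auto intro: jump_sum_measurable)

lemma jump_sum_mono: "(\<And>y. F y \<le> G y) \<Longrightarrow> jump_sum M Y m F x \<le> jump_sum M Y m G x"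
  unfolding jump_sum_def by (intro sum_mono jump_operator_mono)

lemma jump_sum_add:
  assumes "\<And>k. Y k \<in> borel_measurable M" "F \<in> borel_measurable borel" "G \<in> borel_measurable borel"
  shows "jump_sum M Y m (\<lambda>y. F y + c * G y) x = jump_sum M Y m F x + c * jump_sum M Y m G x"
  unfolding jump_sum_def by (simp add: jump_operator_add assms sum.distrib sum_distrib_left)

lemma jump_operator_sum:
  assumes Y: "Y \<in> borel_measurable M" and "\<And>k. G k \<in> borel_measurable borel"
  shows "jump_operator M Y (\<lambda>y. \<Sum>k<(m::nat). G k y) x = (\<Sum>k<m. jump_operator M Y (G k) x)"
proof (induction m)
  case (Suc m)
  have "jump_operator M Y (\<lambda>y. (\<Sum>k<m. G k y) + 1 * G m y) x =
      jump_operator M Y (\<lambda>y. \<Sum>k<m. G k y) x + 1 * jump_operator M Y (G m) x"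
    using assms by (intro jump_operator_add) auto
  with Suc show ?case by simp
qed (simp add: jump_operator_def)

lemma jump_operator_jump_sum:
  assumes Y: "\<And>k. Y k \<in> borel_measurable M" and Z: "Z \<in> borel_measurable M"
    and F: "F \<in> borel_measurable borel"
  shows "jump_operator M Z (jump_sum M Y m F) = jump_sum M Y m (jump_operator M Z F)"
proof
  fix x
  have "jump_operator M Z (jump_sum M Y m F) x = (\<Sum>k<m. jump_operator M Z (jump_operator M (Y k) F) x)"
    unfolding jump_sum_def[abs_def] using assms by (intro jump_operator_sum jump_operator_measurable)
  also have "\<dots> = jump_sum M Y m (jump_operator M Z F) x"
    unfolding jump_sum_def using assms by (intro sum.cong refl jump_operator_commute)
  finally show "jump_operator M Z (jump_sum M Y m F) x = jump_sum M Y m (jump_operator M Z F) x" .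
qed

lemma jump_operator_jump_sum_power:
  assumes Y: "\<And>k. Y k \<in> borel_measurable M" and Z: "Z \<in> borel_measurable M"
    and F: "F \<in> borel_measurable borel"
  shows "jump_operator M Z ((jump_sum M Y m ^^ n) F) = (jump_sum M Y m ^^ n) (jump_operator M Z F)"
proof (induction n)
  case (Suc n)
  have "jump_operator M Z ((jump_sum M Y m ^^ Suc n) F) = jump_sum M Y m (jump_operator M Z ((jump_sum M Y m ^^ n) F))"
    using jump_operator_jump_sum[OF Y Z jump_sum_power_measurable[OF Y F]] by simp
  with Suc show ?case by simp
qed simp

lemma jump_sum_Suc: "jump_sum M Y (Suc m) F x = jump_sum M Y m F x + jump_operator M (Y m) F x"
  by (simp add: jump_sum_def)

text \<open>
  The first two terms of the binomial expansion of \<open>(Q + R)^(n+1)\<close> for commuting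
  positive operators \<open>Q\<close> and \<open>R\<close>.
\<close>

lemma jump_sum_power_Suc_ge:
  assumes Y: "\<And>k. Y k \<in> borel_measurable M" and F: "F \<in> borel_measurable borel"
  shows "(jump_sum M Y m ^^ Suc n) F x + of_nat (Suc n) * (jump_sum M Y m ^^ n) (jump_operator M (Y m) F) x
    \<le> (jump_sum M Y (Suc m) ^^ Suc n) F x"
proof (induction n arbitrary: x)
  case 0 show ?case by (simp add: jump_sum_Suc)
next
  case (Suc n)
  let ?Q = "jump_sum M Y m" and ?R = "jump_operator M (Y m)"
  have RF: "?R F \<in> borel_measurable borel" by (rule jump_operator_measurable[OF Y F])
  note m1 = jump_sum_power_measurable[OF Y F, where m = m and n = "Suc n"]
  note m2 = jump_sum_power_measurable[OF Y RF, where m = m and n = n]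
  have "(?Q ^^ Suc (Suc n)) F x + of_nat (Suc (Suc n)) * (?Q ^^ Suc n) (?R F) x =
      ?Q ((?Q ^^ Suc n) F) x + of_nat (Suc n) * ?Q ((?Q ^^ n) (?R F)) x + ?R ((?Q ^^ Suc n) F) x"
    unfolding jump_operator_jump_sum_power[OF Y Y F] by (simp add: algebra_simps)
  also have "\<dots> = ?Q (\<lambda>y. (?Q ^^ Suc n) F y + of_nat (Suc n) * (?Q ^^ n) (?R F) y) x + ?R ((?Q ^^ Suc n) F) x"
    by (subst jump_sum_add[OF Y m1 m2]) simp
  also have "\<dots> \<le> ?Q ((jump_sum M Y (Suc m) ^^ Suc n) F) x + ?R ((jump_sum M Y (Suc m) ^^ Suc n) F) x"
  proof (intro add_mono jump_sum_mono jump_operator_mono)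
    fix y
    show "(?Q ^^ Suc n) F y + of_nat (Suc n) * (?Q ^^ n) (?R F) y \<le> (jump_sum M Y (Suc m) ^^ Suc n) F y"
      by (rule Suc.IH)
    show "(?Q ^^ Suc n) F y \<le> (jump_sum M Y (Suc m) ^^ Suc n) F y"
      using order_trans[OF _ Suc.IH[of y]] by (simp add: add_increasing2)
  qed
  also have "\<dots> = (jump_sum M Y (Suc m) ^^ Suc (Suc n)) F x"
    by (simp add: jump_sum_Suc)
  finally show ?case .
qed

text \<open>
  With \<open>Q\<close> the sum of the jump operators \<open>R\<^sub>k\<close>, the left-hand side
  is at most \<open>(\<Prod>k<m. (1 + R\<^sub>k)) F x\<close>, because \<open>F (x + Y) \<le> F x
  + F (x + Y) 1\<^bsub>Y \<noteq> 0\<^esub>\<close>, and \<open>\<Prod>(1 + R\<^sub>k) \<le> exp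
  Q\<close>. The induction on \<open>m\<close> uses \<open>(1 + R) exp Q \<le> exp (Q +
  R)\<close>, compared coefficientwise.
\<close>

lemma indep_sum_exponential_bound:
  fixes Y :: "nat \<Rightarrow> 'a \<Rightarrow> real"
  assumes ind: "indep_vars (\<lambda>_. borel) Y UNIV" and F: "F \<in> borel_measurable borel"
  shows "(\<integral>\<^sup>+\<omega>. F (x + (\<Sum>k<m. Y k \<omega>)) \<partial>M) \<le> (\<Sum>n. ennreal (1 / fact n) * (jump_sum M Y m ^^ n) F x)"
  using F
proof (induction m arbitrary: F x)
  case 0
  have "F x = (\<Sum>n\<in>{0}. ennreal (1 / fact n) * (jump_sum M Y 0 ^^ n) F x)" by simp
  also have "\<dots> \<le> (\<Sum>n. ennreal (1 / fact n) * (jump_sum M Y 0 ^^ n) F x)"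
    by (rule sum_le_suminf) auto
  finally show ?case by (simp add: emeasure_space_1)
next
  case (Suc m)
  have Y[measurable]: "Y k \<in> borel_measurable M" for k using ind by (auto simp: indep_vars_def)
  note F[measurable] = Suc.prems
  let ?S = "\<lambda>\<omega>. \<Sum>k<m. Y k \<omega>" and ?Q = "jump_sum M Y m" and ?R = "jump_operator M (Y m)"
  let ?P = "jump_sum M Y (Suc m)"
  note RF[measurable] = jump_operator_measurable[OF Y F, of m]
  have "indep_vars (\<lambda>_. borel) Y (insert m {..<m})" by (rule indep_vars_subset[OF ind]) auto
  then have iv: "indep_var borel (Y m) borel ?S" by (intro indep_vars_sum) auto
  have "(\<integral>\<^sup>+\<omega>. F (x + (\<Sum>k<Suc m. Y k \<omega>)) \<partial>M) = (\<integral>\<^sup>+\<omega>. F (x + ?S \<omega> + Y m \<omega>) \<partial>M)"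
    by (simp add: add.assoc)
  also have "\<dots> = (\<integral>\<^sup>+\<omega>. \<integral>\<^sup>+\<omega>'. F (x + ?S \<omega> + Y m \<omega>') \<partial>M \<partial>M)"
    by (rule nn_integral_indep_var[OF iv, of "\<lambda>v u. F (x + u + v)"]) measurable
  also have "\<dots> \<le> (\<integral>\<^sup>+\<omega>. F (x + ?S \<omega>) + ?R F (x + ?S \<omega>) \<partial>M)"
  proof (rule nn_integral_mono)
    fix \<omega>
    have "(\<integral>\<^sup>+\<omega>'. F (x + ?S \<omega> + Y m \<omega>') \<partial>M) \<le>
        (\<integral>\<^sup>+\<omega>'. F (x + ?S \<omega>) + F (x + ?S \<omega> + Y m \<omega>') * indicator {y. y \<noteq> 0} (Y m \<omega>') \<partial>M)"
      by (intro nn_integral_mono) (auto simp: indicator_def)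
    also have "\<dots> = F (x + ?S \<omega>) + (\<integral>\<^sup>+\<omega>'. F (x + ?S \<omega> + Y m \<omega>') * indicator {y. y \<noteq> 0} (Y m \<omega>') \<partial>M)"
      by (subst nn_integral_add) (auto simp: emeasure_space_1)
    also have "\<dots> = F (x + ?S \<omega>) + ?R F (x + ?S \<omega>)"
      by (auto simp: jump_operator_def indicator_def intro!: arg_cong2[where f = "(+)"] nn_integral_cong)
    finally show "(\<integral>\<^sup>+\<omega>'. F (x + ?S \<omega> + Y m \<omega>') \<partial>M) \<le> F (x + ?S \<omega>) + ?R F (x + ?S \<omega>)" .
  qed
  also have "\<dots> = (\<integral>\<^sup>+\<omega>. F (x + ?S \<omega>) \<partial>M) + (\<integral>\<^sup>+\<omega>. ?R F (x + ?S \<omega>) \<partial>M)"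
    by (rule nn_integral_add) measurable
  also have "\<dots> \<le> (\<Sum>n. ennreal (1 / fact n) * (?Q ^^ n) F x) + (\<Sum>n. ennreal (1 / fact n) * (?Q ^^ n) (?R F) x)"
    by (intro add_mono Suc.IH F RF)
  also have "(\<Sum>n. ennreal (1 / fact n) * (?Q ^^ n) F x) =
      (\<Sum>n. ennreal (1 / fact (Suc n)) * (?Q ^^ Suc n) F x) + F x"
    using sums_Suc[OF summable_sums[OF summableI], of "\<lambda>n. ennreal (1 / fact n) * (?Q ^^ n) F x"]
    by (auto dest!: sums_unique)
  also have "(\<Sum>n. ennreal (1 / fact (Suc n)) * (?Q ^^ Suc n) F x) + F x + (\<Sum>n. ennreal (1 / fact n) * (?Q ^^ n) (?R F) x) =
      (\<Sum>n. ennreal (1 / fact (Suc n)) * (?Q ^^ Suc n) F x + ennreal (1 / fact n) * (?Q ^^ n) (?R F) x) + F x"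
    by (simp add: suminf_add[OF summableI summableI, symmetric] algebra_simps)
  also have "\<dots> \<le> (\<Sum>n. ennreal (1 / fact (Suc n)) * (?P ^^ Suc n) F x) + F x"
  proof (intro add_right_mono suminf_le summableI)
    fix n
    have "1 / fact n = 1 / fact (Suc n) * real (Suc n)" by (simp add: fact_Suc divide_simps del: of_nat_Suc)
    then have "ennreal (1 / fact n) = ennreal (1 / fact (Suc n)) * of_nat (Suc n)"
      by (simp only: ennreal_of_nat_eq_real_of_nat) (subst ennreal_mult, auto)
    then have "ennreal (1 / fact (Suc n)) * (?Q ^^ Suc n) F x + ennreal (1 / fact n) * (?Q ^^ n) (?R F) x =
        ennreal (1 / fact (Suc n)) * ((?Q ^^ Suc n) F x + of_nat (Suc n) * (?Q ^^ n) (?R F) x)"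
      by (simp only: distrib_left mult.assoc)
    also have "\<dots> \<le> ennreal (1 / fact (Suc n)) * (?P ^^ Suc n) F x"
      by (intro mult_left_mono jump_sum_power_Suc_ge[OF Y F]) simp
    finally show "ennreal (1 / fact (Suc n)) * (?Q ^^ Suc n) F x + ennreal (1 / fact n) * (?Q ^^ n) (?R F) x
        \<le> ennreal (1 / fact (Suc n)) * (?P ^^ Suc n) F x" .
  qed
  also have "\<dots> = (\<Sum>n. ennreal (1 / fact n) * (?P ^^ n) F x)"
    using sums_Suc[OF summable_sums[OF summableI], of "\<lambda>n. ennreal (1 / fact n) * (?P ^^ n) F x"]
    by (auto dest!: sums_unique)
  finally show ?case .
qed

end

section \<open>The sequence spaces \<open>\<ell>\<^sub>p\<close> for small \<open>p\<close>\<close>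

definition lp_space :: "real \<Rightarrow> (nat \<Rightarrow> real) set" where
  "lp_space p = {a. summable (\<lambda>k. \<bar>a k\<bar> powr p)}"

definition lp_norm :: "real \<Rightarrow> (nat \<Rightarrow> real) \<Rightarrow> real" where
  "lp_norm p a = (\<Sum>k. \<bar>a k\<bar> powr p) powr (1 / p)"

lemma add_powr_le:
  fixes x y :: real
  assumes "0 \<le> x" "0 \<le> y" "0 < p" "p \<le> 1"
  shows "(x + y) powr p \<le> x powr p + y powr p"
proof (cases "x + y = 0")
  case False
  then have s: "0 < x + y" using assms by simp
  have *: "z \<le> z powr p" if "0 \<le> z" "z \<le> 1" for z :: real
  proof (cases "z = 0")
    case False
    then have "z powr 1 \<le> z powr p" using that assms by (intro powr_mono') auto
    then show ?thesis using that by simp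
  qed simp
  have "1 = x / (x + y) + y / (x + y)" using s by (simp add: add_divide_distrib[symmetric])
  also have "\<dots> \<le> (x / (x + y)) powr p + (y / (x + y)) powr p"
    using assms s by (intro add_mono *) auto
  also have "\<dots> = (x powr p + y powr p) / (x + y) powr p"
    using assms s by (simp add: powr_divide add_divide_distrib)
  finally show ?thesis using s by (simp add: field_simps)
qed simp

text \<open>
  This turns an inequality between rearrangements back into one between numbers of large entries.
  If \<open>b\<close> had \<open>n + 1\<close> entries above \<open>t\<close>, where
  \<open>n\<close> is the number of those of \<open>a\<close>, then the least of them would be a
  lower bound, larger than \<open>t\<close>, for the rearrangement of \<open>b\<close> at
  \<open>n\<close>.
\<close>

lemma superlevel_card_le_of_rearrangement_le:
  assumes b: "bounded (range b)" and le: "\<And>n. seq_rearrangement b n \<le> seq_rearrangement a n"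
    and t: "0 \<le> t" and fin: "finite (superlevel a t)"
  shows "finite (superlevel b t) \<and> card (superlevel b t) \<le> card (superlevel a t)"
proof (rule ccontr)
  define n where "n = card (superlevel a t)"
  assume neg: "\<not> ?thesis"
  have "\<exists>K. K \<subseteq> superlevel b t \<and> finite K \<and> card K = Suc n"
  proof (cases "finite (superlevel b t)")
    case True
    with neg have "Suc n \<le> card (superlevel b t)" by (simp add: n_def)
    then show ?thesis using obtain_subset_with_card_n by metis
  next
    case False
    then show ?thesis using infinite_arbitrarily_large by blast
  qed
  then obtain K where K: "K \<subseteq> superlevel b t" "finite K" "card K = Suc n" by blast
  define m where "m = Min ((\<lambda>k. \<bar>b k\<bar>) ` K)"
  have Kne: "K \<noteq> {}" using K by auto
  then have m: "t < m" unfolding m_def using K by (subst Min_gr_iff) auto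
  have mle: "m \<le> \<bar>b k\<bar>" if "k \<in> K" for k unfolding m_def using K that by (intro Min_le) auto
  have "seq_rearrangement a n \<le> t"
    unfolding seq_rearrangement_def using t fin
    by (intro cInf_lower) (auto simp: n_def intro!: bdd_belowI[of _ 0])
  then have "seq_rearrangement b n \<le> t" using le[of n] by simp
  moreover have "m \<le> seq_rearrangement b n"
    unfolding seq_rearrangement_def
  proof (rule cInf_greatest)
    obtain l where l: "\<And>k. \<bar>b k\<bar> \<le> l" using b by (auto simp: bounded_iff)
    then have "superlevel b l = {}" "0 \<le> l" using order_trans[OF abs_ge_zero l] by (auto simp: not_less)
    then have "l \<in> {l. 0 \<le> l \<and> finite (superlevel b l) \<and> card (superlevel b l) \<le> n}" by simp
    then show "{l. 0 \<le> l \<and> finite (superlevel b l) \<and> card (superlevel b l) \<le> n} \<noteq> {}" by blast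
  next
    fix l assume l: "l \<in> {l. 0 \<le> l \<and> finite (superlevel b l) \<and> card (superlevel b l) \<le> n}"
    show "m \<le> l"
    proof (rule ccontr)
      assume "\<not> m \<le> l"
      then have "K \<subseteq> superlevel b l" using mle by fastforce
      then have "Suc n \<le> card (superlevel b l)" using l K card_mono[of "superlevel b l" K] by simp
      with l show False by simp
    qed
  qed
  ultimately show False using m by simp
qed

lemma lp_sum_layer_cake:
  fixes c :: "nat \<Rightarrow> real"
  assumes "\<And>k. 0 \<le> c k"
  shows "(\<Sum>k. ennreal (c k)) = (\<integral>\<^sup>+s. (\<Sum>k. indicator {0<..<c k} s) \<partial>lborel)"
proof -
  have "(\<integral>\<^sup>+s. (\<Sum>k. indicator {0<..<c k} s) \<partial>lborel) = (\<Sum>k. \<integral>\<^sup>+s. indicator {0<..<c k} s \<partial>lborel)"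
    by (rule nn_integral_suminf) auto
  also have "\<dots> = (\<Sum>k. ennreal (c k))"
    using assms by (intro arg_cong[where f = suminf] ext) simp
  finally show ?thesis ..
qed

lemma lp_mem_norm_mono:
  assumes p: "0 < p" and a: "a \<in> lp_space p"
    and le: "\<And>t. 0 < t \<Longrightarrow> finite (superlevel a t) \<Longrightarrow>
      finite (superlevel b t) \<and> card (superlevel b t) \<le> card (superlevel a t)"
  shows "b \<in> lp_space p \<and> lp_norm p b \<le> lp_norm p a"
proof -
  let ?A = "\<lambda>k. \<bar>a k\<bar> powr p" and ?B = "\<lambda>k. \<bar>b k\<bar> powr p"
  have sa: "summable ?A" using a by (simp add: lp_space_def)
  have "(\<Sum>k. ennreal (?B k)) = (\<integral>\<^sup>+s. (\<Sum>k. indicator {0<..<?B k} s) \<partial>lborel)"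
    by (rule lp_sum_layer_cake) simp
  also have "\<dots> \<le> (\<integral>\<^sup>+s. (\<Sum>k. indicator {0<..<?A k} s) \<partial>lborel)"
  proof (rule nn_integral_mono)
    fix s :: real
    show "(\<Sum>k. indicator {0<..<?B k} s :: ennreal) \<le> (\<Sum>k. indicator {0<..<?A k} s)"
    proof (cases "0 < s")
      case True
      define t where "t = s powr (1 / p)"
      have t: "0 < t" using True by (simp add: t_def)
      have iff: "s < \<bar>x\<bar> powr p \<longleftrightarrow> t < \<bar>x\<bar>" for x :: real
      proof -
        have "s = t powr p" using True p by (simp add: t_def powr_powr)
        then show ?thesis using t p powr_less_mono2[of p t "\<bar>x\<bar>"] powr_mono2[of p "\<bar>x\<bar>" t]
          by (cases "t < \<bar>x\<bar>") auto
      qed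
      have card: "(\<Sum>k. indicator {0<..<\<bar>c k\<bar> powr p} s :: ennreal) = of_nat (card (superlevel c t))"
        if "finite (superlevel c t)" for c
      proof -
        have "(\<Sum>k. indicator {0<..<\<bar>c k\<bar> powr p} s :: ennreal) =
            (\<Sum>k\<in>superlevel c t. indicator {0<..<\<bar>c k\<bar> powr p} s)"
          using that by (rule suminf_finite) (simp add: indicator_def iff)
        also have "\<dots> = (\<Sum>k\<in>superlevel c t. 1)"
          using True by (intro sum.cong) (auto simp: indicator_def iff)
        finally show ?thesis by simp
      qed
      have "?A \<longlonglongrightarrow> 0" by (rule summable_LIMSEQ_zero[OF sa])
      then have "\<forall>\<^sub>F k in sequentially. ?A k < s" using True by (rule order_tendstoD)
      then obtain k0 where "\<And>k. k \<ge> k0 \<Longrightarrow> ?A k < s" by (auto simp: eventually_sequentially)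
      then have "superlevel a t \<subseteq> {..<k0}" using iff by (force simp: not_less[symmetric])
      then have fin: "finite (superlevel a t)" by (rule finite_subset) simp
      with le[OF t] card show ?thesis by simp
    qed simp
  qed
  also have "\<dots> = (\<Sum>k. ennreal (?A k))"
    by (rule lp_sum_layer_cake[symmetric]) simp
  also have "\<dots> = ennreal (\<Sum>k. ?A k)" using sa by (intro suminf_ennreal2) auto
  finally have le': "(\<Sum>k. ennreal (?B k)) \<le> ennreal (\<Sum>k. ?A k)" .
  then have "(\<Sum>k. ennreal (?B k)) \<noteq> \<top>" by (auto simp: top_unique)
  then have sb: "summable ?B" by (intro summable_suminf_not_top) auto
  then have "(\<Sum>k. ennreal (?B k)) = ennreal (\<Sum>k. ?B k)" by (intro suminf_ennreal2) auto
  with le' have "(\<Sum>k. ?B k) \<le> (\<Sum>k. ?A k)" using sa by (simp add: ennreal_le_iff suminf_nonneg)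
  then show ?thesis using sb p
    by (auto simp: lp_space_def lp_norm_def intro!: powr_mono2 suminf_nonneg)
qed

lemma lp_norm_powr: "0 < p \<Longrightarrow> lp_norm p a powr p = \<bar>\<Sum>k. \<bar>a k\<bar> powr p\<bar>"
  by (simp add: lp_norm_def powr_powr)

lemma lp_coordinate_le:
  assumes p: "0 < p" and a: "a \<in> lp_space p"
  shows "\<bar>a k\<bar> \<le> lp_norm p a"
proof -
  have "(\<Sum>i\<in>{k}. \<bar>a i\<bar> powr p) \<le> (\<Sum>i. \<bar>a i\<bar> powr p)"
    using a by (intro sum_le_suminf) (auto simp: lp_space_def)
  then have "(\<bar>a k\<bar> powr p) powr (1 / p) \<le> lp_norm p a"
    unfolding lp_norm_def using p by (intro powr_mono2) auto
  then show ?thesis using p by (simp add: powr_powr)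
qed

lemma lp_add:
  assumes p: "0 < p" "p \<le> 1" and a: "a \<in> lp_space p" and b: "b \<in> lp_space p"
  shows "(\<lambda>k. a k + b k) \<in> lp_space p"
    and "lp_norm p (\<lambda>k. a k + b k) \<le> 2 powr (1 / p) * (lp_norm p a + lp_norm p b)"
proof -
  have sa: "summable (\<lambda>k. \<bar>a k\<bar> powr p)" and sb: "summable (\<lambda>k. \<bar>b k\<bar> powr p)"
    using a b by (auto simp: lp_space_def)
  have le: "\<bar>a k + b k\<bar> powr p \<le> \<bar>a k\<bar> powr p + \<bar>b k\<bar> powr p" for k
    using add_powr_le[of "\<bar>a k\<bar>" "\<bar>b k\<bar>" p] p
      powr_mono2[of p "\<bar>a k + b k\<bar>" "\<bar>a k\<bar> + \<bar>b k\<bar>"] abs_triangle_ineq[of "a k" "b k"] by simp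
  have s: "summable (\<lambda>k. \<bar>a k + b k\<bar> powr p)"
    by (rule summable_comparison_test'[OF summable_add[OF sa sb], of 0]) (use le in simp)
  then show "(\<lambda>k. a k + b k) \<in> lp_space p" by (simp add: lp_space_def)
  let ?A = "\<Sum>k. \<bar>a k\<bar> powr p" and ?B = "\<Sum>k. \<bar>b k\<bar> powr p"
  have "(\<Sum>k. \<bar>a k + b k\<bar> powr p) \<le> (\<Sum>k. \<bar>a k\<bar> powr p + \<bar>b k\<bar> powr p)"
    by (intro suminf_le le s summable_add sa sb)
  also have "\<dots> = ?A + ?B" by (rule suminf_add[OF sa sb, symmetric])
  also have "\<dots> \<le> 2 * max ?A ?B" by simp
  finally have "lp_norm p (\<lambda>k. a k + b k) \<le> (2 * max ?A ?B) powr (1 / p)"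
    unfolding lp_norm_def using p s by (intro powr_mono2 suminf_nonneg) auto
  also have "\<dots> = 2 powr (1 / p) * max ?A ?B powr (1 / p)"
    by (rule powr_mult)
  also have "max ?A ?B powr (1 / p) \<le> lp_norm p a + lp_norm p b"
    by (auto simp: max_def lp_norm_def)
  finally show "lp_norm p (\<lambda>k. a k + b k) \<le> 2 powr (1 / p) * (lp_norm p a + lp_norm p b)"
    by (simp add: mult_left_mono)
qed

lemma lp_scale:
  assumes p: "0 < p" and a: "a \<in> lp_space p"
  shows "(\<lambda>k. c * a k) \<in> lp_space p" "lp_norm p (\<lambda>k. c * a k) = \<bar>c\<bar> * lp_norm p a"
proof -
  have eq: "\<bar>c * a k\<bar> powr p = \<bar>c\<bar> powr p * \<bar>a k\<bar> powr p" for k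
    by (simp add: abs_mult powr_mult)
  show "(\<lambda>k. c * a k) \<in> lp_space p" using a unfolding lp_space_def by (simp add: eq summable_mult)
  have "lp_norm p (\<lambda>k. c * a k) = (\<bar>c\<bar> powr p * (\<Sum>k. \<bar>a k\<bar> powr p)) powr (1 / p)"
    using a unfolding lp_norm_def eq by (subst suminf_mult) (auto simp: lp_space_def)
  also have "\<dots> = \<bar>c\<bar> * lp_norm p a"
    using p by (simp add: powr_mult powr_powr lp_norm_def)
  finally show "lp_norm p (\<lambda>k. c * a k) = \<bar>c\<bar> * lp_norm p a" .
qed

text \<open>
  A Cauchy sequence converges coordinatewise, and finite partial sums pass to the limit.
\<close>

lemma lp_complete:
  assumes p: "0 < p" "p \<le> 1" and u: "\<And>n. u n \<in> lp_space p"
    and cauchy: "\<And>\<epsilon>. 0 < \<epsilon> \<Longrightarrow> \<exists>n0. \<forall>m\<ge>n0. \<forall>n\<ge>n0. lp_norm p (\<lambda>k. u m k - u n k) < \<epsilon>"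
  shows "\<exists>f\<in>lp_space p. (\<lambda>n. lp_norm p (\<lambda>k. u n k - f k)) \<longlonglongrightarrow> 0"
proof -
  have diff: "(\<lambda>k. a k - b k) \<in> lp_space p" if "a \<in> lp_space p" "b \<in> lp_space p" for a b
    using lp_add(1)[OF p that(1) lp_scale(1)[OF p(1) that(2)], of "-1"] by simp
  have "\<exists>l. (\<lambda>n. u n k) \<longlonglongrightarrow> l" for k
  proof -
    have "Cauchy (\<lambda>n. u n k)"
    proof (rule metric_CauchyI)
      fix e :: real assume "0 < e"
      then obtain n0 where n0: "\<And>m n. m \<ge> n0 \<Longrightarrow> n \<ge> n0 \<Longrightarrow> lp_norm p (\<lambda>k. u m k - u n k) < e"
        using cauchy by blast
      show "\<exists>M. \<forall>m\<ge>M. \<forall>n\<ge>M. dist (u m k) (u n k) < e"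
      proof (intro exI allI impI)
        fix m n assume "m \<ge> n0" "n \<ge> n0"
        then have "lp_norm p (\<lambda>k. u m k - u n k) < e" by (rule n0)
        then show "dist (u m k) (u n k) < e"
          using lp_coordinate_le[OF p(1) diff[OF u[of m] u[of n]], of k] by (simp add: dist_real_def)
      qed
    qed
    then show ?thesis by (simp add: Cauchy_convergent_iff convergent_def)
  qed
  then obtain f where f: "\<And>k. (\<lambda>n. u n k) \<longlonglongrightarrow> f k" by metis
  have main: "(\<lambda>k. u n k - f k) \<in> lp_space p \<and> lp_norm p (\<lambda>k. u n k - f k) \<le> e"
    if e: "0 < e" and n0: "\<And>m n. m \<ge> n0 \<Longrightarrow> n \<ge> n0 \<Longrightarrow> lp_norm p (\<lambda>k. u m k - u n k) < e"
      and n: "n \<ge> n0" for e n0 n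
  proof -
    have bound: "(\<Sum>k<K. \<bar>u n k - f k\<bar> powr p) \<le> e powr p" for K
    proof (rule LIMSEQ_le_const2)
      show "(\<lambda>m. \<Sum>k<K. \<bar>u n k - u m k\<bar> powr p) \<longlonglongrightarrow> (\<Sum>k<K. \<bar>u n k - f k\<bar> powr p)"
        using p by (intro tendsto_sum tendsto_powr' tendsto_rabs tendsto_diff tendsto_const f) auto
      have "(\<Sum>k<K. \<bar>u n k - u m k\<bar> powr p) \<le> e powr p" if "m \<ge> n0" for m
      proof -
        have d: "(\<lambda>k. u n k - u m k) \<in> lp_space p" by (rule diff[OF u u])
        have "(\<Sum>k<K. \<bar>u n k - u m k\<bar> powr p) \<le> (\<Sum>k. \<bar>u n k - u m k\<bar> powr p)"
          using d by (intro sum_le_suminf) (auto simp: lp_space_def)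
        also have "\<dots> \<le> lp_norm p (\<lambda>k. u n k - u m k) powr p"
          using p by (simp add: lp_norm_powr)
        also have "\<dots> \<le> e powr p"
          using n0[OF n that] p by (intro powr_mono2) (auto simp: lp_norm_def)
        finally show ?thesis .
      qed
      then show "\<exists>N. \<forall>m\<ge>N. (\<Sum>k<K. \<bar>u n k - u m k\<bar> powr p) \<le> e powr p" by blast
    qed
    have s: "summable (\<lambda>k. \<bar>u n k - f k\<bar> powr p)"
      by (rule summableI_nonneg_bounded[OF _ bound]) simp
    have "(\<Sum>k. \<bar>u n k - f k\<bar> powr p) \<le> e powr p"
      by (rule suminf_le_const[OF s bound])
    then have "lp_norm p (\<lambda>k. u n k - f k) \<le> (e powr p) powr (1 / p)"
      unfolding lp_norm_def using s p by (intro powr_mono2 suminf_nonneg) auto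
    then show ?thesis using s p e by (simp add: lp_space_def powr_powr)
  qed
  show ?thesis
  proof (rule bexI[of _ f])
    obtain n0 where n0: "\<And>m n. m \<ge> n0 \<Longrightarrow> n \<ge> n0 \<Longrightarrow> lp_norm p (\<lambda>k. u m k - u n k) < 1"
      using cauchy[of 1] by auto
    have "(\<lambda>k. u n0 k - f k) \<in> lp_space p" using main[OF _ n0, where n = n0] by simp
    from diff[OF u[of n0] this] show "f \<in> lp_space p" by simp
    show "(\<lambda>n. lp_norm p (\<lambda>k. u n k - f k)) \<longlonglongrightarrow> 0"
    proof (rule LIMSEQ_I)
      fix r :: real assume "0 < r"
      then obtain n0 where n0: "\<And>m n. m \<ge> n0 \<Longrightarrow> n \<ge> n0 \<Longrightarrow> lp_norm p (\<lambda>k. u m k - u n k) < r / 2"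
        using cauchy[of "r / 2"] by auto
      have "norm (lp_norm p (\<lambda>k. u n k - f k) - 0) < r" if "n \<ge> n0" for n
        using main[OF _ n0 that] \<open>0 < r\<close> by (auto simp: lp_norm_def)
      then show "\<exists>no. \<forall>n\<ge>no. norm (lp_norm p (\<lambda>k. u n k - f k) - 0) < r" by blast
    qed
  qed
qed

lemma symmetric_seq_space_lp:
  assumes p: "0 < p" "p \<le> 1"
  shows "symmetric_seq_space (lp_space p) (lp_norm p)"
proof
  show "lp_space p \<subseteq> borel_measurable (count_space UNIV)"
    by (auto simp: measurable_count_space_eq1)
  show "(\<lambda>x. 0) \<in> lp_space p" by (simp add: lp_space_def)
  show "(\<lambda>x. f x + g x) \<in> lp_space p" if "f \<in> lp_space p" "g \<in> lp_space p" for f g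
    using lp_add p that by blast
  show "(\<lambda>x. c * f x) \<in> lp_space p" if "f \<in> lp_space p" for c f using lp_scale p that by blast
  show "0 \<le> lp_norm p f" for f by (simp add: lp_norm_def)
  show "(lp_norm p f = 0) = (AE x in count_space UNIV. f x = 0)" if f: "f \<in> lp_space p" for f
  proof
    assume "lp_norm p f = 0"
    then have "f k = 0" for k using lp_coordinate_le[OF p(1) f, of k] by simp
    then show "AE x in count_space UNIV. f x = 0" by simp
  qed (simp add: AE_count_space lp_norm_def)
  show "lp_norm p (\<lambda>x. c * f x) = \<bar>c\<bar> * lp_norm p f" if "f \<in> lp_space p" for c f
    using lp_scale p that by blast
  show "\<exists>C. \<forall>f\<in>lp_space p. \<forall>g\<in>lp_space p. lp_norm p (\<lambda>x. f x + g x) \<le> C * (lp_norm p f + lp_norm p g)"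
    using lp_add(2)[OF p] by blast
  show "\<exists>f\<in>lp_space p. (\<lambda>n. lp_norm p (\<lambda>x. u n x - f x)) \<longlonglongrightarrow> 0"
    if "\<forall>n. u n \<in> lp_space p" "\<forall>\<epsilon>>0. \<exists>n0. \<forall>m\<ge>n0. \<forall>n\<ge>n0. lp_norm p (\<lambda>x. u m x - u n x) < \<epsilon>" for u
    using lp_complete[OF p] that by blast
  show "bounded (range a)" if "a \<in> lp_space p" for a
    using lp_coordinate_le[OF p(1) that] by (auto simp: bounded_iff)
  show "b \<in> lp_space p \<and> lp_norm p b \<le> lp_norm p a"
    if "a \<in> lp_space p" "bounded (range b)" "\<forall>n. seq_rearrangement b n \<le> seq_rearrangement a n" for a b
    using that superlevel_card_le_of_rearrangement_le[of b a] by (intro lp_mem_norm_mono[OF p(1)]) auto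
  show "indicator {k} \<in> lp_space p \<and> lp_norm p (indicator {k}) = 1" for k :: nat
  proof -
    have "(\<lambda>i. \<bar>indicator {k} i\<bar> powr p :: real) = (\<lambda>i. if i = k then 1 else 0)"
      using p by (auto simp: indicator_def)
    then show ?thesis using sums_single[of k "\<lambda>_. 1::real"]
      by (auto simp: lp_space_def lp_norm_def sums_iff)
  qed
qed

section \<open>The Kruglov operator\<close>

interpretation unit_seq: sequence_space unit_interval ..

abbreviation unit_product :: "(nat \<Rightarrow> real) measure" where
  "unit_product \<equiv> PiM UNIV (\<lambda>_. unit_interval)"

lemma coordinate_measurable: "(\<lambda>\<omega>. \<omega> k) \<in> unit_product \<rightarrow>\<^sub>M unit_interval"
  by (rule measurable_component_singleton) simp

text \<open>
  Splitting off the first coordinate makes sums over coordinates accessible to induction: the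
  remaining coordinates have again the law of the whole sequence.
\<close>

lemma nn_integral_first_coordinate:
  assumes F[measurable]: "F \<in> borel_measurable unit_product"
  shows "(\<integral>\<^sup>+\<omega>. F \<omega> \<partial>unit_product) = (\<integral>\<^sup>+x. \<integral>\<^sup>+\<omega>. F (case_nat x \<omega>) \<partial>unit_product \<partial>unit_interval)"
proof -
  have "(\<integral>\<^sup>+\<omega>. F \<omega> \<partial>unit_product) =
      (\<integral>\<^sup>+\<omega>. F \<omega> \<partial>distr (unit_interval \<Otimes>\<^sub>M unit_product) unit_product (\<lambda>(s, \<omega>). case_nat s \<omega>))"
    by (simp only: unit_seq.PiM_iter)
  also have "\<dots> = (\<integral>\<^sup>+z. F (case z of (s, \<omega>) \<Rightarrow> case_nat s \<omega>) \<partial>(unit_interval \<Otimes>\<^sub>M unit_product))"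
    by (rule nn_integral_distr) measurable
  also have "\<dots> = (\<integral>\<^sup>+x. \<integral>\<^sup>+\<omega>. F (case (x, \<omega>) of (s, \<omega>) \<Rightarrow> case_nat s \<omega>) \<partial>unit_product \<partial>unit_interval)"
    by (rule unit_seq.nn_integral_fst[symmetric]) measurable
  also have "\<dots> = (\<integral>\<^sup>+x. \<integral>\<^sup>+\<omega>. F (case_nat x \<omega>) \<partial>unit_product \<partial>unit_interval)"
    by simp
  finally show ?thesis .
qed

lemma nn_integral_coordinate:
  assumes F: "F \<in> borel_measurable unit_interval"
  shows "(\<integral>\<^sup>+\<omega>. F (\<omega> k) \<partial>unit_product) = (\<integral>\<^sup>+x. F x \<partial>unit_interval)"
proof -
  have "(\<integral>\<^sup>+x. F x \<partial>unit_interval) = (\<integral>\<^sup>+x. F x \<partial>distr unit_product unit_interval (\<lambda>\<omega>. \<omega> k))"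
    by (subst distr_PiM_component[OF prob_space_unit_interval]) simp_all
  also have "\<dots> = (\<integral>\<^sup>+\<omega>. F (\<omega> k) \<partial>unit_product)"
    by (rule nn_integral_distr[OF coordinate_measurable]) (simp add: F)
  finally show ?thesis ..
qed

text \<open>
  The counterpart of \<open>jump_operator\<close> for the full law of \<open>\<phi>\<close>,
  including a possible atom at zero.
\<close>

definition shift_operator :: "(real \<Rightarrow> real) \<Rightarrow> (real \<Rightarrow> ennreal) \<Rightarrow> real \<Rightarrow> ennreal" where
  "shift_operator \<phi> F x = (\<integral>\<^sup>+y. F (x + \<phi> y) \<partial>unit_interval)"

lemma shift_operator_measurable:
  assumes [measurable]: "\<phi> \<in> borel_measurable unit_interval" "F \<in> borel_measurable borel"
  shows "shift_operator \<phi> F \<in> borel_measurable borel"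
  unfolding shift_operator_def[abs_def] by measurable

lemma shift_operator_power_measurable:
  assumes "\<phi> \<in> borel_measurable unit_interval" "F \<in> borel_measurable borel"
  shows "(shift_operator \<phi> ^^ n) F \<in> borel_measurable borel"
  using assms by (induction n) (auto intro: shift_operator_measurable)

lemma nn_integral_sum_coordinates:
  assumes \<phi>[measurable]: "\<phi> \<in> borel_measurable unit_interval" and F[measurable]: "F \<in> borel_measurable borel"
  shows "(\<integral>\<^sup>+\<omega>. F (x + (\<Sum>k<n. \<phi> (\<omega> k))) \<partial>unit_product) = (shift_operator \<phi> ^^ n) F x"
proof (induction n arbitrary: x)
  case 0
  show ?case by (simp add: unit_seq.emeasure_space_1 del: space_PiM)
next
  case (Suc n)
  note [measurable] = measurable_compose[OF coordinate_measurable \<phi>]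
  have "(\<integral>\<^sup>+\<omega>. F (x + (\<Sum>k<Suc n. \<phi> (\<omega> k))) \<partial>unit_product) =
      (\<integral>\<^sup>+y. \<integral>\<^sup>+\<omega>. F (x + (\<Sum>k<Suc n. \<phi> (case_nat y \<omega> k))) \<partial>unit_product \<partial>unit_interval)"
    by (rule nn_integral_first_coordinate) measurable
  also have "\<dots> = (\<integral>\<^sup>+y. \<integral>\<^sup>+\<omega>. F (x + \<phi> y + (\<Sum>k<n. \<phi> (\<omega> k))) \<partial>unit_product \<partial>unit_interval)"
    by (simp only: sum.lessThan_Suc_shift nat.case add.assoc)
  also have "\<dots> = (shift_operator \<phi> ^^ Suc n) F x"
    by (simp add: Suc.IH shift_operator_def[of \<phi> "(shift_operator \<phi> ^^ n) F"])
  finally show ?case .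
qed

context
  fixes A :: "nat \<Rightarrow> real set"
  assumes A_sets: "\<And>n. A n \<in> sets unit_interval" and A_disjoint: "disjoint_family A"
begin

lemma kruglov_on: "\<omega> 0 \<in> A n \<Longrightarrow> kruglov A f \<omega> = (\<Sum>k<n. f (\<omega> (Suc k)))"
proof -
  assume \<omega>: "\<omega> 0 \<in> A n"
  have "\<omega> 0 \<notin> A m" if "m \<noteq> n" for m
    using A_disjoint \<omega> that by (auto simp: disjoint_family_on_def)
  then have "kruglov A f \<omega> = (\<Sum>m\<in>{n}. \<Sum>k=1..m. f (\<omega> k) * indicator (A m) (\<omega> 0))"
    unfolding kruglov_def by (intro suminf_finite) auto
  also have "\<dots> = (\<Sum>k=1..n. f (\<omega> k))" using \<omega> by simp
  finally show ?thesis by (simp add: sum.atLeast1_atMost_eq)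
qed

lemma kruglov_off: "(\<And>n. \<omega> 0 \<notin> A n) \<Longrightarrow> kruglov A f \<omega> = 0"
  by (simp add: kruglov_def)

lemma kruglov_cases:
  obtains (on) n where "\<omega> 0 \<in> A n" "\<And>f. kruglov A f \<omega> = (\<Sum>k<n. f (\<omega> (Suc k)))"
  | (off) "\<And>f. kruglov A f \<omega> = 0"
  using kruglov_on[of \<omega>] kruglov_off[of \<omega>] by metis

lemma kruglov_nonneg: "(\<And>x. 0 \<le> f x) \<Longrightarrow> 0 \<le> kruglov A f \<omega>"
  by (rule kruglov_cases[of \<omega>]) (auto intro: sum_nonneg)

lemma kruglov_mono: "(\<And>k. f (\<omega> k) \<le> g (\<omega> k)) \<Longrightarrow> kruglov A f \<omega> \<le> kruglov A g \<omega>"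
  by (rule kruglov_cases[of \<omega>]) (auto intro: sum_mono)

lemma abs_kruglov_le: "\<bar>kruglov A f \<omega>\<bar> \<le> kruglov A (\<lambda>x. \<bar>f x\<bar>) \<omega>"
  by (rule kruglov_cases[of \<omega>]) auto

lemma kruglov_scale: "kruglov A (\<lambda>x. c * f x) \<omega> = c * kruglov A f \<omega>"
  by (rule kruglov_cases[of \<omega>]) (auto simp: sum_distrib_left)

lemma kruglov_measurable:
  assumes f: "f \<in> borel_measurable unit_interval"
  shows "kruglov A f \<in> borel_measurable unit_product"
proof -
  note [measurable] = measurable_compose[OF coordinate_measurable f] A_sets coordinate_measurable
  show ?thesis unfolding kruglov_def[abs_def] by measurable
qed

text \<open>
  Conditioning on \<open>\<omega> 0 \<in> A n\<close>: the value is then a sum of \<open>n\<close>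
  independent copies of \<open>f\<close>. The condition \<open>F 0 = 0\<close> covers the points
  outside all \<open>A n\<close>, where the operator gives zero.
\<close>

lemma nn_integral_kruglov:
  assumes f: "f \<in> borel_measurable unit_interval" and F[measurable]: "F \<in> borel_measurable borel"
    and F0: "F 0 = 0"
  shows "(\<integral>\<^sup>+\<omega>. F (kruglov A f \<omega>) \<partial>unit_product) =
    (\<Sum>n. emeasure unit_interval (A n) * (shift_operator f ^^ n) F 0)"
proof -
  note [measurable] = measurable_compose[OF coordinate_measurable f] A_sets coordinate_measurable
    kruglov_measurable[OF f]
  have eq: "F (kruglov A f (case_nat x \<omega>)) = (\<Sum>n. indicator (A n) x * F (0 + (\<Sum>k<n. f (\<omega> k))))" for x \<omega>
  proof (cases "\<exists>n. x \<in> A n")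
    case True
    then obtain n where n: "x \<in> A n" by blast
    have other: "x \<notin> A m" if "m \<noteq> n" for m
      using A_disjoint n that by (auto simp: disjoint_family_on_def)
    have "(\<Sum>m. indicator (A m) x * F (0 + (\<Sum>k<m. f (\<omega> k)))) =
        (\<Sum>m\<in>{n}. indicator (A m) x * F (0 + (\<Sum>k<m. f (\<omega> k))))"
      by (rule suminf_finite) (auto simp: other)
    then show ?thesis using n kruglov_on[of "case_nat x \<omega>" n f] by simp
  next
    case False
    then show ?thesis using kruglov_off[of "case_nat x \<omega>" f] F0 by simp
  qed
  have "(\<integral>\<^sup>+\<omega>. F (kruglov A f \<omega>) \<partial>unit_product) =
      (\<integral>\<^sup>+x. \<integral>\<^sup>+\<omega>. (\<Sum>n. indicator (A n) x * F (0 + (\<Sum>k<n. f (\<omega> k)))) \<partial>unit_product \<partial>unit_interval)"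
    unfolding eq[symmetric] by (rule nn_integral_first_coordinate) measurable
  also have "\<dots> = (\<integral>\<^sup>+x. (\<Sum>n. indicator (A n) x * (shift_operator f ^^ n) F 0) \<partial>unit_interval)"
  proof (rule nn_integral_cong)
    fix x
    have "(\<integral>\<^sup>+\<omega>. (\<Sum>n. indicator (A n) x * F (0 + (\<Sum>k<n. f (\<omega> k)))) \<partial>unit_product) =
        (\<Sum>n. \<integral>\<^sup>+\<omega>. indicator (A n) x * F (0 + (\<Sum>k<n. f (\<omega> k))) \<partial>unit_product)"
      by (rule nn_integral_suminf) measurable
    also have "\<dots> = (\<Sum>n. indicator (A n) x * (\<integral>\<^sup>+\<omega>. F (0 + (\<Sum>k<n. f (\<omega> k))) \<partial>unit_product))"
      by (intro arg_cong[where f = suminf] ext nn_integral_cmult) measurable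
    finally show "(\<integral>\<^sup>+\<omega>. (\<Sum>n. indicator (A n) x * F (0 + (\<Sum>k<n. f (\<omega> k)))) \<partial>unit_product) =
        (\<Sum>n. indicator (A n) x * (shift_operator f ^^ n) F 0)"
      by (simp only: nn_integral_sum_coordinates[OF f F])
  qed
  also have "\<dots> = (\<Sum>n. emeasure unit_interval (A n) * (shift_operator f ^^ n) F 0)"
    by (subst nn_integral_suminf) (simp_all add: nn_integral_multc A_sets)
  finally show ?thesis .
qed

end

lemma
  assumes T: "measure_preserving_bijection unit_interval product_space T"
  shows measure_preserving_measurable: "G \<in> unit_product \<rightarrow>\<^sub>M N \<Longrightarrow> (\<lambda>t. G (T t)) \<in> unit_interval \<rightarrow>\<^sub>M N"
    and nn_integral_measure_preserving: "F \<in> borel_measurable unit_product \<Longrightarrow>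
      (\<integral>\<^sup>+t. F (T t) \<partial>unit_interval) = (\<integral>\<^sup>+\<omega>. F \<omega> \<partial>unit_product)"
    and AE_measure_preserving: "(AE \<omega> in unit_product. P \<omega>) \<Longrightarrow> (AE t in unit_interval. P (T t))"
proof -
  have Tm: "T \<in> unit_interval \<rightarrow>\<^sub>M completion unit_product"
    and Td: "distr unit_interval (completion unit_product) T = completion unit_product"
    using T by (auto simp: measure_preserving_bijection_def product_space_def)
  show "(\<lambda>t. G (T t)) \<in> unit_interval \<rightarrow>\<^sub>M N" if "G \<in> unit_product \<rightarrow>\<^sub>M N"
    by (rule measurable_compose[OF Tm measurable_completion[OF that]])
  show "(\<integral>\<^sup>+t. F (T t) \<partial>unit_interval) = (\<integral>\<^sup>+\<omega>. F \<omega> \<partial>unit_product)" if F: "F \<in> borel_measurable unit_product"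
  proof -
    have "(\<integral>\<^sup>+t. F (T t) \<partial>unit_interval) = (\<integral>\<^sup>+\<omega>. F \<omega> \<partial>distr unit_interval (completion unit_product) T)"
      by (rule nn_integral_distr[OF Tm, symmetric]) (simp add: measurable_completion F)
    then show ?thesis by (simp only: Td nn_integral_completion)
  qed
  show "AE t in unit_interval. P (T t)" if "AE \<omega> in unit_product. P \<omega>"
    by (rule AE_distrD[OF Tm]) (simp only: Td, rule AE_completion[OF that])
qed

lemma AE_all_coordinates:
  assumes "AE x in unit_interval. P x"
  shows "AE \<omega> in unit_product. \<forall>k. P (\<omega> k)"
  unfolding AE_all_countable
  by (intro allI AE_PiM_component[OF prob_space_unit_interval _ assms]) simp

context symmetric_fun_space begin

text \<open>
  A positive operator on a complete quasi-normed lattice is bounded. If \<open>g n \<ge> 0\<close>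
  had norm \<open>(2 C) ^ (- n)\<close> and images of norm exceeding \<open>n\<close>, then
  \<open>\<Sum>n. g n\<close> would converge in \<open>X\<close> to a function \<open>f\<close>
  whose modulus dominates every \<open>g n\<close> almost everywhere, and the image of
  \<open>\<bar>f\<bar>\<close> would have norm exceeding every \<open>n\<close>.
\<close>

lemma kruglov_bounded:
  assumes A_sets: "\<And>n. A n \<in> sets unit_interval" and A_disjoint: "disjoint_family A"
    and T: "measure_preserving_bijection unit_interval product_space T"
    and p: "0 < p"
    and K: "\<And>f. f \<in> power_space X p \<Longrightarrow> (\<lambda>t. kruglov A f (T t)) \<in> power_space X p"
  obtains B where "0 \<le> B" "\<And>g. g \<in> X \<Longrightarrow> (\<And>x. 0 \<le> g x) \<Longrightarrow>
    (\<lambda>t. kruglov A (\<lambda>x. g x powr p) (T t) powr (1 / p)) \<in> X \<and>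
    N (\<lambda>t. kruglov A (\<lambda>x. g x powr p) (T t) powr (1 / p)) \<le> B * N g"
proof -
  define L where "L g = (\<lambda>t. kruglov A (\<lambda>x. g x powr p) (T t) powr (1 / p))" for g
  note A = A_sets A_disjoint
  have LX: "L g \<in> X" if g: "g \<in> X" "\<And>x. 0 \<le> g x" for g
  proof -
    note gm[measurable] = mem_measurable[OF g(1)]
    have "(\<lambda>x. \<bar>g x powr p\<bar> powr (1 / p)) = g" using g(2) p by (auto simp: powr_powr)
    then have "(\<lambda>x. g x powr p) \<in> power_space X p" using g(1) by (simp add: power_space_def)
    from K[OF this] have "(\<lambda>t. \<bar>kruglov A (\<lambda>x. g x powr p) (T t)\<bar> powr (1 / p)) \<in> X"
      by (simp add: power_space_def)
    then show ?thesis unfolding L_def by (simp add: kruglov_nonneg[OF A] abs_of_nonneg)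
  qed
  have Lmono: "AE t in unit_interval. L g t \<le> L h t"
    if "AE x in unit_interval. g x \<le> h x" "\<And>x. 0 \<le> g x" for g h
  proof -
    have "AE t in unit_interval. \<forall>k. g (T t k) \<le> h (T t k)"
      by (rule AE_measure_preserving[OF T, of "\<lambda>\<omega>. \<forall>k. g (\<omega> k) \<le> h (\<omega> k)"]) (rule AE_all_coordinates[OF that(1)])
    then show ?thesis
    proof eventually_elim
      case (elim t)
      then show ?case unfolding L_def using p that(2)
        by (intro powr_mono2 kruglov_mono[OF A] kruglov_nonneg[OF A]) auto
    qed
  qed
  have Lscale: "L (\<lambda>x. c * g x) = (\<lambda>t. c * L g t)" if "0 \<le> c" "\<And>x. 0 \<le> g x" for c g
  proof
    fix t
    have "(\<lambda>x. (c * g x) powr p) = (\<lambda>x. c powr p * g x powr p)"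
      using that by (simp add: powr_mult)
    then have "L (\<lambda>x. c * g x) t = (c powr p * kruglov A (\<lambda>x. g x powr p) (T t)) powr (1 / p)"
      by (simp add: L_def kruglov_scale[OF A])
    also have "\<dots> = c * L g t"
      using that p by (simp add: powr_mult powr_powr L_def kruglov_nonneg[OF A])
    finally show "L (\<lambda>x. c * g x) t = c * L g t" .
  qed
  have L_abs: "\<bar>L g t\<bar> = L g t" for g t by (simp add: L_def)
  have NLmono: "N (L g) \<le> N (L h)"
    if "AE x in unit_interval. g x \<le> h x" "\<And>x. 0 \<le> g x" "g \<in> X" "h \<in> X" "\<And>x. 0 \<le> h x" for g h
    using ideal[OF LX[OF that(4,5)] mem_measurable[OF LX[OF that(3,2)]]] Lmono[OF that(1,2)]
    by (simp add: L_abs)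
  obtain C where C: "1 \<le> C" "\<And>f g. f \<in> X \<Longrightarrow> g \<in> X \<Longrightarrow> N (\<lambda>x. f x + g x) \<le> C * (N f + N g)"
    using quasi_triangle_constant by blast
  have "\<exists>B\<ge>0. \<forall>g\<in>X. (\<forall>x. 0 \<le> g x) \<longrightarrow> N (L g) \<le> B * N g"
  proof (rule ccontr)
    assume neg: "\<not> ?thesis"
    have "\<exists>g. g \<in> X \<and> (\<forall>x. 0 \<le> g x) \<and> real n * (2 * C) ^ n * N g < N (L g)" for n
    proof -
      have "0 \<le> real n * (2 * C) ^ n" using C(1) by (intro mult_nonneg_nonneg zero_le_power) auto
      with neg show ?thesis by (meson not_le)
    qed
    then obtain G where G: "\<And>n. G n \<in> X" "\<And>n x. 0 \<le> G n x"
      "\<And>n. real n * (2 * C) ^ n * N (G n) < N (L (G n))" by metis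
    have NG: "0 < N (G n)" for n
    proof (rule ccontr)
      assume "\<not> 0 < N (G n)"
      then have N0: "N (G n) = 0" using nonneg[OF G(1)[of n]] by simp
      then have "AE x in unit_interval. G n x = 0" using definite[OF G(1)] by blast
      then have "AE x in unit_interval. G n x \<le> 0" by eventually_elim simp
      from NLmono[OF this G(2) G(1) zero_mem] have "N (L (G n)) \<le> N (L (\<lambda>_. 0))" by simp
      also have "L (\<lambda>_. 0) = (\<lambda>_. 0)" using Lscale[of 0 "\<lambda>_. 0"] by simp
      finally show False using G(3)[of n] N0 quasi_norm_zero by simp
    qed
    define c where "c n = 1 / ((2 * C) ^ n * N (G n))" for n
    define g where "g n = (\<lambda>x. c n * G n x)" for n
    have c: "0 < c n" for n unfolding c_def using NG[of n] C(1) by simp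
    have g: "g n \<in> X" "0 \<le> g n x" for n x
      unfolding g_def using G scale_mem c[of n] by (auto simp: less_imp_le)
    have Ng: "N (g n) = 1 / (2 * C) ^ n" for n
      unfolding g_def using homogeneous[OF G(1), of "c n" n] c[of n] NG[of n]
      by (simp add: c_def)
    have NLg: "real n < N (L (g n))" for n
    proof -
      have "N (L (g n)) = c n * N (L (G n))"
        unfolding g_def Lscale[OF less_imp_le[OF c] G(2)]
        using homogeneous[OF LX[OF G(1,2)], of "c n" n] c[of n] by simp
      also have "\<dots> > c n * (real n * (2 * C) ^ n * N (G n))"
        by (rule mult_strict_left_mono[OF G(3) c])
      also have "c n * (real n * (2 * C) ^ n * N (G n)) = real n"
        using NG[of n] C(1) by (simp add: c_def)
      finally show ?thesis .
    qed
    define u where "u m = (\<lambda>x. \<Sum>i<m. g i x)" for m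
    have u: "u m \<in> X" for m unfolding u_def using g by (intro sum_mem)
    have tail: "N (\<lambda>x. u (a + d) x - u a x) \<le> 2 * C * (1 / 2) ^ a" for a d
    proof -
      have eq: "(\<lambda>x. u (a + d) x - u a x) = (\<lambda>x. \<Sum>i<d. g (a + i) x)"
        by (induction d) (auto simp: u_def fun_eq_iff algebra_simps)
      have "N (\<lambda>x. \<Sum>i<d. g (a + i) x) \<le> (\<Sum>i<d. C ^ Suc i * N (g (a + i)))"
        by (rule quasi_norm_sum_le[OF C]) (auto intro: g)
      also have "\<dots> \<le> (\<Sum>i<d. C * (1 / 2) ^ a * (1 / 2) ^ i)"
      proof (rule sum_mono)
        fix i
        have "C ^ Suc i * N (g (a + i)) = C * (1 / 2) ^ a * (1 / 2) ^ i * (1 / C ^ a)"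
          using C(1) by (simp add: Ng power_add power_mult_distrib field_simps)
        also have "\<dots> \<le> C * (1 / 2) ^ a * (1 / 2) ^ i * 1"
          using C(1) by (intro mult_left_mono) (auto simp: one_le_power)
        finally show "C ^ Suc i * N (g (a + i)) \<le> C * (1 / 2) ^ a * (1 / 2) ^ i" by simp
      qed
      also have "\<dots> = C * (1 / 2) ^ a * (\<Sum>i<d. (1 / 2) ^ i)" by (simp add: sum_distrib_left)
      also have "\<dots> \<le> C * (1 / 2) ^ a * 2"
      proof (intro mult_left_mono)
        have "(\<Sum>j<d. (1 / 2 :: real) ^ j) \<le> (\<Sum>j. (1 / 2) ^ j)"
          by (rule sum_le_suminf) (auto intro: summable_geometric)
        then show "(\<Sum>j<d. (1 / 2 :: real) ^ j) \<le> 2" by (simp add: suminf_geometric)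
      qed (use C in auto)
      finally show ?thesis unfolding eq by simp
    qed
    have sym: "N (\<lambda>x. f x - h x) = N (\<lambda>x. h x - f x)" if "f \<in> X" "h \<in> X" for f h
      using homogeneous[OF diff_mem[OF that(2,1)], of "-1"] by simp
    have "\<exists>f\<in>X. (\<lambda>n. N (\<lambda>x. u n x - f x)) \<longlonglongrightarrow> 0"
    proof (rule complete)
      show "\<forall>n. u n \<in> X" using u by blast
      show "\<forall>\<epsilon>>0. \<exists>n0. \<forall>m\<ge>n0. \<forall>n\<ge>n0. N (\<lambda>x. u m x - u n x) < \<epsilon>"
      proof (intro allI impI)
        fix \<epsilon> :: real assume "0 < \<epsilon>"
        have "(\<lambda>a. 2 * C * (1 / 2 :: real) ^ a) \<longlonglongrightarrow> 2 * C * 0"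
          by (intro tendsto_mult tendsto_const LIMSEQ_power_zero) auto
        then have "\<forall>\<^sub>F a in sequentially. 2 * C * (1 / 2 :: real) ^ a < \<epsilon>"
          using \<open>0 < \<epsilon>\<close> by (intro order_tendstoD(2)) auto
        then obtain n0 where n0: "\<And>a. a \<ge> n0 \<Longrightarrow> 2 * C * (1 / 2 :: real) ^ a < \<epsilon>"
          by (auto simp: eventually_sequentially)
        have "N (\<lambda>x. u m x - u n x) < \<epsilon>" if "m \<ge> n0" "n \<ge> n0" for m n
        proof (cases "n \<le> m")
          case True
          then show ?thesis using tail[of n "m - n"] n0[OF that(2)] by simp
        next
          case False
          then show ?thesis using tail[of m "n - m"] n0[OF that(1)] sym[OF u u, of m n] by simp
        qed
        then show "\<exists>n0. \<forall>m\<ge>n0. \<forall>n\<ge>n0. N (\<lambda>x. u m x - u n x) < \<epsilon>" by blast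
      qed
    qed
    then obtain f where f: "f \<in> X" "(\<lambda>n. N (\<lambda>x. u n x - f x)) \<longlonglongrightarrow> 0" by blast
    note [measurable] = mem_measurable[OF f(1)] mem_measurable[OF g(1)]
    have le: "AE x in unit_interval. g n x \<le> \<bar>f x\<bar>" for n
    proof -
      \<comment> \<open>The excess of \<open>g n\<close> over the limit is bounded by the distance of later partial sums from it.\<close>
      let ?w = "\<lambda>x. max (g n x - f x) 0"
      have w: "?w \<in> X \<and> N ?w \<le> N (\<lambda>x. u m x - f x)" if "n < m" for m
      proof (rule ideal[OF diff_mem[OF u f(1)]])
        have "g n x \<le> u m x" for x
          unfolding u_def using that g by (intro member_le_sum) auto
        then have "\<bar>max (g n x - f x) 0\<bar> \<le> \<bar>u m x - f x\<bar>" for x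
          by (smt (verit, best))
        then show "AE x in unit_interval. \<bar>max (g n x - f x) 0\<bar> \<le> \<bar>u m x - f x\<bar>" by simp
      qed measurable
      have "N ?w \<le> 0"
        by (rule LIMSEQ_le_const[OF f(2)]) (use w in \<open>auto intro!: exI[of _ "Suc n"]\<close>)
      moreover have wX: "?w \<in> X" using w[of "Suc n"] by blast
      ultimately have "N ?w = 0" using nonneg[OF wX] by simp
      then have "AE x in unit_interval. ?w x = 0" using definite[OF wX] by blast
      then show ?thesis by eventually_elim (auto simp: max_def split: if_splits)
    qed
    have af: "(\<lambda>x. \<bar>f x\<bar>) \<in> X" using ideal[OF f(1), of "\<lambda>x. \<bar>f x\<bar>"] by simp
    obtain n where "N (L (\<lambda>x. \<bar>f x\<bar>)) < real n" using reals_Archimedean2 by blast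
    moreover have "N (L (g n)) \<le> N (L (\<lambda>x. \<bar>f x\<bar>))"
      by (rule NLmono[OF le g(2,1) af]) simp
    ultimately show False using NLg[of n] by simp
  qed
  then obtain B where "0 \<le> B" "\<And>g. g \<in> X \<Longrightarrow> (\<And>x. 0 \<le> g x) \<Longrightarrow> N (L g) \<le> B * N g" by blast
  then show ?thesis using that[of B] LX unfolding L_def by blast
qed

end

section \<open>Counting exceedances\<close>

text \<open>
  Expresses finiteness and cardinality by partial sums, which are visibly measurable in a
  parameter.
\<close>

lemma finite_card_le_iff_partial_sums:
  fixes P :: "nat \<Rightarrow> bool"
  shows "(\<forall>m. (\<Sum>k<m. of_bool (P k) :: real) \<le> real n) \<longleftrightarrow> finite {k. P k} \<and> card {k. P k} \<le> n"
proof
  have eq: "(\<Sum>k<m. of_bool (P k) :: real) = real (card {k\<in>{..<m}. P k})" for m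
    by (subst sum_of_bool_eq) (simp_all add: Int_def)
  assume *: "\<forall>m. (\<Sum>k<m. of_bool (P k) :: real) \<le> real n"
  have le: "card K \<le> n" if K: "finite K" "K \<subseteq> {k. P k}" for K
  proof -
    obtain m where "K \<subseteq> {..<m}" using K(1) finite_nat_iff_bounded[of K] by auto
    then have "K \<subseteq> {k\<in>{..<m}. P k}" using K by auto
    then have "card K \<le> card {k\<in>{..<m}. P k}" by (intro card_mono) auto
    also have "\<dots> \<le> n" using * eq by (metis of_nat_le_iff)
    finally show ?thesis .
  qed
  have "finite {k. P k}"
  proof (rule ccontr)
    assume "infinite {k. P k}"
    then obtain K where "K \<subseteq> {k. P k}" "finite K" "card K = Suc n"
      using infinite_arbitrarily_large by blast
    with le[of K] show False by simp
  qed
  with le show "finite {k. P k} \<and> card {k. P k} \<le> n" by blast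
next
  have eq: "(\<Sum>k<m. of_bool (P k) :: real) = real (card {k\<in>{..<m}. P k})" for m
    by (subst sum_of_bool_eq) (simp_all add: Int_def)
  assume *: "finite {k. P k} \<and> card {k. P k} \<le> n"
  show "\<forall>m. (\<Sum>k<m. of_bool (P k) :: real) \<le> real n"
  proof
    fix m
    have "card {k\<in>{..<m}. P k} \<le> card {k. P k}" using * by (intro card_mono) auto
    then show "(\<Sum>k<m. of_bool (P k) :: real) \<le> real n" unfolding eq using * by simp
  qed
qed

definition few_exceedances :: "'a measure \<Rightarrow> (nat \<Rightarrow> 'a \<Rightarrow> real) \<Rightarrow> real \<Rightarrow> nat \<Rightarrow> 'a set" where
  "few_exceedances M f s n =
    {t \<in> space M. finite (superlevel (\<lambda>k. f k t) s) \<and> card (superlevel (\<lambda>k. f k t) s) \<le> n}"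

lemma few_exceedances_eq:
  "few_exceedances M f s n =
    {t \<in> space M. \<forall>m. (\<Sum>k<m. indicator {\<omega> \<in> space M. \<bar>f k \<omega>\<bar> > s} t) \<le> real n}"
proof -
  have "(\<Sum>k<m. indicator {\<omega> \<in> space M. \<bar>f k \<omega>\<bar> > s} t :: real) = (\<Sum>k<m. of_bool (\<bar>f k t\<bar> > s))"
    if "t \<in> space M" for t m
    using that by (intro sum.cong) (auto simp: indicator_def)
  then show ?thesis
    unfolding few_exceedances_def by (auto simp only: finite_card_le_iff_partial_sums[symmetric])
qed

lemma few_exceedances_measurable:
  assumes "\<And>k. f k \<in> borel_measurable M"
  shows "few_exceedances M f s n \<in> sets M"
proof -
  note [measurable] = assms
  have "(\<Sum>k<m. indicator {\<omega> \<in> space M. \<bar>f k \<omega>\<bar> > s} t) = (\<Sum>k<m. indicator {y. \<bar>y\<bar> > s} (f k t) :: real)"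
    if "t \<in> space M" for t m
    using that by (intro sum.cong) (auto simp: indicator_def)
  then have "few_exceedances M f s n =
      {t \<in> space M. \<forall>m. (\<Sum>k<m. indicator {y. \<bar>y\<bar> > s} (f k t)) \<le> real n}"
    unfolding few_exceedances_eq by (intro Collect_cong) (simp cong: conj_cong)
  then show ?thesis by simp
qed

context prob_space begin

text \<open>
  The Chernoff bound with \<open>\<theta> = -1\<close>. The expected number of exceedances may be
  infinite, so that it enters through a real lower bound \<open>D\<close>.
\<close>

lemma few_exceedances_le:
  assumes ind: "indep_vars (\<lambda>_. borel) f UNIV"
    and D: "ennreal D \<le> (\<Sum>k. distribution_fn M (f k) s)"
  shows "prob (few_exceedances M f s n) \<le> exp (real n - D / 2)"
proof (rule ccontr)
  define p where "p k = prob {\<omega> \<in> space M. \<bar>f k \<omega>\<bar> > s}" for k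
  define P where "P = prob (few_exceedances M f s n)"
  assume neg: "\<not> ?thesis"
  have fm[measurable]: "f k \<in> borel_measurable M" for k using ind by (auto simp: indep_vars_def)
  have Ppos: "0 < P" using neg exp_gt_zero[of "real n - D / 2"] unfolding P_def by linarith
  \<comment> \<open>\<open>x\<close> is the value of \<open>D\<close> for which the bound would be an equality.\<close>
  define x where "x = 2 * (real n - ln P)"
  have "real n - x / 2 = ln P" by (simp add: x_def field_simps)
  then have "exp (real n - x / 2) = P" using Ppos by simp
  then have "exp (real n - D / 2) < exp (real n - x / 2)" using neg by (simp add: P_def)
  then have xD: "x < D" by simp
  have small: "P \<le> exp (real n - (\<Sum>k<m. p k) / 2)" for m
  proof -
    have "P \<le> prob {\<omega> \<in> space M. (-1) * real n \<le> (-1) * (\<Sum>k<m. indicator {\<omega> \<in> space M. \<bar>f k \<omega>\<bar> > s} \<omega>)}"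
      unfolding P_def by (rule finite_measure_mono) (auto simp: few_exceedances_eq, measurable)
    also have "\<dots> \<le> exp ((exp (-1) - 1) * (\<Sum>k<m. p k) - (-1) * real n)"
      unfolding p_def by (rule indep_count_chernoff[OF ind])
    also have "\<dots> \<le> exp (real n - (\<Sum>k<m. p k) / 2)"
    proof -
      have "exp (-1 :: real) \<le> 1 / 2" using exp_ge_add_one_self[of 1] by (simp add: exp_minus field_simps)
      then have "(exp (-1) - 1) * (\<Sum>k<m. p k) \<le> (- 1 / 2) * (\<Sum>k<m. p k)"
        by (intro mult_right_mono sum_nonneg) (auto simp: p_def)
      then show ?thesis by simp
    qed
    finally show ?thesis .
  qed
  have "(\<Sum>k<m. p k) \<le> x" for m
  proof -
    have "ln P \<le> real n - (\<Sum>k<m. p k) / 2" 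
      using small[of m] Ppos ln_le_cancel_iff[of P "exp (real n - (\<Sum>k<m. p k) / 2)"] by simp
    then show ?thesis by (simp add: x_def)
  qed
  then have le: "(\<Sum>k<m. ennreal (p k)) \<le> ennreal x" for m
    by (subst sum_ennreal) (auto simp: p_def intro!: ennreal_leI)
  have "(\<Sum>k. distribution_fn M (f k) s) = (\<Sum>k. ennreal (p k))"
    by (simp add: distribution_fn_def p_def emeasure_eq_measure)
  also have "\<dots> \<le> ennreal x" by (rule suminf_le_const[OF summableI le])
  finally have "ennreal D \<le> ennreal x" using D by (rule order_trans[rotated])
  moreover have "0 \<le> x" using \<open>\<And>m. (\<Sum>k<m. p k) \<le> x\<close>[of 0] by simp
  ultimately show False using xD by (simp add: ennreal_le_iff)
qed

lemma many_exceedances_le: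
  assumes ind: "indep_vars (\<lambda>_. borel) f UNIV"
    and D: "(\<Sum>k. distribution_fn M (f k) s) \<le> ennreal D" "0 \<le> D" and \<theta>: "0 \<le> \<theta>"
  shows "prob (space M - few_exceedances M f s n) \<le> exp ((exp \<theta> - 1) * D - \<theta> * real n)"
proof -
  define p where "p k = prob {\<omega> \<in> space M. \<bar>f k \<omega>\<bar> > s}" for k
  have fm[measurable]: "f k \<in> borel_measurable M" for k using ind by (auto simp: indep_vars_def)
  let ?N = "\<lambda>m \<omega>. \<Sum>k<m. indicator {\<omega> \<in> space M. \<bar>f k \<omega>\<bar> > s} \<omega> :: real"
  let ?B = "\<lambda>m. {\<omega> \<in> space M. real n < ?N m \<omega>}"
  have eq: "space M - few_exceedances M f s n = (\<Union>m. ?B m)"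
    unfolding few_exceedances_eq
    by (intro set_eqI, simp only: Diff_iff mem_Collect_eq UN_iff de_Morgan_conj not_all not_le) blast
  have "?B m \<in> sets M" for m by measurable
  moreover have "incseq ?B"
  proof (rule incseq_SucI, safe)
    fix m \<omega> assume "real n < ?N m \<omega>"
    moreover have "?N m \<omega> \<le> ?N (Suc m) \<omega>" by simp
    ultimately show "real n < ?N (Suc m) \<omega>" by linarith
  qed
  ultimately have "(\<lambda>m. prob (?B m)) \<longlonglongrightarrow> prob (\<Union>m. ?B m)"
    by (intro finite_Lim_measure_incseq) auto
  then have lim: "(\<lambda>m. prob (?B m)) \<longlonglongrightarrow> prob (space M - few_exceedances M f s n)" by (simp only: eq)
  have "prob (?B m) \<le> exp ((exp \<theta> - 1) * D - \<theta> * real n)" for m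
  proof -
    have "prob (?B m) \<le> prob {\<omega> \<in> space M. \<theta> * real n \<le> \<theta> * ?N m \<omega>}"
    proof (rule finite_measure_mono)
      show "?B m \<subseteq> {\<omega> \<in> space M. \<theta> * real n \<le> \<theta> * ?N m \<omega>}"
      proof
        fix \<omega> assume "\<omega> \<in> ?B m"
        then have "\<omega> \<in> space M" "real n \<le> ?N m \<omega>" by (simp_all only: mem_Collect_eq less_imp_le)
        then show "\<omega> \<in> {\<omega> \<in> space M. \<theta> * real n \<le> \<theta> * ?N m \<omega>}"
          using mult_left_mono[OF _ \<theta>] by (simp only: mem_Collect_eq)
      qed
    qed measurable
    also have "\<dots> \<le> exp ((exp \<theta> - 1) * (\<Sum>k<m. p k) - \<theta> * real n)"
      unfolding p_def by (rule indep_count_chernoff[OF ind])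
    also have "\<dots> \<le> exp ((exp \<theta> - 1) * D - \<theta> * real n)"
    proof -
      have "ennreal (\<Sum>k<m. p k) = (\<Sum>k<m. ennreal (p k))" by (simp add: p_def)
      also have "\<dots> \<le> (\<Sum>k. ennreal (p k))" by (rule sum_le_suminf) auto
      also have "\<dots> = (\<Sum>k. distribution_fn M (f k) s)"
        by (simp add: distribution_fn_def p_def emeasure_eq_measure)
      finally have "(\<Sum>k<m. p k) \<le> D" using D by (meson ennreal_le_iff order_trans)
      then show ?thesis using \<theta> by (auto intro!: mult_left_mono)
    qed
    finally show ?thesis .
  qed
  then show ?thesis by (intro LIMSEQ_le_const2[OF lim]) auto
qed

end

section \<open>Comparing a sample with the rearrangement\<close>

lemma power_of_two_between:
  assumes "1 \<le> (q::nat)"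
  obtains k where "1 \<le> k" "q < 2 ^ k" "2 ^ k \<le> 2 * q"
proof -
  define k where "k = (LEAST k. q < 2 ^ k)"
  have k: "q < 2 ^ k" unfolding k_def by (rule LeastI[of _ q]) (rule less_exp)
  then have "k \<noteq> 0" using assms by (cases k) auto
  then obtain i where i: "k = Suc i" by (cases k) auto
  have "\<not> q < 2 ^ i" using not_less_Least[of i "\<lambda>k. q < 2 ^ k"] i by (simp add: k_def)
  then have "2 ^ k \<le> 2 * q" using i by simp
  with k \<open>k \<noteq> 0\<close> show ?thesis using that[of k] by simp
qed

context symmetric_seq_space begin

text \<open>
  Here \<open>g\<close> plays the part of \<open>\<mu>\<close>. Dyadic arguments suffice: if the
  comparison sequence \<open>a\<close> has \<open>q\<close> entries above \<open>s\<close> and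
  \<open>q < 2 ^ k \<le> 2 q\<close>, then \<open>g (2 ^ (k + 2)) \<le> s\<close>, so fewer than
  \<open>2 ^ (k + 2) \<le> 8 q\<close> of the numbers \<open>g 1, g 2, \<dots>\<close> exceed
  \<open>s\<close>. The entry \<open>g 1\<close> added to \<open>a\<close> ensures \<open>q \<ge>
  1\<close> for \<open>s < g 1\<close>.
\<close>

lemma rearrangement_le_sample:
  assumes C: "\<And>f g. f \<in> E \<Longrightarrow> g \<in> E \<Longrightarrow> N (\<lambda>x. f x + g x) \<le> C * (N f + N g)" "1 \<le> C"
    and x: "x \<in> E" and g0: "\<And>t. 0 \<le> g t"
    and anti: "\<And>t t'. 0 < t \<Longrightarrow> t \<le> t' \<Longrightarrow> g t' \<le> g t"
    and many: "\<And>k. 1 \<le> k \<Longrightarrow> 0 < g (2 ^ (k + 2)) \<Longrightarrow>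
      \<not> (finite (superlevel x (g (2 ^ (k + 2)) / 2)) \<and> card (superlevel x (g (2 ^ (k + 2)) / 2)) \<le> 2 ^ k)"
  shows "(\<lambda>n. g (real (Suc n))) \<in> E \<and> N (\<lambda>n. g (real (Suc n))) \<le> (2 * C) ^ 3 * (C * (2 * N x + g 1))"
proof -
  define e where "e n = g (real (Suc n))" for n
  define a where "a k = 2 * \<bar>x k\<bar> + g 1 * indicator {0} k" for k :: nat
  have x2: "(\<lambda>k. 2 * \<bar>x k\<bar>) \<in> E \<and> N (\<lambda>k. 2 * \<bar>x k\<bar>) \<le> 2 * N x"
  proof -
    have 1: "(\<lambda>k. \<bar>x k\<bar>) \<in> E \<and> N (\<lambda>k. \<bar>x k\<bar>) \<le> N x" by (rule solid[OF x]) simp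
    then show ?thesis using homogeneous[of "\<lambda>k. \<bar>x k\<bar>" 2] scale_mem[of "\<lambda>k. \<bar>x k\<bar>" 2] by simp
  qed
  have i: "(\<lambda>k. g 1 * indicator {0} k) \<in> E \<and> N (\<lambda>k. g 1 * indicator {0} k) = g 1"
    using homogeneous[of "indicator {0}" "g 1"] scale_mem[of "indicator {0}" "g 1"] unit_vectors[of 0] g0[of 1]
    by simp
  have aE: "a \<in> E" unfolding a_def using add_mem x2 i by blast
  have "N a \<le> C * (N (\<lambda>k. 2 * \<bar>x k\<bar>) + N (\<lambda>k. g 1 * indicator {0} k))"
    unfolding a_def using C x2 i by blast
  also have "\<dots> \<le> C * (2 * N x + g 1)"
    using C(2) x2 i by (intro mult_left_mono add_mono) auto
  finally have Na: "N a \<le> C * (2 * N x + g 1)" .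
  have "e \<in> E \<and> N e \<le> (2 * C) ^ 3 * N a"
  proof (rule seq_dilation_power[OF C aE])
    fix s :: real assume s: "0 \<le> s" and fin: "finite (superlevel a s)"
    show "finite (superlevel e s) \<and> card (superlevel e s) \<le> 2 ^ 3 * card (superlevel a s)"
    proof (cases "s < g 1")
      case False
      have "e n \<le> g 1" "0 \<le> e n" for n unfolding e_def by (auto intro: anti g0)
      then have "superlevel e s = {}" using False by (auto simp: not_less intro: order_trans)
      then show ?thesis by (simp only: finite.emptyI card.empty) simp
    next
      case True
      have "0 \<in> superlevel a s" using True g0[of 1] by (simp add: a_def)
      then have "1 \<le> card (superlevel a s)" using fin by (metis One_nat_def Suc_leI card_gt_0_iff empty_iff)
      then obtain k where k: "1 \<le> k" "card (superlevel a s) < 2 ^ k" "2 ^ k \<le> 2 * card (superlevel a s)"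
        by (rule power_of_two_between)
      have gs: "g (2 ^ (k + 2)) \<le> s"
      proof (rule ccontr)
        assume "\<not> ?thesis"
        then have *: "s < g (2 ^ (k + 2))" by simp
        have "superlevel x (g (2 ^ (k + 2)) / 2) \<subseteq> superlevel a s"
        proof
          fix i assume "i \<in> superlevel x (g (2 ^ (k + 2)) / 2)"
          then have "s < 2 * \<bar>x i\<bar>" using * by simp
          also have "\<dots> \<le> \<bar>a i\<bar>" using g0[of 1] by (simp add: a_def indicator_def)
          finally show "i \<in> superlevel a s" by simp
        qed
        then have "finite (superlevel x (g (2 ^ (k + 2)) / 2))"
            "card (superlevel x (g (2 ^ (k + 2)) / 2)) \<le> card (superlevel a s)"
          using fin by (auto intro: finite_subset card_mono)
        then show False using many[OF k(1)] * s k(2) by auto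
      qed
      have "superlevel e s \<subseteq> {..<2 ^ (k + 2)}"
      proof
        fix n assume "n \<in> superlevel e s"
        then have "g (2 ^ (k + 2)) < g (real (Suc n))" using gs g0[of "real (Suc n)"] by (simp add: e_def)
        then have "\<not> (2 ^ (k + 2) \<le> real (Suc n))" using anti[of "2 ^ (k + 2)" "real (Suc n)"] by force
        then have "real (Suc n) < real (2 ^ (k + 2))" by simp
        then show "n \<in> {..<2 ^ (k + 2)}" by (simp only: of_nat_less_iff) simp
      qed
      then have "finite (superlevel e s)" "card (superlevel e s) \<le> 2 ^ (k + 2)"
        using finite_subset card_mono[of "{..<2 ^ (k + 2)}" "superlevel e s"] by auto
      moreover have "2 ^ (k + 2) \<le> 2 ^ 3 * card (superlevel a s)" using k(3) by simp
      ultimately show ?thesis by linarith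
    qed
  qed
  then have "e \<in> E" "N e \<le> (2 * C) ^ 3 * N a" by auto
  moreover have "(2 * C) ^ 3 * N a \<le> (2 * C) ^ 3 * (C * (2 * N x + g 1))"
    using C(2) by (intro mult_left_mono[OF Na]) simp
  ultimately show ?thesis unfolding e_def[abs_def] by linarith
qed

text \<open>
  The same dyadic comparison in the opposite direction; the surplus factor \<open>2 ^ j\<close> in
  the counts costs \<open>j\<close> further dilations.
\<close>

lemma sample_le_rearrangement:
  assumes C: "\<And>f g. f \<in> E \<Longrightarrow> g \<in> E \<Longrightarrow> N (\<lambda>x. f x + g x) \<le> C * (N f + N g)" "1 \<le> C"
    and e: "(\<lambda>n. g (real (Suc n))) \<in> E" and g0: "\<And>t. 0 \<le> g t"
    and anti: "\<And>t t'. 0 < t \<Longrightarrow> t \<le> t' \<Longrightarrow> g t' \<le> g t"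
    and y: "\<And>k. \<bar>y k\<bar> \<le> g 1"
    and few: "\<And>i. finite (superlevel y (g (2 ^ i))) \<and> card (superlevel y (g (2 ^ i))) \<le> 2 ^ (i + j)"
  shows "y \<in> E \<and> N y \<le> (2 * C) ^ Suc j * N (\<lambda>n. g (real (Suc n)))"
proof -
  define e where "e n = g (real (Suc n))" for n
  have eE: "e \<in> E" using assms(3) by (simp add: e_def[abs_def])
  have "y \<in> E \<and> N y \<le> (2 * C) ^ Suc j * N e"
  proof (rule seq_dilation_power[OF C eE])
    fix s :: real assume s: "0 \<le> s" and fin: "finite (superlevel e s)"
    show "finite (superlevel y s) \<and> card (superlevel y s) \<le> 2 ^ Suc j * card (superlevel e s)"
    proof (cases "s < g 1")
      case False
      then have "superlevel y s = {}" using y by (auto simp: not_less intro: order_trans)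
      then show ?thesis by (simp only: finite.emptyI card.empty) simp
    next
      case True
      define q where "q = card (superlevel e s)"
      have "0 \<in> superlevel e s" using True g0[of 1] by (simp add: e_def)
      then have q1: "1 \<le> q" unfolding q_def using fin by (metis One_nat_def Suc_leI card_gt_0_iff empty_iff)
      then obtain i where i: "1 \<le> i" "q < 2 ^ i" "2 ^ i \<le> 2 * q" by (rule power_of_two_between)
      have eq: "e q \<le> s"
      proof (rule ccontr)
        assume "\<not> e q \<le> s"
        then have "s < e n" if "n \<le> q" for n
          using anti[of "real (Suc n)" "real (Suc q)"] that by (simp add: e_def)
        then have "{..q} \<subseteq> superlevel e s" using g0 by (auto simp: e_def intro: less_le_trans)
        then have "card {..q} \<le> q" unfolding q_def by (intro card_mono fin)
        then show False by simp
      qed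
      have "real (Suc q) \<le> 2 ^ i" using i(2) by (metis Suc_leI numeral_power_eq_of_nat_cancel_iff of_nat_le_iff)
      then have "g (2 ^ i) \<le> e q" unfolding e_def by (intro anti) auto
      then have sub: "superlevel y s \<subseteq> superlevel y (g (2 ^ i))" using eq by auto
      then have "finite (superlevel y s)" "card (superlevel y s) \<le> 2 ^ (i + j)"
        using few[of i] finite_subset card_mono[OF _ sub] by (auto intro: order_trans)
      moreover have "(2::nat) ^ (i + j) \<le> 2 ^ Suc j * q"
        using mult_right_mono[OF i(3), of "2 ^ j"] by (simp add: power_add mult_ac)
      ultimately show ?thesis unfolding q_def by linarith
    qed
  qed
  then show ?thesis by (simp add: e_def[abs_def])
qed

end

section \<open>The lower estimate\<close>

abbreviation half_line :: "real measure" where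
  "half_line \<equiv> lebesgue_on {0<..}"

lemma decreasing_fun_nonneg: "0 \<le> decreasing_fun M f t"
  by (simp add: decreasing_fun_def)

lemma decreasing_fun_antimono:
  assumes "rearrangement M f t < \<infinity>" "t \<le> t'"
  shows "decreasing_fun M f t' \<le> decreasing_fun M f t"
  unfolding decreasing_fun_def using assms by (intro enn2real_mono rearrangement_antimono) auto

lemma ennreal_one_half: "(1 / 2 :: ennreal) = ennreal (1 / 2)"
  using divide_ennreal[of 1 2] by simp

lemma exp_minus_le_one_minus_half:
  fixes x :: real assumes "0 \<le> x" "x \<le> 1"
  shows "exp (- x) \<le> 1 - x / 2"
proof -
  have "exp (- x) = 1 / exp x" by (simp add: exp_minus inverse_eq_divide)
  also have "\<dots> \<le> 1 / (1 + x)" using assms exp_ge_add_one_self[of x] by (intro divide_left_mono) auto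
  also have "\<dots> \<le> 1 - x / 2"
  proof -
    have "x * x \<le> x" using assms mult_left_le_one_le[of x x] by simp
    then have "1 \<le> (1 - x / 2) * (1 + x)" by (simp add: algebra_simps)
    then show ?thesis using assms by (simp add: pos_divide_le_eq)
  qed
  finally show ?thesis .
qed

context symmetric_fun_space begin

lemma AE_eq_mem_norm:
  assumes "f \<in> X" "g \<in> borel_measurable unit_interval" "AE t in unit_interval. g t = f t"
  shows "g \<in> X" "N g = N f"
proof -
  have 1: "AE t in unit_interval. \<bar>g t\<bar> \<le> \<bar>f t\<bar>" using assms(3) by eventually_elim simp
  from ideal[OF assms(1,2) 1] have g: "g \<in> X" "N g \<le> N f" by auto
  have 2: "AE t in unit_interval. \<bar>f t\<bar> \<le> \<bar>g t\<bar>" using assms(3) by eventually_elim simp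
  from ideal[OF g(1) mem_measurable[OF assms(1)] 2] g show "g \<in> X" "N g = N f" by auto
qed

lemma fun_norm_rearrangement:
  assumes fin: "\<And>t. 0 < t \<Longrightarrow> rearrangement M f t < \<infinity>" and m: "decreasing_fun M f \<in> X"
  shows "fun_norm X N (\<lambda>t. rearrangement M f t * indicator {0<..<1} t) = ennreal (N (decreasing_fun M f))"
proof -
  let ?F = "\<lambda>t. rearrangement M f t * indicator {0<..<1} t"
  have "?F t \<noteq> \<infinity>" for t using fin[of t] by (auto simp: indicator_def)
  moreover have eq: "enn2real (?F t) = decreasing_fun M f t" if "t \<in> space unit_interval" for t
    using that by (simp add: decreasing_fun_def space_restrict_space)
  have mm: "(\<lambda>t. enn2real (?F t)) \<in> borel_measurable unit_interval"
    using mem_measurable[OF m] by (subst measurable_cong[OF eq])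
  have "AE t in unit_interval. enn2real (?F t) = decreasing_fun M f t"
    by (rule AE_I2) (rule eq)
  from AE_eq_mem_norm[OF m mm this] calculation show ?thesis by (simp add: fun_norm_def)
qed

end

text \<open>The right-hand side of the equivalence.\<close>

definition rearrangement_norm where
  "rearrangement_norm X N E NE f =
    fun_norm X N (\<lambda>t. rearrangement half_line (disjoint_sum f) t * indicator {0<..<1} t)
      + seq_norm E NE (\<lambda>k. rearrangement half_line (disjoint_sum f) (real (Suc k)))"

locale independent_sample =
  fixes f :: "nat \<Rightarrow> real \<Rightarrow> real"
  assumes independent: "unit.indep_vars (\<lambda>_. borel) f UNIV"
begin

text \<open>
  The distribution function of the disjoint sum and, below, its decreasing rearrangement.
\<close>

definition tail :: "real \<Rightarrow> ennreal" where
  "tail = distribution_fn half_line (disjoint_sum f)"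

definition rearr :: "real \<Rightarrow> real" where
  "rearr = decreasing_fun half_line (disjoint_sum f)"

lemma sample_measurable: "f k \<in> borel_measurable unit_interval"
  using independent by (auto simp: unit.indep_vars_def)

lemma tail_eq: "tail s = (\<Sum>k. distribution_fn unit_interval (f k) s)"
  unfolding tail_def by (rule distribution_fn_disjoint_sum[OF sample_measurable])

lemma rearr_nonneg: "0 \<le> rearr t" by (simp add: rearr_def decreasing_fun_nonneg)

text \<open>
  The probability of no exceedance is at most \<open>exp (- D / 2)\<close> with \<open>D = min 1
  (tail s)\<close>, hence at most \<open>1 - D / 4\<close>.
\<close>

lemma prob_exceedance_ge:
  assumes s: "0 \<le> s"
  shows "min 1 (tail s) \<le> 4 * emeasure unit_interval (space unit_interval - few_exceedances unit_interval f s 0)"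
proof -
  obtain D where D: "min 1 (tail s) = ennreal D" "0 \<le> D" "D \<le> 1"
  proof (cases "tail s")
    case (real r)
    then show ?thesis by (intro that[of "min 1 r"]) (auto simp: min_def)
  next
    case top
    then show ?thesis by (intro that[of 1]) auto
  qed
  have "ennreal D \<le> tail s" using D(1)[symmetric] by simp
  then have "unit.prob (few_exceedances unit_interval f s 0) \<le> exp (real 0 - D / 2)"
    unfolding tail_eq by (rule unit.few_exceedances_le[OF independent])
  also have "\<dots> \<le> 1 - D / 4" using exp_minus_le_one_minus_half[of "D / 2"] D by simp
  finally have "D / 4 \<le> unit.prob (space unit_interval - few_exceedances unit_interval f s 0)"
    by (subst unit.prob_compl) (auto intro: few_exceedances_measurable sample_measurable)
  then have "ennreal D \<le> ennreal (4 * unit.prob (space unit_interval - few_exceedances unit_interval f s 0))"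
    by (intro ennreal_leI) simp
  then show ?thesis unfolding D(1) by (simp add: ennreal_mult unit.emeasure_eq_measure)
qed

text \<open>
  The exceptional events of the lower estimate. Halving the level makes the expected number of
  exceedances at least \<open>2 ^ (j + 3)\<close> also if \<open>tail\<close> jumps at the level
  itself; this requires the level to be positive.
\<close>

definition sparse :: "nat \<Rightarrow> real set" where
  "sparse j = (if 0 < rearr (2 ^ (j + 3))
     then few_exceedances unit_interval f (rearr (2 ^ (j + 3)) / 2) (2 ^ (j + 1)) else {})"

lemma sparse_measurable: "sparse j \<in> sets unit_interval"
  by (simp add: sparse_def few_exceedances_measurable sample_measurable)

text \<open>
  The \<open>j\<close>-th event has probability at most \<open>exp (- 2 ^ (j + 1)) \<le> 2 ^ (- j
  - 2)\<close>.
\<close>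

lemma prob_sparse_le:
  assumes fin: "\<And>t. 0 < t \<Longrightarrow> rearrangement half_line (disjoint_sum f) t < \<infinity>"
  shows "unit.prob (\<Union>j. sparse j) \<le> 1 / 2"
proof -
  have one: "unit.prob (sparse j) \<le> (1 / 2) ^ (j + 2)" for j
  proof (cases "0 < rearr (2 ^ (j + 3))")
    case True
    let ?s = "rearr (2 ^ (j + 3)) / 2"
    have "ennreal ?s < rearrangement half_line (disjoint_sum f) (2 ^ (j + 3))"
      using less_decreasing_fun_iff[OF fin, of "2 ^ (j + 3)" ?s] True by (simp add: rearr_def)
    then have "ennreal (2 ^ (j + 3)) \<le> tail ?s"
      unfolding tail_def using True by (intro distribution_fn_ge_of_less_rearrangement) auto
    then have "unit.prob (few_exceedances unit_interval f ?s (2 ^ (j + 1))) \<le> exp (real (2 ^ (j + 1)) - 2 ^ (j + 3) / 2)"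
      unfolding tail_eq by (rule unit.few_exceedances_le[OF independent])
    then have "unit.prob (sparse j) \<le> exp (- (2 ^ (j + 1)))"
      using True by (simp add: sparse_def power_add)
    also have "\<dots> \<le> exp (- real (j + 2))"
    proof -
      have "j + 1 < 2 ^ (j + 1)" by (rule less_exp)
      then have "real (j + 2) \<le> real (2 ^ (j + 1))" by linarith
      then show ?thesis by simp
    qed
    also have "\<dots> = exp (-1) ^ (j + 2)" by (simp only: exp_of_nat_mult[symmetric]) simp
    also have "\<dots> \<le> (1 / 2) ^ (j + 2)"
      using exp_ge_add_one_self[of 1] by (intro power_mono) (auto simp: exp_minus field_simps)
    finally show ?thesis .
  qed (simp add: sparse_def)
  have sums: "(\<lambda>j. (1 / 2 :: real) ^ (j + 2)) sums (1 / 2)"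
    using sums_mult[OF geometric_sums[of "1 / 2 :: real"], of "1 / 4"] by (simp add: power_add mult.commute power2_eq_square)
  have sm: "summable (\<lambda>j. unit.prob (sparse j))"
    by (rule summable_comparison_test'[OF sums_summable[OF sums], of 0]) (use one in simp)
  have "unit.prob (\<Union>j. sparse j) \<le> (\<Sum>j. unit.prob (sparse j))"
    by (rule unit.finite_measure_subadditive_countably[OF _ sm]) (auto intro: sparse_measurable)
  also have "\<dots> \<le> (\<Sum>j. (1 / 2) ^ (j + 2))"
    by (intro suminf_le one sm sums_summable[OF sums])
  finally show ?thesis using sums by (simp add: sums_iff)
qed

end

lemma pointwise_seq_norm_AE:
  assumes "fun_norm X N (pointwise_seq_norm E NE f) \<noteq> \<infinity>"
  shows "(\<lambda>t. enn2real (pointwise_seq_norm E NE f t)) \<in> X"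
    and "fun_norm X N (pointwise_seq_norm E NE f) = ennreal (N (\<lambda>t. enn2real (pointwise_seq_norm E NE f t)))"
    and "AE t in unit_interval. (\<lambda>k. f k t) \<in> E \<and> enn2real (pointwise_seq_norm E NE f t) = enn2real (ennreal (NE (\<lambda>k. f k t)))"
proof -
  have *: "(AE t in unit_interval. pointwise_seq_norm E NE f t \<noteq> \<infinity>) \<and> (\<lambda>t. enn2real (pointwise_seq_norm E NE f t)) \<in> X"
    using assms unfolding fun_norm_def by presburger
  then show "(\<lambda>t. enn2real (pointwise_seq_norm E NE f t)) \<in> X"
    "fun_norm X N (pointwise_seq_norm E NE f) = ennreal (N (\<lambda>t. enn2real (pointwise_seq_norm E NE f t)))"
    by (auto simp: fun_norm_def)
  from * have "AE t in unit_interval. pointwise_seq_norm E NE f t \<noteq> \<infinity>" by blast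
  then show "AE t in unit_interval. (\<lambda>k. f k t) \<in> E \<and> enn2real (pointwise_seq_norm E NE f t) = enn2real (ennreal (NE (\<lambda>k. f k t)))"
    by eventually_elim (auto simp: pointwise_seq_norm_def split: if_splits)
qed

text \<open>
  The maximum of the \<open>\<bar>f k\<bar>\<close> controls \<open>\<mu>\<close> on
  \<open>(0,1)\<close>. Outside the exceptional events, hence with probability at least one half,
  the sample norm \<open>L t\<close> has a lower bound in terms of the sequence, which
  \<open>constant_bound\<close> compares with the norm of \<open>L\<close>.
\<close>

lemma johnson_schechtman_lower:
  assumes X: "symmetric_fun_space X N" and E: "symmetric_seq_space E NE"
  obtains C where "0 < C" "\<And>f. unit.indep_vars (\<lambda>_. borel) f UNIV \<Longrightarrow>
    rearrangement_norm X N E NE f \<le> ennreal C * fun_norm X N (pointwise_seq_norm E NE f)"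
proof -
  interpret X: symmetric_fun_space X N by (rule X)
  interpret E: symmetric_seq_space E NE by (rule E)
  obtain c where c: "1 \<le> c" "\<And>f g. f \<in> E \<Longrightarrow> g \<in> E \<Longrightarrow> NE (\<lambda>x. f x + g x) \<le> c * (NE f + NE g)"
    using E.quasi_triangle_constant by blast
  obtain D where D: "0 < D" "X.dilation_bound 4 D"
    using X.dilation by blast
  obtain K where K: "0 \<le> K" "\<And>L v. L \<in> X \<Longrightarrow> 0 \<le> v \<Longrightarrow>
    1 / 2 \<le> emeasure unit_interval {t \<in> space unit_interval. v \<le> \<bar>L t\<bar>} \<Longrightarrow> v \<le> K * N L"
    using X.constant_bound by blast
  define c1 where "c1 = (2 * c) ^ 3 * c"
  have c1: "0 < c1" using c(1) by (simp add: c1_def)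
  define C where "C = D + c1 * (2 * K + K * D)"
  have C0: "0 < C" using D(1) K(1) c1 by (simp add: C_def add_pos_nonneg)
  show ?thesis
  proof (rule that[OF C0])
    fix f :: "nat \<Rightarrow> real \<Rightarrow> real" assume ind: "unit.indep_vars (\<lambda>_. borel) f UNIV"
    interpret independent_sample f by unfold_locales (rule ind)
    let ?\<mu> = "rearrangement half_line (disjoint_sum f)"
    let ?lhs = "fun_norm X N (pointwise_seq_norm E NE f)"
    let ?rhs = "fun_norm X N (\<lambda>t. ?\<mu> t * indicator {0<..<1} t) + seq_norm E NE (\<lambda>k. ?\<mu> (real (Suc k)))"
    have "?rhs \<le> ennreal C * ?lhs"
    proof (cases "?lhs = \<infinity>")
      case True
      then show ?thesis using C0 by (simp add: ennreal_mult_top)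
    next
      case False
      define L where "L t = enn2real (pointwise_seq_norm E NE f t)" for t
      have LX: "L \<in> X" and lhs: "?lhs = ennreal (N L)"
        and AE1: "AE t in unit_interval. (\<lambda>k. f k t) \<in> E \<and> L t = enn2real (ennreal (NE (\<lambda>k. f k t)))"
        unfolding L_def using pointwise_seq_norm_AE[OF False] by blast+
      have AE: "AE t in unit_interval. (\<lambda>k. f k t) \<in> E \<and> L t = NE (\<lambda>k. f k t)"
        using AE1 by eventually_elim (auto simp: E.nonneg)
      note Lm[measurable] = X.mem_measurable[OF LX]
      have tail_le: "min 1 (tail s) \<le> 4 * distribution_fn unit_interval L s" if s: "0 \<le> s" for s
      proof -
        have "emeasure unit_interval (space unit_interval - few_exceedances unit_interval f s 0) \<le> distribution_fn unit_interval L s"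
          unfolding distribution_fn_def
        proof (rule emeasure_mono_AE)
          show "AE t in unit_interval. t \<in> space unit_interval - few_exceedances unit_interval f s 0 \<longrightarrow>
              t \<in> {x \<in> space unit_interval. s < \<bar>L x\<bar>}"
            using AE
          proof eventually_elim
            case (elim t)
            show ?case
            proof
              assume t: "t \<in> space unit_interval - few_exceedances unit_interval f s 0"
              have "superlevel (\<lambda>k. f k t) s \<noteq> {}"
              proof
                assume "superlevel (\<lambda>k. f k t) s = {}"
                then show False using t by (auto simp: few_exceedances_def)
              qed
              then obtain k where "s < \<bar>f k t\<bar>" by blast
              also have "\<dots> \<le> L t" using E.coordinate_le[of "\<lambda>k. f k t" k] elim by simp
              finally show "t \<in> {x \<in> space unit_interval. s < \<bar>L x\<bar>}" using t by auto
            qed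
          qed
        qed measurable
        then show ?thesis by (intro order_trans[OF prob_exceedance_ge[OF s]] mult_left_mono) auto
      qed
      have fin: "?\<mu> t < \<infinity>" if t: "0 < t" for t
      proof -
        obtain l where l: "0 \<le> l" "distribution_fn unit_interval L l < ennreal (min 1 t / 4)"
          using distribution_fn_unit_vanishes[OF Lm, of "min 1 t / 4"] t by auto
        have "min 1 (tail l) \<le> 4 * distribution_fn unit_interval L l" by (rule tail_le[OF l(1)])
        also have "\<dots> < 4 * ennreal (min 1 t / 4)"
          using l(2) by (intro ennreal_mult_strict_left_mono) auto
        also have "\<dots> = ennreal (min 1 t)" using t by (subst ennreal_mult'[symmetric, of 4, simplified]) auto
        finally have "min 1 (tail l) < ennreal (min 1 t)" .
        moreover have "ennreal (min 1 t) \<le> 1" "ennreal (min 1 t) \<le> ennreal t"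
          using ennreal_leI[of "min 1 t" 1] by (auto intro: ennreal_leI)
        ultimately have "tail l < ennreal t"
          by (cases "1 \<le> tail l") (auto simp: min_absorb1 min_absorb2 dest: less_le_trans)
        then show ?thesis unfolding tail_def by (rule rearrangement_finiteI[OF l(1)])
      qed
      note Fm = disjoint_sum_measurable[of f, OF sample_measurable]
      have mm: "rearr \<in> borel_measurable unit_interval"
        unfolding rearr_def by (rule decreasing_fun_measurable[OF Fm fin])
      have mX: "rearr \<in> X \<and> N rearr \<le> D * N L"
      proof (rule X.dilation_boundD[OF D(2) LX mm])
        fix s :: real assume "0 \<le> s"
        then show "distribution_fn unit_interval rearr s \<le> ennreal 4 * distribution_fn unit_interval L s"
          using tail_le by (simp add: rearr_def distribution_fn_decreasing_fun[OF Fm fin] tail_def)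
      qed
      have first: "fun_norm X N (\<lambda>t. ?\<mu> t * indicator {0<..<1} t) = ennreal (N rearr)"
        unfolding rearr_def by (rule X.fun_norm_rearrangement[OF fin]) (use mX in \<open>auto simp: rearr_def\<close>)
      have anti: "rearr t' \<le> rearr t" if "0 < t" "t \<le> t'" for t t'
        unfolding rearr_def by (rule decreasing_fun_antimono[OF fin[OF that(1)] that(2)])
      have m1: "rearr 1 \<le> K * N rearr"
      proof (rule K(2))
        have "{t \<in> space unit_interval. rearr 1 \<le> \<bar>rearr t\<bar>} = space unit_interval"
          using anti rearr_nonneg by (auto simp: space_restrict_space abs_of_nonneg)
        then show "1 / 2 \<le> emeasure unit_interval {t \<in> space unit_interval. rearr 1 \<le> \<bar>rearr t\<bar>}"
          using ennreal_leI[of "1 / 2" 1] by (simp only: unit.emeasure_space_1 ennreal_one_half) simp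
      qed (use mX rearr_nonneg in auto)
      define e where "e n = rearr (real (Suc n))" for n
      define G where "G = space unit_interval - (\<Union>j. sparse j)"
      have Gm: "G \<in> sets unit_interval" unfolding G_def by (intro sets.Diff sets.countable_UN) (auto intro: sparse_measurable)
      have "1 / 2 \<le> unit.prob G"
        unfolding G_def using prob_sparse_le[OF fin]
        by (subst unit.prob_compl) (auto intro!: sets.countable_UN sparse_measurable)
      then have halfG: "1 / 2 \<le> emeasure unit_interval G"
        unfolding unit.emeasure_eq_measure ennreal_one_half by (rule ennreal_leI)
      have sample: "e \<in> E \<and> NE e \<le> c1 * (2 * L t + rearr 1)"
        if t: "t \<in> G" "(\<lambda>k. f k t) \<in> E \<and> L t = NE (\<lambda>k. f k t)" for t
      proof -
        have "e \<in> E \<and> NE e \<le> (2 * c) ^ 3 * (c * (2 * NE (\<lambda>k. f k t) + rearr 1))"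
          unfolding e_def[abs_def]
        proof (rule E.rearrangement_le_sample[OF c(2,1)])
          show "(\<lambda>k. f k t) \<in> E" using t by blast
          fix k :: nat assume k: "1 \<le> k" "0 < rearr (2 ^ (k + 2))"
          then obtain j where j: "k = Suc j" by (cases k) auto
          have "t \<notin> sparse j" using t by (auto simp: G_def)
          then show "\<not> (finite (superlevel (\<lambda>k. f k t) (rearr (2 ^ (k + 2)) / 2)) \<and>
              card (superlevel (\<lambda>k. f k t) (rearr (2 ^ (k + 2)) / 2)) \<le> 2 ^ k)"
            using k t by (simp add: sparse_def few_exceedances_def j numeral_3_eq_3 G_def)
        qed (auto intro: rearr_nonneg anti)
        then show ?thesis using t by (simp add: c1_def mult.assoc)
      qed
      have "\<exists>t. t \<in> G \<and> (\<lambda>k. f k t) \<in> E \<and> L t = NE (\<lambda>k. f k t)"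
      proof (rule ccontr)
        assume "\<not> ?thesis"
        then have "AE t in unit_interval. t \<notin> G" using AE by (auto elim: eventually_mono)
        then have "emeasure unit_interval G \<le> emeasure unit_interval {}"
          by (intro emeasure_mono_AE) auto
        then show False using halfG by (simp add: ennreal_one_half)
      qed
      then have eE: "e \<in> E" using sample by blast
      \<comment> \<open>The lower bound for \<open>L\<close> that every point of \<open>G\<close> provides; it may be negative.\<close>
      define v where "v = (NE e / c1 - rearr 1) / 2"
      have "v \<le> K * N L"
      proof (cases "0 \<le> v")
        case True
        have "emeasure unit_interval G \<le> emeasure unit_interval {t \<in> space unit_interval. v \<le> \<bar>L t\<bar>}"
        proof (rule emeasure_mono_AE)
          show "AE t in unit_interval. t \<in> G \<longrightarrow> t \<in> {t \<in> space unit_interval. v \<le> \<bar>L t\<bar>}"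
            using AE
          proof eventually_elim
            case (elim t)
            show ?case
            proof
              assume "t \<in> G"
              then have "NE e \<le> c1 * (2 * L t + rearr 1)" using sample elim by blast
              then have "v \<le> L t" using c1 by (simp add: v_def field_simps)
              then show "t \<in> {t \<in> space unit_interval. v \<le> \<bar>L t\<bar>}" using \<open>t \<in> G\<close> by (auto simp: G_def)
            qed
          qed
        qed measurable
        with halfG True show ?thesis by (intro K(2)[OF LX]) auto
      next
        case False
        moreover have "0 \<le> K * N L" using K(1) X.nonneg[OF LX] by simp
        ultimately show ?thesis by linarith
      qed
      then have "NE e \<le> c1 * (2 * (K * N L) + rearr 1)" using c1 by (simp add: v_def field_simps)
      also have "\<dots> \<le> c1 * (2 * (K * N L) + K * (D * N L))"
        using c1 m1 mX K(1) by (intro mult_left_mono add_left_mono order_trans[OF m1]) auto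
      finally have NEe: "NE e \<le> c1 * (2 * K + K * D) * N L" by (simp add: algebra_simps)
      have "seq_norm E NE (\<lambda>k. ?\<mu> (real (Suc k))) = ennreal (NE e)"
        using fin[of "real (Suc _)"] eE
        by (auto simp: seq_norm_def e_def[abs_def] rearr_def decreasing_fun_def[abs_def] less_top simp del: of_nat_Suc)
      then have "?rhs = ennreal (N rearr + NE e)"
        using first mX eE by (simp add: X.nonneg E.nonneg)
      also have "\<dots> \<le> ennreal (C * N L)"
        using mX NEe by (intro ennreal_leI) (simp add: C_def algebra_simps)
      also have "\<dots> = ennreal C * ?lhs" unfolding lhs using C0 X.nonneg[OF LX] by (simp add: ennreal_mult)
      finally show ?thesis .
    qed
    then show "rearrangement_norm X N E NE f \<le> ennreal C * ?lhs" by (simp only: rearrangement_norm_def)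
  qed
qed

section \<open>The upper estimate\<close>

context symmetric_fun_space begin

text \<open>A space with a nonzero element contains the constants.\<close>

lemma constant_mem:
  assumes f: "f \<in> X" and nz: "\<not> (AE t in unit_interval. f t = 0)"
  shows "(\<lambda>_. 1) \<in> X"
proof -
  note [measurable] = mem_measurable[OF f]
  have "\<exists>\<delta>>0. 0 < distribution_fn unit_interval f \<delta>"
  proof (rule ccontr)
    assume "\<not> ?thesis"
    then have "distribution_fn unit_interval f l \<le> 0" if "0 < l" for l using that not_le by blast
    then have "distribution_fn unit_interval f 0 \<le> 0"
      by (rule distribution_fn_right_continuous[OF mem_measurable[OF f]])
    then have 0: "emeasure unit_interval {t \<in> space unit_interval. 0 < \<bar>f t\<bar>} = 0"
      by (simp only: distribution_fn_def le_zero_eq)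
    have "AE t in unit_interval. f t = 0"
      by (rule AE_I[OF _ 0]) (force, measurable)
    then show False using nz by simp
  qed
  then obtain \<delta> where \<delta>: "0 < \<delta>" "0 < distribution_fn unit_interval f \<delta>" by blast
  define r where "r = unit.prob {t \<in> space unit_interval. \<bar>f t\<bar> > \<delta>}"
  have r: "distribution_fn unit_interval f \<delta> = ennreal r" "0 < r"
    using \<delta>(2) by (auto simp: distribution_fn_def r_def unit.emeasure_eq_measure simp del: space_lebesgue_on)
  obtain D where D: "dilation_bound (1 / r) D"
    using dilation by blast
  have "(\<lambda>_. \<delta>) \<in> X \<and> N (\<lambda>_. \<delta>) \<le> D * N f"
  proof (rule dilation_boundD[OF D f])
    fix s :: real assume s: "0 \<le> s"
    show "distribution_fn unit_interval (\<lambda>_. \<delta>) s \<le> ennreal (1 / r) * distribution_fn unit_interval f s"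
    proof (cases "s < \<delta>")
      case True
      have "(1::ennreal) = ennreal (1 / r) * ennreal r" using r(2) by (subst ennreal_mult[symmetric]) auto
      also have "\<dots> \<le> ennreal (1 / r) * distribution_fn unit_interval f s"
        unfolding r(1)[symmetric] using True by (intro mult_left_mono distribution_fn_antimono mem_measurable f) auto
      finally show ?thesis by (rule order_trans[OF distribution_fn_le_1])
    next
      case False
      then show ?thesis using \<delta>(1) by (simp add: distribution_fn_def)
    qed
  qed simp
  then show ?thesis using scale_mem[of "\<lambda>_. \<delta>" "1 / \<delta>"] \<delta>(1) by simp
qed

text \<open>
  A variable with tails at most \<open>2 / (2^j)!\<close> at \<open>R ^ j\<close> is dominated in
  distribution by \<open>R\<^sup>2 W\<close>, where \<open>W\<close> has tails at least \<open>1 /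
  (e (2^j)!)\<close> there; the factor \<open>R\<^sup>2\<close> bridges the gap between
  consecutive powers. It is applied to a power \<open>W\<close> of a Poisson variable.
\<close>

lemma geometric_majorant:
  fixes W :: "real \<Rightarrow> real" and R :: real
  assumes W: "W \<in> X" and R: "1 < R"
    and W_tail: "\<And>j. ennreal (1 / (exp 1 * fact (2 ^ j))) \<le> emeasure unit_interval {t \<in> space unit_interval. R ^ j \<le> W t}"
  obtains D where "0 \<le> D" "\<And>J. J \<in> unit_interval \<rightarrow>\<^sub>M count_space UNIV \<Longrightarrow>
      (\<And>j. emeasure unit_interval {t \<in> space unit_interval. j < J t} \<le> ennreal (2 / fact (2 ^ j))) \<Longrightarrow>
      (\<lambda>t. R ^ J t) \<in> X \<and> N (\<lambda>t. R ^ J t) \<le> D"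
proof -
  obtain D where D: "0 < D" "dilation_bound (2 * exp 1) D"
    using dilation by blast
  let ?W = "\<lambda>t. R ^ 2 * W t"
  have WX: "?W \<in> X" using scale_mem W by blast
  note [measurable] = mem_measurable[OF W]
  have lower: "ennreal (2 / fact (2 ^ j)) \<le> ennreal (2 * exp 1) * distribution_fn unit_interval ?W s"
    if s: "s < R ^ (j + 2)" for j s
  proof -
    have "ennreal (2 / fact (2 ^ j)) = ennreal (2 * exp 1) * ennreal (1 / (exp 1 * fact (2 ^ j)))"
      by (subst ennreal_mult[symmetric]) auto
    also have "\<dots> \<le> ennreal (2 * exp 1) * emeasure unit_interval {t \<in> space unit_interval. R ^ j \<le> W t}"
      by (intro mult_left_mono W_tail) auto
    also have "\<dots> \<le> ennreal (2 * exp 1) * distribution_fn unit_interval ?W s"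
      unfolding distribution_fn_def
    proof (rule mult_left_mono[OF emeasure_mono])
      show "{t \<in> space unit_interval. R ^ j \<le> W t} \<subseteq> {x \<in> space unit_interval. s < \<bar>R ^ 2 * W x\<bar>}"
      proof
        fix t assume t: "t \<in> {t \<in> space unit_interval. R ^ j \<le> W t}"
        then have "R ^ 2 * R ^ j \<le> R ^ 2 * W t" using R by (intro mult_left_mono) auto
        moreover have "s < R ^ 2 * R ^ j" using s by (simp only: power_add mult.commute)
        ultimately have "s < R ^ 2 * W t" by linarith
        also have "\<dots> \<le> \<bar>R ^ 2 * W t\<bar>" by simp
        finally show "t \<in> {x \<in> space unit_interval. s < \<bar>R ^ 2 * W x\<bar>}" using t by simp
      qed
      show "{x \<in> space unit_interval. s < \<bar>R ^ 2 * W x\<bar>} \<in> sets unit_interval" by measurable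
    qed simp
    finally show ?thesis .
  qed
  show ?thesis
  proof (rule that[of "D * N ?W"])
    show "0 \<le> D * N ?W" using D(1) nonneg[OF WX] by simp
    fix J assume J[measurable]: "J \<in> unit_interval \<rightarrow>\<^sub>M count_space UNIV"
      and J_tail: "\<And>j. emeasure unit_interval {t \<in> space unit_interval. j < J t} \<le> ennreal (2 / fact (2 ^ j))"
    show "(\<lambda>t. R ^ J t) \<in> X \<and> N (\<lambda>t. R ^ J t) \<le> D * N ?W"
    proof (rule dilation_boundD[OF D(2) WX])
      show "(\<lambda>t. R ^ J t) \<in> borel_measurable unit_interval" by measurable
      fix s :: real assume s: "0 \<le> s"
      show "distribution_fn unit_interval (\<lambda>t. R ^ J t) s \<le> ennreal (2 * exp 1) * distribution_fn unit_interval ?W s"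
      proof (cases "s < 1")
        case True
        have "1 \<le> R ^ (0 + 2)" using R by (intro one_le_power) simp
        then have "ennreal (2 / fact (2 ^ 0)) \<le> ennreal (2 * exp 1) * distribution_fn unit_interval ?W s"
          using True by (intro lower) linarith
        moreover have "1 \<le> ennreal (2 / fact (2 ^ 0))" using ennreal_leI[of 1 2] by simp
        ultimately have "1 \<le> ennreal (2 * exp 1) * distribution_fn unit_interval ?W s" by (rule order_trans[rotated])
        then show ?thesis by (rule order_trans[OF distribution_fn_le_1])
      next
        case False
        define j where "j = (LEAST j. s < R ^ Suc j)"
        obtain n where n: "s < R ^ n" using real_arch_pow[OF R] by blast
        also have "R ^ n \<le> R ^ Suc n" using R by (intro power_increasing) auto
        finally have "s < R ^ Suc n" .
        then have j1: "s < R ^ Suc j" unfolding j_def by (rule LeastI)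
        have j2: "R ^ j \<le> s"
        proof (cases j)
          case 0 then show ?thesis using False by simp
        next
          case (Suc i)
          then have "\<not> s < R ^ Suc i" using not_less_Least[of i "\<lambda>j. s < R ^ Suc j"] by (simp add: j_def)
          then show ?thesis using Suc by simp
        qed
        have "distribution_fn unit_interval (\<lambda>t. R ^ J t) s \<le> emeasure unit_interval {t \<in> space unit_interval. j < J t}"
          unfolding distribution_fn_def
        proof (rule emeasure_mono)
          show "{x \<in> space unit_interval. s < \<bar>R ^ J x\<bar>} \<subseteq> {t \<in> space unit_interval. j < J t}"
          proof
            fix t assume t: "t \<in> {x \<in> space unit_interval. s < \<bar>R ^ J x\<bar>}"
            have "\<not> J t \<le> j"
            proof
              assume "J t \<le> j"
              then have le: "R ^ J t \<le> R ^ j" using R by (intro power_increasing) auto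
              have "\<bar>R ^ J t\<bar> = R ^ J t" using R by (intro abs_of_nonneg zero_le_power) simp
              moreover have "s < \<bar>R ^ J t\<bar>" using t by blast
              ultimately show False using le j2 by linarith
            qed
            then show "t \<in> {t \<in> space unit_interval. j < J t}" using t by simp
          qed
        qed measurable
        also have "\<dots> \<le> ennreal (2 / fact (2 ^ j))" by (rule J_tail)
        also have "\<dots> \<le> ennreal (2 * exp 1) * distribution_fn unit_interval ?W s"
        proof (rule lower)
          have "R ^ Suc j \<le> R ^ (j + 2)" using R by (intro power_increasing) auto
          then show "s < R ^ (j + 2)" using j1 by linarith
        qed
        finally show ?thesis .
      qed
    qed
  qed
qed

end

lemma emeasure_coordinate:
  assumes T: "measure_preserving_bijection unit_interval product_space T" and B[measurable]: "B \<in> sets unit_interval"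
  shows "emeasure unit_interval {t \<in> space unit_interval. T t k \<in> B} = emeasure unit_interval B"
proof -
  have m: "indicator B \<in> borel_measurable unit_interval" by (rule borel_measurable_indicator[OF B])
  have [measurable]: "(\<lambda>t. T t k) \<in> unit_interval \<rightarrow>\<^sub>M unit_interval"
    by (rule measure_preserving_measurable[OF T coordinate_measurable])
  have "emeasure unit_interval {t \<in> space unit_interval. T t k \<in> B} =
      (\<integral>\<^sup>+t. indicator {t \<in> space unit_interval. T t k \<in> B} t \<partial>unit_interval)"
    by (rule nn_integral_indicator[symmetric]) measurable
  also have "\<dots> = (\<integral>\<^sup>+t. indicator B (T t k) \<partial>unit_interval)"
    by (intro nn_integral_cong) (auto simp: indicator_def)
  also have "\<dots> = (\<integral>\<^sup>+x. indicator B x \<partial>unit_interval)"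
    by (simp only: nn_integral_measure_preserving[OF T measurable_compose[OF coordinate_measurable m]]
        nn_integral_coordinate[OF m])
  finally show ?thesis using B by simp
qed

lemma fact_two_power_le_exp: "fact (2 ^ j) \<le> exp ((real j + 1) * 4 ^ (j + 1))"
proof -
  have "fact (2 ^ j) \<le> (real (2 ^ j)) ^ (2 ^ j)" 
    using fact_le_power[of "2 ^ j", where 'a = real] by simp
  also have "\<dots> = 2 ^ (j * 2 ^ j)" by (simp add: power_mult)
  also have "\<dots> \<le> exp 1 ^ (j * 2 ^ j)"
    using exp_ge_add_one_self[of 1] by (intro power_mono) auto
  also have "\<dots> = exp (real j * 2 ^ j)" by (simp add: exp_of_nat_mult[symmetric])
  also have "\<dots> \<le> exp ((real j + 1) * 4 ^ (j + 1))"
  proof -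
    have "(2::real) ^ j \<le> 4 ^ j" by (rule power_mono) auto
    also have "\<dots> \<le> 4 ^ (j + 1)" by simp
    finally show ?thesis by (simp only: exp_le_cancel_iff) (intro mult_mono, auto)
  qed
  finally show ?thesis .
qed

context independent_sample begin

text \<open>
  The sample points at which no dyadic count exceeds \<open>2 ^ i\<close>, the bound for its
  expectation, by more than the factor \<open>2 ^ (2 j + 4)\<close>. The doubled exponent \<open>2
  j\<close> makes the Chernoff bound beat \<open>1 / (2^j)!\<close> for all \<open>j \<ge>
  0\<close> at once.
\<close>

definition controlled :: "nat \<Rightarrow> real set" where
  "controlled j = (\<Inter>i. few_exceedances unit_interval f (rearr (2 ^ i)) (2 ^ (i + (2 * j + 4))))"

definition level :: "real \<Rightarrow> nat" where
  "level t = (LEAST j. t \<in> controlled j)"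

lemma controlled_measurable: "controlled j \<in> sets unit_interval"
  unfolding controlled_def by (intro sets.countable_INT) (auto intro: few_exceedances_measurable sample_measurable)

lemma level_measurable: "level \<in> unit_interval \<rightarrow>\<^sub>M count_space UNIV"
proof -
  note [measurable] = controlled_measurable
  show ?thesis unfolding level_def[abs_def] by measurable
qed

context
  assumes fin: "\<And>t. 0 < t \<Longrightarrow> rearrangement half_line (disjoint_sum f) t < \<infinity>"
begin

lemma tail_rearr_le: "0 < t \<Longrightarrow> tail (rearr t) \<le> ennreal t"
  unfolding tail_def
  by (rule distribution_fn_le_of_rearrangement_le[OF disjoint_sum_measurable[OF sample_measurable] rearr_nonneg])
    (use fin[of t] in \<open>simp add: rearr_def decreasing_fun_def less_top\<close>)

lemma rearr_antimono: "0 < t \<Longrightarrow> t \<le> t' \<Longrightarrow> rearr t' \<le> rearr t"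
  unfolding rearr_def by (rule decreasing_fun_antimono[OF fin])

text \<open>
  The Chernoff bound with \<open>\<theta> = j + 1\<close>: since \<open>e < 4\<close>, the
  \<open>i\<close>-th exponent is at most \<open>- a * 2 ^ i \<le> - a * (1 + i)\<close> with
  \<open>a = (j + 1) * 4 ^ (j + 1)\<close>, so the sum over \<open>i\<close> is geometric.
\<close>

lemma prob_not_controlled_le: "unit.prob (space unit_interval - controlled j) \<le> 2 / fact (2 ^ j)"
proof -
  define a where "a = (real j + 1) * 4 ^ (j + 1)"
  have a1: "1 \<le> a"
    unfolding a_def using mult_mono[of 1 "real j + 1" 1 "4 ^ (j + 1)"] one_le_power[of "4::real" "j + 1"] by simp
  let ?B = "\<lambda>i. space unit_interval - few_exceedances unit_interval f (rearr (2 ^ i)) (2 ^ (i + (2 * j + 4)))"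
  have one: "unit.prob (?B i) \<le> exp (- a) * (1 / 2) ^ i" for i
  proof -
    have "unit.prob (?B i) \<le> exp ((exp (real (j + 1)) - 1) * 2 ^ i - real (j + 1) * real (2 ^ (i + (2 * j + 4))))"
      using tail_rearr_le[of "2 ^ i"]
      by (intro unit.many_exceedances_le[OF independent]) (auto simp: tail_eq)
    also have "\<dots> \<le> exp (- a * (1 + real i))"
    proof -
      have "exp (real (j + 1)) = exp 1 ^ (j + 1)" by (simp only: exp_of_nat_mult[symmetric]) simp
      also have "\<dots> \<le> 4 ^ (j + 1)" using exp_le by (intro power_mono) auto
      finally have "(exp (real (j + 1)) - 1) * 2 ^ i \<le> 4 ^ (j + 1) * 2 ^ i" by (intro mult_right_mono) auto
      also have "\<dots> \<le> a * 2 ^ i" unfolding a_def by (intro mult_right_mono) (auto simp: mult_le_cancel_right1)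
      finally have 1: "(exp (real (j + 1)) - 1) * 2 ^ i \<le> a * 2 ^ i" .
      have "(2::real) ^ (i + (2 * j + 4)) = 4 * 4 ^ (j + 1) * 2 ^ i"
        by (simp add: power_add power_mult)
      then have 2: "real (j + 1) * real (2 ^ (i + (2 * j + 4))) = 4 * a * 2 ^ i"
        by (simp add: a_def)
      have "i < 2 ^ i" by (rule less_exp)
      then have "1 + real i \<le> 2 ^ i" by (metis Suc_leI numeral_power_eq_of_nat_cancel_iff of_nat_Suc of_nat_le_iff add.commute)
      then have "a * (1 + real i) \<le> a * 2 ^ i" using a1 by (intro mult_left_mono) auto
      moreover have "0 \<le> a * 2 ^ i" using a1 by simp
      ultimately have "(exp (real (j + 1)) - 1) * 2 ^ i - real (j + 1) * real (2 ^ (i + (2 * j + 4))) \<le> - a * (1 + real i)"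
        using 1 2 by linarith
      then show ?thesis by simp
    qed
    also have "\<dots> = exp (- a) * exp (- a) ^ i" by (simp add: exp_of_nat_mult[symmetric] exp_add[symmetric] algebra_simps)
    also have "\<dots> \<le> exp (- a) * (1 / 2) ^ i"
    proof (intro mult_left_mono power_mono)
      have "exp (- a) \<le> exp (- 1)" using a1 by simp
      also have "\<dots> \<le> (1 / 2 :: real)" using exp_ge_add_one_self[of 1] by (simp add: exp_minus field_simps)
      finally show "exp (- a) \<le> 1 / 2" .
    qed auto
    finally show ?thesis .
  qed
  have sums: "(\<lambda>i. exp (- a) * (1 / 2) ^ i) sums (exp (- a) * 2)"
    using sums_mult[OF geometric_sums[of "1 / 2 :: real"], of "exp (- a)"] by simp
  have sm: "summable (\<lambda>i. unit.prob (?B i))"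
    by (rule summable_comparison_test'[OF sums_summable[OF sums], of 0]) (use one in simp)
  have "space unit_interval - controlled j = (\<Union>i. ?B i)" by (auto simp: controlled_def)
  then have "unit.prob (space unit_interval - controlled j) = unit.prob (\<Union>i. ?B i)" by (simp only:)
  also have "\<dots> \<le> (\<Sum>i. unit.prob (?B i))"
    by (rule unit.finite_measure_subadditive_countably[OF _ sm])
      (auto intro!: sets.Diff few_exceedances_measurable sample_measurable simp del: space_lebesgue_on)
  also have "\<dots> \<le> (\<Sum>i. exp (- a) * (1 / 2) ^ i)"
    by (intro suminf_le one sm sums_summable[OF sums])
  also have "\<dots> = 2 / exp a" using sums by (simp add: sums_iff exp_minus field_simps)
  also have "\<dots> \<le> 2 / fact (2 ^ j)"
    using fact_two_power_le_exp[of j] by (intro divide_left_mono) (auto simp: a_def)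
  finally show ?thesis .
qed

lemma emeasure_level_gt_le:
  "emeasure unit_interval {t \<in> space unit_interval. j < level t} \<le> ennreal (2 / fact (2 ^ j))"
proof -
  have "{t \<in> space unit_interval. j < level t} \<subseteq> space unit_interval - controlled j"
    using Least_le[of "\<lambda>j. _ \<in> controlled j" j] by (force simp: level_def)
  then have "emeasure unit_interval {t \<in> space unit_interval. j < level t} \<le> emeasure unit_interval (space unit_interval - controlled j)"
    by (intro emeasure_mono sets.compl_sets controlled_measurable)
  also have "\<dots> \<le> ennreal (2 / fact (2 ^ j))"
    unfolding unit.emeasure_eq_measure by (intro ennreal_leI prob_not_controlled_le)
  finally show ?thesis .
qed

lemma AE_controlled_level: "AE t in unit_interval. t \<in> controlled (level t)"
proof -
  let ?Z = "space unit_interval - (\<Union>j. controlled j)"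
  have Zm: "?Z \<in> sets unit_interval"
    by (intro sets.compl_sets sets.countable_UN) (auto intro: controlled_measurable)
  have "unit.prob ?Z \<le> 2 / real j" if "1 \<le> j" for j
  proof -
    have "unit.prob ?Z \<le> unit.prob (space unit_interval - controlled j)"
      by (intro unit.finite_measure_mono sets.compl_sets controlled_measurable) auto
    also have "\<dots> \<le> 2 / fact (2 ^ j)" by (rule prob_not_controlled_le)
    also have "\<dots> \<le> 2 / real j"
    proof -
      have "real j \<le> real (2 ^ j)" using less_exp[of j] by linarith
      also have "\<dots> \<le> fact (2 ^ j)" using fact_ge_self[of "2 ^ j"] by (metis of_nat_fact of_nat_le_iff)
      finally show ?thesis using that by (intro divide_left_mono) auto
    qed
    finally show ?thesis .
  qed
  moreover have "(\<lambda>j. 2 / real j) \<longlonglongrightarrow> 0" by (rule lim_const_over_n)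
  ultimately have "unit.prob ?Z \<le> 0" by (intro LIMSEQ_le_const) auto
  then have "emeasure unit_interval ?Z = 0" by (simp add: unit.emeasure_eq_measure measure_le_0_iff)
  then have "AE t in unit_interval. t \<notin> ?Z" using Zm by (intro AE_not_in) (simp add: null_sets_def)
  moreover have "AE t in unit_interval. t \<in> space unit_interval" by (rule AE_space)
  ultimately show ?thesis
  proof eventually_elim
    case (elim t)
    then obtain j where "t \<in> controlled j" by blast
    then show ?case unfolding level_def by (rule LeastI)
  qed
qed

end

end

lemma less_powr_root_iff:
  fixes s h p :: real
  assumes "0 \<le> s" "0 \<le> h" "0 < p"
  shows "s < h powr (1 / p) \<longleftrightarrow> s powr p < h"
proof -
  have s: "(s powr p) powr (1 / p) = s" using assms by (simp add: powr_powr)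
  show ?thesis
  proof
    assume "s < h powr (1 / p)"
    then show "s powr p < h"
      using powr_mono2[of "1 / p" h "s powr p"] assms s by (cases "s powr p < h") auto
  next
    assume "s powr p < h"
    then show "s < h powr (1 / p)"
      using powr_less_mono2[of "1 / p" "s powr p" h] assms s by simp
  qed
qed

locale kruglov_setting =
  fixes A :: "nat \<Rightarrow> real set" and T :: "real \<Rightarrow> nat \<Rightarrow> real"
  assumes A_sets: "\<And>n. A n \<in> sets unit_interval" and A_disjoint: "disjoint_family A"
    and A_measure: "\<And>n. measure unit_interval (A n) = 1 / (exp 1 * fact n)"
    and T: "measure_preserving_bijection unit_interval product_space T"
begin

lemma emeasure_A: "emeasure unit_interval (A n) = ennreal (1 / (exp 1 * fact n))"
  by (simp add: unit.emeasure_eq_measure A_measure)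

lemma kruglov_T_measurable:
  "f \<in> borel_measurable unit_interval \<Longrightarrow> (\<lambda>t. kruglov A f (T t)) \<in> borel_measurable unit_interval"
  by (rule measure_preserving_measurable[OF T kruglov_measurable[OF A_sets A_disjoint]])

text \<open>The law of \<open>K f\<close> is compound Poisson.\<close>

lemma kruglov_tail:
  assumes f: "f \<in> borel_measurable unit_interval" and s: "0 \<le> s"
  shows "emeasure unit_interval {t \<in> space unit_interval. s < kruglov A f (T t)} =
    (\<Sum>n. ennreal (1 / (exp 1 * fact n)) * (shift_operator f ^^ n) (indicator {s<..}) 0)"
proof -
  note [measurable] = kruglov_measurable[OF A_sets A_disjoint f] kruglov_T_measurable[OF f]
  have "emeasure unit_interval {t \<in> space unit_interval. s < kruglov A f (T t)} =
      (\<integral>\<^sup>+t. indicator {t \<in> space unit_interval. s < kruglov A f (T t)} t \<partial>unit_interval)"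
    by (rule nn_integral_indicator[symmetric]) measurable
  also have "\<dots> = (\<integral>\<^sup>+t. indicator {s<..} (kruglov A f (T t)) \<partial>unit_interval)"
    by (intro nn_integral_cong) (auto simp: indicator_def)
  also have "\<dots> = (\<integral>\<^sup>+\<omega>. indicator {s<..} (kruglov A f \<omega>) \<partial>unit_product)"
    by (rule nn_integral_measure_preserving[OF T]) measurable
  also have "\<dots> = (\<Sum>n. emeasure unit_interval (A n) * (shift_operator f ^^ n) (indicator {s<..}) 0)"
    using s by (intro nn_integral_kruglov[OF A_sets A_disjoint f]) (auto simp: indicator_def)
  finally show ?thesis by (simp only: emeasure_A)
qed

end

context independent_sample begin

text \<open>
  The \<open>p\<close>-th power of the part of a value above the level \<open>\<mu>(1)\<close>.
\<close>

definition large :: "real \<Rightarrow> real \<Rightarrow> real" where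
  "large p y = (if rearr 1 < \<bar>y\<bar> then \<bar>y\<bar> powr p else 0)"

definition large_sum :: "real \<Rightarrow> real \<Rightarrow> real" where
  "large_sum p t = enn2real (\<Sum>k. ennreal (large p (f k t)))"

lemma large_nonneg: "0 \<le> large p y"
  by (simp add: large_def)

lemma large_measurable: "large p \<in> borel_measurable borel"
  unfolding large_def[abs_def] by measurable

lemma large_eq_0_iff: "large p y = 0 \<longleftrightarrow> \<not> rearr 1 < \<bar>y\<bar>"
  using rearr_nonneg[of 1] by (auto simp: large_def)

lemma large_sum_measurable: "large_sum p \<in> borel_measurable unit_interval"
proof -
  note [measurable] = measurable_compose[OF sample_measurable large_measurable]
  show ?thesis unfolding large_sum_def[abs_def] by measurable
qed

context
  assumes fin: "\<And>t. 0 < t \<Longrightarrow> rearrangement half_line (disjoint_sum f) t < \<infinity>"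
begin

lemma rearr_measurable: "rearr \<in> borel_measurable unit_interval"
  unfolding rearr_def by (rule decreasing_fun_measurable[OF disjoint_sum_measurable[OF sample_measurable] fin])

text \<open>
  Above the level \<open>\<mu>(1)\<close> the disjoint sum has a support of measure at most one
  and therefore the same law there as \<open>\<mu>\<close> on \<open>(0,1)\<close>.
\<close>

lemma jump_sum_large_le:
  assumes F[measurable]: "F \<in> borel_measurable borel"
  shows "jump_sum unit_interval (\<lambda>k t. large p (f k t)) m F x \<le> shift_operator (\<lambda>t. large p (rearr t)) F x"
proof -
  let ?I = "\<lambda>y. indicator {y. rearr 1 < \<bar>y\<bar>} y :: ennreal"
  note Dm = disjoint_sum_measurable[of f, OF sample_measurable]
  have [measurable]: "{y. rearr 1 < \<bar>y\<bar>} \<in> sets borel" by measurable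
  have "jump_sum unit_interval (\<lambda>k t. large p (f k t)) m F x =
      (\<Sum>k<m. \<integral>\<^sup>+t. F (x + \<bar>f k t\<bar> powr p) * ?I (f k t) \<partial>unit_interval)"
    unfolding jump_sum_def jump_operator_def
    by (intro sum.cong refl nn_integral_cong) (auto simp: indicator_def large_eq_0_iff, simp add: large_def)
  also have "\<dots> \<le> (\<Sum>k. \<integral>\<^sup>+t. F (x + \<bar>f k t\<bar> powr p) * ?I (f k t) \<partial>unit_interval)"
    by (rule sum_le_suminf) auto
  also have "\<dots> = (\<integral>\<^sup>+t. F (x + \<bar>disjoint_sum f t\<bar> powr p) * ?I (disjoint_sum f t) \<partial>half_line)"
    by (rule nn_integral_disjoint_sum[of f "\<lambda>y. F (x + \<bar>y\<bar> powr p) * ?I y", OF sample_measurable, symmetric]) measurable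
  also have "\<dots> = (\<integral>\<^sup>+t. F (x + \<bar>rearr t\<bar> powr p) * ?I (rearr t) \<partial>unit_interval)"
  proof (rule nn_integral_superlevel_cong[OF Dm rearr_measurable, of "rearr 1" "\<lambda>y. F (x + y powr p)"])
    have t1: "tail (rearr 1) \<le> 1" using tail_rearr_le[OF fin, of 1] by simp
    then show "distribution_fn half_line (disjoint_sum f) (rearr 1) < \<infinity>"
      by (simp add: tail_def[symmetric] le_less_trans)
    fix s assume s: "rearr 1 \<le> s"
    have "tail s \<le> tail (rearr 1)" unfolding tail_def by (rule distribution_fn_antimono[OF Dm s])
    then have "tail s \<le> 1" using t1 by (rule order_trans)
    then show "distribution_fn half_line (disjoint_sum f) s = distribution_fn unit_interval rearr s"
      using s rearr_nonneg[of 1] unfolding rearr_def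
      by (subst distribution_fn_decreasing_fun[OF Dm fin]) (auto simp: tail_def min_absorb2)
  qed measurable
  also have "\<dots> \<le> shift_operator (\<lambda>t. large p (rearr t)) F x"
    unfolding shift_operator_def by (intro nn_integral_mono) (auto simp: indicator_def large_def)
  finally show ?thesis .
qed

lemma jump_sum_power_large_le:
  assumes F: "F \<in> borel_measurable borel"
  shows "(jump_sum unit_interval (\<lambda>k t. large p (f k t)) m ^^ n) F x \<le> (shift_operator (\<lambda>t. large p (rearr t)) ^^ n) F x"
proof (induction n arbitrary: x)
  case (Suc n)
  let ?Q = "jump_sum unit_interval (\<lambda>k t. large p (f k t)) m" and ?P = "shift_operator (\<lambda>t. large p (rearr t))"
  have "(?P ^^ n) F \<in> borel_measurable borel"
    by (rule shift_operator_power_measurable[OF measurable_compose[OF rearr_measurable large_measurable] F])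
  then have "?Q ((?P ^^ n) F) x \<le> ?P ((?P ^^ n) F) x" by (rule jump_sum_large_le)
  moreover have "?Q ((?Q ^^ n) F) x \<le> ?Q ((?P ^^ n) F) x" by (intro unit.jump_sum_mono Suc.IH)
  ultimately show ?case by (simp add: order_trans)
qed simp

text \<open>
  The exponential bound has the weights \<open>1 / n!\<close>, the compound Poisson law \<open>1 /
  (e n!)\<close>.
\<close>

lemma large_sum_tail_le:
  assumes A: "kruglov_setting A T" and s: "0 \<le> s"
  shows "emeasure unit_interval {t \<in> space unit_interval. s < large_sum p t} \<le>
    ennreal (exp 1) * emeasure unit_interval {t \<in> space unit_interval. s < kruglov A (\<lambda>x. large p (rearr x)) (T t)}"
proof -
  interpret kruglov_setting A T by (rule A)
  let ?Y = "\<lambda>k t. large p (f k t)"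
  let ?S = "\<lambda>m t. \<Sum>k<m. ?Y k t"
  let ?\<phi> = "\<lambda>x. large p (rearr x)"
  let ?B = "\<lambda>m. {t \<in> space unit_interval. s < ?S m t}"
  note Ym[measurable] = measurable_compose[OF sample_measurable large_measurable]
  note \<phi>m = measurable_compose[OF rearr_measurable large_measurable]
  have ind: "unit.indep_vars (\<lambda>_. borel) ?Y UNIV"
    by (rule unit.indep_vars_compose2[OF independent]) (rule large_measurable)
  have one: "emeasure unit_interval (?B m) \<le>
      ennreal (exp 1) * emeasure unit_interval {t \<in> space unit_interval. s < kruglov A ?\<phi> (T t)}" for m
  proof -
    have "emeasure unit_interval (?B m) = (\<integral>\<^sup>+t. indicator (?B m) t \<partial>unit_interval)"
      by (rule nn_integral_indicator[symmetric]) measurable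
    also have "\<dots> = (\<integral>\<^sup>+t. indicator {s<..} (0 + ?S m t) \<partial>unit_interval)"
      by (intro nn_integral_cong) (auto simp: indicator_def)
    also have "\<dots> \<le> (\<Sum>n. ennreal (1 / fact n) * (jump_sum unit_interval ?Y m ^^ n) (indicator {s<..}) 0)"
      by (rule unit.indep_sum_exponential_bound[OF ind]) measurable
    also have "\<dots> \<le> (\<Sum>n. ennreal (1 / fact n) * (shift_operator ?\<phi> ^^ n) (indicator {s<..}) 0)"
      by (intro suminf_le summableI mult_left_mono jump_sum_power_large_le) auto
    also have "\<dots> = (\<Sum>n. ennreal (exp 1) * (ennreal (1 / (exp 1 * fact n)) * (shift_operator ?\<phi> ^^ n) (indicator {s<..}) 0))"
      by (intro arg_cong[where f = suminf] ext) (simp add: mult.assoc[symmetric] ennreal_mult[symmetric])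
    also have "\<dots> = ennreal (exp 1) * emeasure unit_interval {t \<in> space unit_interval. s < kruglov A ?\<phi> (T t)}"
      by (simp only: kruglov_tail[OF \<phi>m s] ennreal_suminf_cmult)
    finally show ?thesis .
  qed
  have sub: "{t \<in> space unit_interval. s < large_sum p t} \<subseteq> (\<Union>m. ?B m)"
  proof
    fix t assume "t \<in> {t \<in> space unit_interval. s < large_sum p t}"
    then have t: "t \<in> space unit_interval" "s < large_sum p t" by auto
    have "ennreal s < (\<Sum>k. ennreal (?Y k t))"
      using t(2) s unfolding large_sum_def
      by (cases "\<Sum>k. ennreal (?Y k t)") (auto simp: ennreal_less_iff)
    also have "\<dots> = (SUP m. \<Sum>k<m. ennreal (?Y k t))" by (rule suminf_eq_SUP)
    finally obtain m where "ennreal s < (\<Sum>k<m. ennreal (?Y k t))" by (auto simp: less_SUP_iff)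
    then have "s < ?S m t" using s by (simp add: sum_ennreal large_nonneg ennreal_less_iff sum_nonneg)
    then show "t \<in> (\<Union>m. ?B m)" using t by auto
  qed
  have meas: "?B m \<in> sets unit_interval" for m by measurable
  have "incseq ?B"
  proof (rule incseq_SucI, safe)
    fix m t assume "s < ?S m t"
    moreover have "?S m t \<le> ?S (Suc m) t" using large_nonneg by simp
    ultimately show "s < ?S (Suc m) t" by linarith
  qed
  then have "emeasure unit_interval (\<Union>m. ?B m) = (SUP m. emeasure unit_interval (?B m))"
    using meas by (intro SUP_emeasure_incseq[symmetric]) auto
  also have "\<dots> \<le> ennreal (exp 1) * emeasure unit_interval {t \<in> space unit_interval. s < kruglov A ?\<phi> (T t)}"
    by (rule SUP_least) (rule one)
  finally show ?thesis
    using meas by (intro order_trans[OF emeasure_mono[OF sub]]) auto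
qed

end

text \<open>
  The entries above the level are finite in number, so \<open>large_sum\<close> is the finite sum
  that occurs in the \<open>\<ell>\<^sub>p\<close> bound.
\<close>

lemma large_sum_finite:
  assumes "finite (superlevel (\<lambda>k. f k t) (rearr 1))"
  defines "y \<equiv> \<lambda>k. if rearr 1 < \<bar>f k t\<bar> then f k t else 0"
  shows "finite {k. y k \<noteq> 0}" "(\<Sum>k | y k \<noteq> 0. \<bar>y k\<bar> powr p) = large_sum p t"
proof -
  have S: "{k. y k \<noteq> 0} = superlevel (\<lambda>k. f k t) (rearr 1)"
    using rearr_nonneg[of 1] by (auto simp: y_def)
  then show fin: "finite {k. y k \<noteq> 0}" using assms(1) by simp
  have "(\<Sum>k. ennreal (large p (f k t))) = (\<Sum>k | y k \<noteq> 0. ennreal (large p (f k t)))"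
    by (rule suminf_finite[OF fin]) (simp add: S large_def)
  also have "\<dots> = (\<Sum>k | y k \<noteq> 0. ennreal (\<bar>y k\<bar> powr p))"
    by (intro sum.cong refl) (auto simp: S y_def large_def)
  also have "\<dots> = ennreal (\<Sum>k | y k \<noteq> 0. \<bar>y k\<bar> powr p)" by (rule sum_ennreal) simp
  finally show "(\<Sum>k | y k \<noteq> 0. \<bar>y k\<bar> powr p) = large_sum p t"
    by (simp add: large_sum_def sum_nonneg)
qed

end

text \<open>
  Finiteness almost everywhere on \<open>(0,1)\<close> and monotonicity give finiteness on all of
  \<open>(0,\<infinity>)\<close>.
\<close>

lemma rearrangement_finite_of_fun_norm:
  assumes "fun_norm X N (\<lambda>t. rearrangement M f t * indicator {0<..<1} t) \<noteq> \<infinity>" and t: "0 < t"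
  shows "rearrangement M f t < \<infinity>"
proof -
  have AE: "AE t in unit_interval. rearrangement M f t * indicator {0<..<1} t \<noteq> \<infinity>"
    using assms(1) unfolding fun_norm_def by presburger
  have "\<exists>u\<in>{0<..<min 1 t}. rearrangement M f u * indicator {0<..<1} u \<noteq> \<infinity>"
  proof (rule ccontr)
    assume neg: "\<not> ?thesis"
    have "emeasure unit_interval {0<..<min 1 t} \<le> emeasure unit_interval {}"
      using AE neg by (intro emeasure_mono_AE) (auto elim!: eventually_mono)
    moreover have "emeasure unit_interval {0<..<min 1 t} = ennreal (min 1 t)"
      using t by (subst emeasure_unit_interval) auto
    ultimately show False using t by (simp add: ennreal_eq_0_iff)
  qed
  then obtain u where u: "0 < u" "u < 1" "u < t" "rearrangement M f u \<noteq> \<infinity>" by auto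
  then show ?thesis using rearrangement_antimono[of u t M f] by (simp add: less_top le_less_trans)
qed

context kruglov_setting begin

text \<open>
  The exponent \<open>p\<close> is chosen so that \<open>2 powr (1 / p) = 4 c\<^sup>2 =:
  R\<close>, with \<open>c\<close> the constant in the quasi-triangle inequality of
  \<open>E\<close>. This one choice gives the \<open>\<ell>\<^sub>p\<close> bound for the large
  entries, makes two dilations in \<open>E\<close> cost the factor \<open>R\<close>, and turns
  \<open>2 ^ j\<close> points of the Poisson variable into the value \<open>R ^ j\<close> of its
  \<open>1 / p\<close>-th power.
\<close>

lemma johnson_schechtman_upper:
  assumes X: "symmetric_fun_space X N" and E: "symmetric_seq_space E NE"
    and K: "\<And>p f. 0 < p \<Longrightarrow> p < 1 \<Longrightarrow> f \<in> power_space X p \<Longrightarrow> (\<lambda>t. kruglov A f (T t)) \<in> power_space X p"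
  obtains C where "0 < C" "\<And>f. unit.indep_vars (\<lambda>_. borel) f UNIV \<Longrightarrow> (\<And>k. f k \<in> X) \<Longrightarrow>
    pointwise_seq_norm E NE f \<in> borel_measurable unit_interval \<Longrightarrow>
    fun_norm X N (pointwise_seq_norm E NE f) \<le> ennreal C * rearrangement_norm X N E NE f"
proof -
  interpret X: symmetric_fun_space X N by (rule X)
  interpret E: symmetric_seq_space E NE by (rule E)
  obtain c where c: "1 \<le> c" "\<And>f g. f \<in> E \<Longrightarrow> g \<in> E \<Longrightarrow> NE (\<lambda>x. f x + g x) \<le> c * (NE f + NE g)"
    using E.quasi_triangle_constant by blast
  obtain cX where cX: "1 \<le> cX" "\<And>f g. f \<in> X \<Longrightarrow> g \<in> X \<Longrightarrow> N (\<lambda>x. f x + g x) \<le> cX * (N f + N g)"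
    using X.quasi_triangle_constant by blast
  define R where "R = 4 * c ^ 2"
  have R: "4 \<le> R" using c(1) by (simp add: R_def)
  define p where "p = ln 2 / ln R"
  have lnR: "ln 2 < ln R" "0 < ln (2::real)" using R by auto
  have p: "0 < p" "p < 1" using lnR R by (auto simp: p_def)
  have pR: "2 powr (1 / p) = R"
    using lnR R by (simp add: p_def powr_def)
  obtain B where B: "0 \<le> B" "\<And>g. g \<in> X \<Longrightarrow> (\<And>x. 0 \<le> g x) \<Longrightarrow>
    (\<lambda>t. kruglov A (\<lambda>x. g x powr p) (T t) powr (1 / p)) \<in> X \<and>
    N (\<lambda>t. kruglov A (\<lambda>x. g x powr p) (T t) powr (1 / p)) \<le> B * N g"
    using X.kruglov_bounded[OF A_sets A_disjoint T p(1) K[OF p]] by blast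
  obtain D where D: "0 < D" "X.dilation_bound (exp 1) D"
    using X.dilation by blast
  have "\<exists>G\<ge>0. (\<lambda>_. 1) \<in> X \<longrightarrow> (\<forall>J. J \<in> unit_interval \<rightarrow>\<^sub>M count_space UNIV \<longrightarrow>
      (\<forall>j. emeasure unit_interval {t \<in> space unit_interval. j < J t} \<le> ennreal (2 / fact (2 ^ j))) \<longrightarrow>
      (\<lambda>t. R ^ J t) \<in> X \<and> N (\<lambda>t. R ^ J t) \<le> G)"
  proof (cases "(\<lambda>_. 1) \<in> X")
    case True
    define W where "W t = kruglov A (\<lambda>x. 1 powr p) (T t) powr (1 / p)" for t
    have WX: "W \<in> X" using B(2)[OF True] unfolding W_def by simp
    have W_tail: "ennreal (1 / (exp 1 * fact (2 ^ j))) \<le> emeasure unit_interval {t \<in> space unit_interval. R ^ j \<le> W t}" for j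
    proof -
      have "ennreal (1 / (exp 1 * fact (2 ^ j))) = emeasure unit_interval {t \<in> space unit_interval. T t 0 \<in> A (2 ^ j)}"
        by (simp only: emeasure_A[symmetric] emeasure_coordinate[OF T A_sets])
      also have "\<dots> \<le> emeasure unit_interval {t \<in> space unit_interval. R ^ j \<le> W t}"
      proof (rule emeasure_mono)
        show "{t \<in> space unit_interval. T t 0 \<in> A (2 ^ j)} \<subseteq> {t \<in> space unit_interval. R ^ j \<le> W t}"
        proof
          fix t assume t: "t \<in> {t \<in> space unit_interval. T t 0 \<in> A (2 ^ j)}"
          then have "kruglov A (\<lambda>x. 1 powr p) (T t) = 2 ^ j"
            using kruglov_on[OF A_sets A_disjoint, of "T t" "2 ^ j"] by simp
          then have "W t = (2 powr real j) powr (1 / p)" by (simp add: W_def powr_realpow)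
          also have "\<dots> = R ^ j" using R by (simp add: powr_powr powr_realpow mult.commute flip: pR)
            (simp add: powr_powr mult.commute pR[symmetric] powr_realpow[symmetric])
          finally show "t \<in> {t \<in> space unit_interval. R ^ j \<le> W t}" using t by simp
        qed
        show "{t \<in> space unit_interval. R ^ j \<le> W t} \<in> sets unit_interval"
          using X.mem_measurable[OF WX] by measurable
      qed
      finally show ?thesis .
    qed
    have "1 < R" using R by simp
    from X.geometric_majorant[OF WX this W_tail] obtain G where "0 \<le> G"
      "\<And>J. J \<in> unit_interval \<rightarrow>\<^sub>M count_space UNIV \<Longrightarrow>
      (\<And>j. emeasure unit_interval {t \<in> space unit_interval. j < J t} \<le> ennreal (2 / fact (2 ^ j))) \<Longrightarrow>
      (\<lambda>t. R ^ J t) \<in> X \<and> N (\<lambda>t. R ^ J t) \<le> G" by blast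
    then show ?thesis by (intro exI[of _ G]) blast
  qed auto
  then obtain G where G: "0 \<le> G" "\<And>J. (\<lambda>_. 1) \<in> X \<Longrightarrow> J \<in> unit_interval \<rightarrow>\<^sub>M count_space UNIV \<Longrightarrow>
      (\<And>j. emeasure unit_interval {t \<in> space unit_interval. j < J t} \<le> ennreal (2 / fact (2 ^ j))) \<Longrightarrow>
      (\<lambda>t. R ^ J t) \<in> X \<and> N (\<lambda>t. R ^ J t) \<le> G" by blast
  define C where "C = 1 + cX * (c * R * (D * B) + c * (2 * c) ^ 5 * G)"
  have c0: "0 < c" "0 < cX" using c(1) cX(1) by auto
  have C0: "0 < C" unfolding C_def
    using c0 R D(1) B(1) G(1) by (intro add_pos_nonneg mult_nonneg_nonneg add_nonneg_nonneg) auto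
  show ?thesis
  proof (rule that[OF C0])
    fix f :: "nat \<Rightarrow> real \<Rightarrow> real"
    assume ind: "unit.indep_vars (\<lambda>_. borel) f UNIV" and fX: "\<And>k. f k \<in> X"
      and pm: "pointwise_seq_norm E NE f \<in> borel_measurable unit_interval"
    interpret independent_sample f by unfold_locales (rule ind)
    let ?\<mu> = "rearrangement half_line (disjoint_sum f)"
    let ?lhs = "fun_norm X N (pointwise_seq_norm E NE f)"
    let ?r1 = "fun_norm X N (\<lambda>t. ?\<mu> t * indicator {0<..<1} t)"
    let ?r2 = "seq_norm E NE (\<lambda>k. ?\<mu> (real (Suc k)))"
    define L where "L t = enn2real (pointwise_seq_norm E NE f t)" for t
    have Lm: "L \<in> borel_measurable unit_interval" unfolding L_def using pm by measurable
    have lhs_le: "?lhs \<le> ennreal b"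
      if V: "V \<in> X" "N V \<le> b" and AE: "AE t in unit_interval. (\<lambda>k. f k t) \<in> E \<and> NE (\<lambda>k. f k t) \<le> V t" for V b
    proof -
      have fin: "AE t in unit_interval. pointwise_seq_norm E NE f t \<noteq> \<infinity>"
        using AE by eventually_elim (simp add: pointwise_seq_norm_def)
      have "AE t in unit_interval. \<bar>L t\<bar> \<le> \<bar>V t\<bar>"
        using AE by eventually_elim (auto simp: L_def pointwise_seq_norm_def E.nonneg)
      from X.ideal[OF V(1) Lm this] have "L \<in> X" "N L \<le> N V" by auto
      then show ?thesis using fin V(2) by (simp add: fun_norm_def L_def[abs_def] ennreal_leI)
    qed
    have "?lhs \<le> ennreal C * (?r1 + ?r2)"
    proof (cases "(\<lambda>_. 1) \<in> X")
      case False
      then have "AE t in unit_interval. f k t = 0" for k using X.constant_mem[OF fX] by blast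
      then have "AE t in unit_interval. \<forall>k. f k t = 0" by (simp add: AE_all_countable)
      then have "AE t in unit_interval. (\<lambda>k. f k t) \<in> E \<and> NE (\<lambda>k. f k t) \<le> 0"
        by eventually_elim (simp add: E.zero_mem E.quasi_norm_zero)
      from lhs_le[OF X.zero_mem _ this, of 0] show ?thesis by (simp add: X.quasi_norm_zero)
    next
      case one: True
      show ?thesis
      proof (cases "?r1 = \<infinity> \<or> ?r2 = \<infinity>")
        case True
        then show ?thesis using C0 by (auto simp: ennreal_mult_top)
      next
        case False
        then have r1: "?r1 \<noteq> \<infinity>" and r2: "?r2 \<noteq> \<infinity>" by auto
        have fin: "?\<mu> t < \<infinity>" if "0 < t" for t by (rule rearrangement_finite_of_fun_norm[OF r1 that])
        have rm[measurable]: "rearr \<in> borel_measurable unit_interval"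
          by (rule rearr_measurable) (rule fin)
        have r1X: "(\<lambda>t. enn2real (?\<mu> t * indicator {0<..<1} t)) \<in> X"
          using r1 unfolding fun_norm_def by presburger
        have "AE t in unit_interval. rearr t = enn2real (?\<mu> t * indicator {0<..<1} t)"
          by (rule AE_I2) (simp add: rearr_def decreasing_fun_def space_restrict_space)
        from X.AE_eq_mem_norm(1)[OF r1X rm this] have rX: "rearr \<in> X" .
        have r1_eq: "?r1 = ennreal (N rearr)"
          unfolding rearr_def by (rule X.fun_norm_rearrangement[OF fin]) (use rX in \<open>auto simp: rearr_def\<close>)
        define e where "e n = rearr (real (Suc n))" for n
        have "(\<lambda>k. enn2real (?\<mu> (real (Suc k)))) \<in> E" and r2': "?r2 = ennreal (NE (\<lambda>k. enn2real (?\<mu> (real (Suc k)))))"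
          using r2 unfolding seq_norm_def by presburger+
        then have eE: "e \<in> E" and r2_eq: "?r2 = ennreal (NE e)"
          by (simp_all only: e_def[abs_def] rearr_def decreasing_fun_def[abs_def])
        define V1 where "V1 t = large_sum p t powr (1 / p)" for t
        define V2 where "V2 t = R ^ level t" for t
        define g where "g t = (if rearr 1 < rearr t then rearr t else 0)" for t
        have gX: "g \<in> X \<and> N g \<le> N rearr"
          by (rule X.ideal[OF rX]) (auto simp: g_def[abs_def])
        have g0: "0 \<le> g x" for x by (simp add: g_def rearr_nonneg)
        have g_large: "g x powr p = large p (rearr x)" for x
          by (simp add: g_def large_def rearr_nonneg abs_of_nonneg)
        from B(2)[OF conjunct1[OF gX] g0]
        have Kg: "(\<lambda>t. kruglov A (\<lambda>x. large p (rearr x)) (T t) powr (1 / p)) \<in> X"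
          "N (\<lambda>t. kruglov A (\<lambda>x. large p (rearr x)) (T t) powr (1 / p)) \<le> B * N g"
          by (simp_all only: g_large)
        note [measurable] = large_sum_measurable
        have V1: "V1 \<in> X \<and> N V1 \<le> D * N (\<lambda>t. kruglov A (\<lambda>x. large p (rearr x)) (T t) powr (1 / p))"
        proof (rule X.dilation_boundD[OF D(2) Kg(1)])
          show "V1 \<in> borel_measurable unit_interval" unfolding V1_def[abs_def] by measurable
          fix s :: real assume s: "0 \<le> s"
          have "{t \<in> space unit_interval. s < \<bar>V1 t\<bar>} = {t \<in> space unit_interval. s powr p < large_sum p t}"
            using s p by (simp add: V1_def less_powr_root_iff large_sum_def)
          moreover have "{t \<in> space unit_interval. s < \<bar>kruglov A (\<lambda>x. large p (rearr x)) (T t) powr (1 / p)\<bar>} =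
              {t \<in> space unit_interval. s powr p < kruglov A (\<lambda>x. large p (rearr x)) (T t)}"
            using s p kruglov_nonneg[OF A_sets A_disjoint large_nonneg] by (simp add: less_powr_root_iff)
          ultimately show "distribution_fn unit_interval V1 s \<le>
              ennreal (exp 1) * distribution_fn unit_interval (\<lambda>t. kruglov A (\<lambda>x. large p (rearr x)) (T t) powr (1 / p)) s"
            unfolding distribution_fn_def
            using large_sum_tail_le[OF fin kruglov_setting_axioms, of "s powr p" p] by (simp only: powr_ge_zero)
        qed
        have "B * N g \<le> B * N rearr" using gX B(1) by (intro mult_left_mono) auto
        then have "D * N (\<lambda>t. kruglov A (\<lambda>x. large p (rearr x)) (T t) powr (1 / p)) \<le> D * (B * N rearr)"
          using D(1) Kg(2) by (intro mult_left_mono) auto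
        then have NV1: "N V1 \<le> D * B * N rearr" using V1 by (simp add: mult.assoc)
        have V2: "V2 \<in> X \<and> N V2 \<le> G"
          unfolding V2_def[abs_def]
          by (rule G(2)[OF one level_measurable emeasure_level_gt_le[OF fin]])
        define V where "V t = c * R * V1 t + c * (2 * c) ^ 5 * NE e * V2 t" for t
        have VX: "V \<in> X" unfolding V_def[abs_def] using V1 V2 by (intro X.add_mem X.scale_mem) auto
        have "N V \<le> cX * (N (\<lambda>t. c * R * V1 t) + N (\<lambda>t. c * (2 * c) ^ 5 * NE e * V2 t))"
          unfolding V_def[abs_def] using V1 V2 by (intro cX(2) X.scale_mem) auto
        also have "\<dots> = cX * (c * R * N V1 + c * (2 * c) ^ 5 * NE e * N V2)"
          using V1 V2 c0 R E.nonneg[OF eE] by (simp only: X.homogeneous abs_mult abs_of_nonneg) (simp add: abs_mult abs_of_nonneg)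
        also have "\<dots> \<le> cX * (c * R * (D * B * N rearr) + c * (2 * c) ^ 5 * NE e * G)"
          using NV1 V2 c0 R E.nonneg[OF eE] by (intro mult_left_mono add_mono) auto
        also have "\<dots> \<le> C * (N rearr + NE e)"
        proof -
          have nn: "0 \<le> N rearr" "0 \<le> NE e" "0 \<le> cX * (c * R * (D * B))" "0 \<le> cX * (c * (2 * c) ^ 5 * G)"
            using X.nonneg[OF rX] E.nonneg[OF eE] c0 R D(1) B(1) G(1) by auto
          have "cX * (c * R * (D * B * N rearr) + c * (2 * c) ^ 5 * NE e * G) =
              cX * (c * R * (D * B)) * N rearr + cX * (c * (2 * c) ^ 5 * G) * NE e"
            by (simp add: algebra_simps)
          also have "\<dots> \<le> C * N rearr + C * NE e"
            using nn by (intro add_mono mult_right_mono) (auto simp: C_def distrib_left)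
          finally show ?thesis by (simp add: distrib_left)
        qed
        finally have NV: "N V \<le> C * (N rearr + NE e)" .
        have "AE t in unit_interval. t \<in> controlled (level t)"
          by (rule AE_controlled_level) (rule fin)
        then have "AE t in unit_interval. (\<lambda>k. f k t) \<in> E \<and> NE (\<lambda>k. f k t) \<le> V t"
        proof eventually_elim
          case (elim t)
          define J where "J = level t"
          have few: "finite (superlevel (\<lambda>k. f k t) (rearr (2 ^ i))) \<and>
              card (superlevel (\<lambda>k. f k t) (rearr (2 ^ i))) \<le> 2 ^ (i + (2 * J + 4))" for i
            using elim unfolding controlled_def few_exceedances_def J_def by blast
          \<comment> \<open>The sample is split at the level \<open>\<mu>(1)\<close> into a finitely supported part and a bounded part.\<close>
          define y where "y k = (if rearr 1 < \<bar>f k t\<bar> then f k t else 0)" for k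
          define z where "z k = (if rearr 1 < \<bar>f k t\<bar> then 0 else f k t)" for k
          have fin1: "finite (superlevel (\<lambda>k. f k t) (rearr 1))" using few[of 0] by simp
          note ls = large_sum_finite[OF fin1, folded y_def]
          have y: "y \<in> E \<and> NE y \<le> R * V1 t"
            using E.finite_support_lp_bound[OF c(2,1) p(1) _ ls(1)] pR
            unfolding ls(2) V1_def R_def by blast
          have z: "z \<in> E \<and> NE z \<le> (2 * c) ^ Suc (2 * J + 4) * NE (\<lambda>n. rearr (real (Suc n)))"
          proof (rule E.sample_le_rearrangement[OF c(2,1)])
            show "(\<lambda>n. rearr (real (Suc n))) \<in> E" using eE by (simp only: e_def[abs_def])
            show "\<bar>z k\<bar> \<le> rearr 1" for k using rearr_nonneg[of 1] by (simp add: z_def)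
            fix i
            have sub: "superlevel z (rearr (2 ^ i)) \<subseteq> superlevel (\<lambda>k. f k t) (rearr (2 ^ i))"
              using rearr_nonneg[of "2 ^ i"] by (auto simp: z_def split: if_splits)
            then show "finite (superlevel z (rearr (2 ^ i))) \<and> card (superlevel z (rearr (2 ^ i))) \<le> 2 ^ (i + (2 * J + 4))"
              using few[of i] by (meson card_mono finite_subset order_trans)
          qed (auto intro: rearr_nonneg rearr_antimono[OF fin])
          have pow: "(2 * c) ^ Suc (2 * J + 4) = (2 * c) ^ 5 * V2 t"
          proof -
            have "(2 * c) ^ Suc (2 * J + 4) = (2 * c) ^ (5 + 2 * J)" by (rule arg_cong[where f = "(^) (2 * c)"]) simp
            also have "\<dots> = (2 * c) ^ 5 * ((2 * c) ^ 2) ^ J" by (simp only: power_add power_mult)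
            also have "(2 * c) ^ 2 = R" by (simp add: R_def power_mult_distrib)
            finally show ?thesis by (simp add: V2_def J_def)
          qed
          have eq: "(\<lambda>k. f k t) = (\<lambda>k. y k + z k)" by (auto simp: y_def z_def)
          have "NE (\<lambda>k. y k + z k) \<le> c * (NE y + NE z)" using c(2) y z by blast
          also have "\<dots> \<le> c * (R * V1 t + (2 * c) ^ 5 * V2 t * NE e)"
            using y z c0 unfolding pow e_def[abs_def, symmetric] by (intro mult_left_mono add_mono) auto
          also have "\<dots> = V t" by (simp add: V_def algebra_simps)
          finally have "NE (\<lambda>k. y k + z k) \<le> V t" .
          moreover have "(\<lambda>k. y k + z k) \<in> E" using E.add_mem y z by blast
          ultimately show ?case unfolding eq by blast
        qed
        from lhs_le[OF VX NV this] have "?lhs \<le> ennreal (C * (N rearr + NE e))" .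
        also have "\<dots> = ennreal C * (?r1 + ?r2)"
          unfolding r1_eq r2_eq using C0 X.nonneg[OF rX] E.nonneg[OF eE] by (simp add: ennreal_mult)
        finally show ?thesis .
      qed
    qed
    then show "?lhs \<le> ennreal C * rearrangement_norm X N E NE f" by (simp only: rearrangement_norm_def)
  qed
qed

end

section \<open>Necessity of the condition on the Kruglov operator\<close>

lemma ennreal_suminf_pair_le:
  fixes x :: "nat \<Rightarrow> ennreal"
  assumes "x 0 = 0"
  shows "(\<Sum>n. x n) \<le> (\<Sum>m. x (2 * m + 1) + x (2 * m + 2))"
proof (rule suminf_le_const[OF summableI])
  fix n
  have eq: "(\<Sum>i<2 * n + 1. x i) = (\<Sum>m<n. x (2 * m + 1) + x (2 * m + 2))"
    using assms by (induction n) (auto simp: add.assoc)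
  have "(\<Sum>i<n. x i) \<le> (\<Sum>i<2 * n + 1. x i)" by (rule sum_mono2) auto
  also have "\<dots> \<le> (\<Sum>m. x (2 * m + 1) + x (2 * m + 2))"
    unfolding eq by (rule sum_le_suminf) auto
  finally show "(\<Sum>i<n. x i) \<le> (\<Sum>m. x (2 * m + 1) + x (2 * m + 2))" .
qed

text \<open>
  Under the uniform law on \<open>(0,1)\<close>, this has the law of \<open>g\<close> on an event
  \<open>{..<q}\<close> of probability \<open>q\<close> and vanishes elsewhere.
\<close>

definition dilated :: "(real \<Rightarrow> real) \<Rightarrow> real \<Rightarrow> real \<Rightarrow> real" where
  "dilated g q x = g (x / q) * indicator {0<..<1} (x / q)"

lemma dilated_measurable_lebesgue:
  assumes g: "g \<in> borel_measurable unit_interval" and q: "0 < q"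
  shows "dilated g q \<in> borel_measurable lebesgue"
proof -
  have G: "(\<lambda>x. g x * indicator {0<..<1} x) \<in> borel_measurable lebesgue"
    using g by (simp add: borel_measurable_restrict_space_iff mult.commute)
  have "(\<lambda>x. 0 + (1 / q) * x) \<in> lebesgue \<rightarrow>\<^sub>M lebesgue"
    using q by (intro affine_measurable_lebesgue) simp
  from measurable_compose[OF this G] show ?thesis by (simp add: dilated_def[abs_def])
qed

lemma dilated_measurable:
  assumes "g \<in> borel_measurable unit_interval" "0 < q"
  shows "dilated g q \<in> borel_measurable unit_interval"
  by (rule measurable_restrict_space1[OF dilated_measurable_lebesgue[OF assms]])

lemma nn_integral_dilated:
  fixes \<Psi> :: "real \<Rightarrow> ennreal"
  assumes g: "g \<in> borel_measurable unit_interval" and q: "0 < q" "q \<le> 1" and \<Psi>[measurable]: "\<Psi> \<in> borel_measurable borel"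
  shows "(\<integral>\<^sup>+x. \<Psi> (dilated g q x) * indicator {..<q} x \<partial>unit_interval) = ennreal q * (\<integral>\<^sup>+x. \<Psi> (g x) \<partial>unit_interval)"
proof -
  let ?G = "\<lambda>x. g x * indicator {0<..<1} x"
  have G: "?G \<in> borel_measurable lebesgue"
    using g by (simp add: borel_measurable_restrict_space_iff mult.commute)
  note [measurable] = measurable_compose[OF G \<Psi>]
  have "(\<integral>\<^sup>+x. \<Psi> (g x) \<partial>unit_interval) = (\<integral>\<^sup>+x. \<Psi> (g x) * indicator {0<..<1} x \<partial>lebesgue)"
    by (rule nn_integral_restrict_space) auto
  also have "\<dots> = (\<integral>\<^sup>+x. \<Psi> (?G x) * indicator {0<..<1} x \<partial>lebesgue)"
    by (intro nn_integral_cong) (auto simp: indicator_def)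
  also have "\<dots> = ennreal \<bar>1 / q\<bar> * (\<integral>\<^sup>+x. \<Psi> (?G (0 + (1 / q) * x)) * indicator {0<..<1} (0 + (1 / q) * x) \<partial>lebesgue)"
    using q by (intro nn_integral_real_affine_lebesgue borel_measurable_times_ennreal borel_measurable_indicator) auto
  also have "(\<integral>\<^sup>+x. \<Psi> (?G (0 + (1 / q) * x)) * indicator {0<..<1} (0 + (1 / q) * x) \<partial>lebesgue) =
      (\<integral>\<^sup>+x. \<Psi> (dilated g q x) * indicator {..<q} x * indicator {0<..<1} x \<partial>lebesgue)"
    using q by (intro nn_integral_cong) (auto simp: indicator_def dilated_def field_simps)
  also have "\<dots> = (\<integral>\<^sup>+x. \<Psi> (dilated g q x) * indicator {..<q} x \<partial>unit_interval)"
    by (rule nn_integral_restrict_space[symmetric]) auto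
  finally have "ennreal q * (\<integral>\<^sup>+x. \<Psi> (g x) \<partial>unit_interval) =
      ennreal q * ennreal (1 / q) * (\<integral>\<^sup>+x. \<Psi> (dilated g q x) * indicator {..<q} x \<partial>unit_interval)"
    using q by (simp add: mult.assoc)
  also have "ennreal q * ennreal (1 / q) = 1"
    using q by (subst ennreal_mult[symmetric]) auto
  finally show ?thesis by simp
qed

lemma distribution_fn_dilated:
  assumes g: "g \<in> borel_measurable unit_interval" and q: "0 < q" "q \<le> 1" and s: "0 \<le> s"
  shows "distribution_fn unit_interval (dilated g q) s = ennreal q * distribution_fn unit_interval g s"
proof -
  have [measurable]: "{y::real. \<bar>y\<bar> > s} \<in> sets borel" by measurable
  have "distribution_fn unit_interval (dilated g q) s = (\<integral>\<^sup>+x. indicator {y. \<bar>y\<bar> > s} (dilated g q x) \<partial>unit_interval)"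
    by (rule distribution_fn_eq_nn_integral[OF dilated_measurable[OF g q(1)]])
  also have "\<dots> = (\<integral>\<^sup>+x. indicator {y. \<bar>y\<bar> > s} (dilated g q x) * indicator {..<q} x \<partial>unit_interval)"
    using q s by (intro nn_integral_cong) (auto simp: indicator_def dilated_def field_simps)
  also have "\<dots> = ennreal q * distribution_fn unit_interval g s"
    unfolding distribution_fn_eq_nn_integral[OF g] by (rule nn_integral_dilated[OF g q]) measurable
  finally show ?thesis .
qed

text \<open>
  These probabilities \<open>q k\<close> are summable, while the product of the first \<open>n +
  1\<close> of them is \<open>1 / (2 n + 1)!\<close>, an upper bound for the probability that a
  Poisson variable is at least \<open>2 n + 1\<close>.
\<close>

definition success :: "nat \<Rightarrow> real" where
  "success k = (if k = 0 then 1 else 1 / (real (2 * k) * real (2 * k + 1)))"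

lemma success_pos: "0 < success k"
  by (simp add: success_def)

lemma success_le_1: "success k \<le> 1"
proof (cases "k = 0")
  case False
  then have "1 \<le> real (2 * k) * real (2 * k + 1)" using mult_mono[of 1 "real (2 * k)" 1 "real (2 * k + 1)"] by simp
  then show ?thesis using False by (simp add: success_def)
qed (simp add: success_def)

lemma sum_success_le: "(\<Sum>k<m. success k) \<le> 2"
proof -
  have "(\<Sum>k<Suc m. success k) \<le> 2 - 1 / real (Suc m)" for m
  proof (induction m)
    case (Suc m)
    have "success (Suc m) \<le> 1 / (real (Suc m) * real (Suc (Suc m)))"
      unfolding success_def by (auto intro!: divide_left_mono mult_mono)
    also have "\<dots> = 1 / real (Suc m) - 1 / real (Suc (Suc m))" by (simp add: field_simps)
    finally show ?case using Suc by simp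
  qed (simp add: success_def)
  from this[of m] have "(\<Sum>k<Suc m. success k) \<le> 2" by (rule order_trans) simp
  then show ?thesis using success_pos[of m] by simp
qed

lemma prod_success: "(\<Prod>k<Suc n. success k) = 1 / fact (2 * n + 1)"
proof (induction n)
  case (Suc n)
  have "fact (2 * Suc n + 1) = real (2 * Suc n + 1) * (real (2 * Suc n) * fact (2 * n + 1))"
    by (simp add: fact_Suc algebra_simps)
  with Suc show ?case by (simp add: success_def field_simps del: of_nat_Suc fact_Suc)
qed (simp add: success_def)

text \<open>
  The Poisson weights of \<open>2 n + 1\<close> and \<open>2 n + 2\<close> together are at most
  the probability of exactly \<open>n + 1\<close> initial successes. Up to the common factor
  \<open>1 / (2 n + 1)!\<close>, the former is at most \<open>(3 / 2) / e \<le> 3 / 4\<close> and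
  the latter at least \<open>5 / 6\<close>.
\<close>

lemma poisson_pair_le:
  "1 / (exp 1 * fact (2 * n + 1)) + 1 / (exp 1 * fact (2 * n + 2)) \<le>
    (\<Prod>k<Suc n. success k) * (1 - success (Suc n))"
proof -
  define a where "a = 1 / (fact (2 * n + 1) :: real)"
  have a0: "0 \<le> a" by (simp add: a_def)
  have e: "2 \<le> exp (1::real)" using exp_ge_add_one_self[of 1] by simp
  have "fact (2 * n + 2) = real (2 * n + 2) * fact (2 * n + 1)" by (simp add: fact_Suc)
  then have 1: "1 / fact (2 * n + 2) = a / real (2 * n + 2)" by (simp only: a_def) simp
  have "a / real (2 * n + 2) \<le> a / 2" using a0 by (intro divide_left_mono) auto
  with 1 have "a + 1 / fact (2 * n + 2) \<le> a * (3 / 2)" by linarith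
  then have "(a + 1 / fact (2 * n + 2)) / exp 1 \<le> a * (3 / 2) / exp 1" by (intro divide_right_mono) auto
  also have "\<dots> \<le> a * (3 / 2) / 2" using e a0 by (intro divide_left_mono) auto
  also have "\<dots> \<le> a * (1 - success (Suc n))"
  proof -
    have "(2::real) * 3 \<le> real (2 * Suc n) * real (2 * Suc n + 1)" by (intro mult_mono) auto
    then have "success (Suc n) \<le> 1 / (2 * 3)" unfolding success_def by (simp only: nat.distinct if_False) (intro divide_left_mono, auto)
    then have "(3 / 4) \<le> 1 - success (Suc n)" by simp
    then have "a * (3 / 4) \<le> a * (1 - success (Suc n))" using a0 by (intro mult_left_mono) auto
    then show ?thesis by simp
  qed
  finally have "a / exp 1 + (1 / fact (2 * n + 2)) / exp 1 \<le> a * (1 - success (Suc n))"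
    by (simp only: add_divide_distrib)
  then show ?thesis unfolding prod_success a_def[symmetric] by (simp add: a_def mult.commute)
qed

context
  fixes g :: "real \<Rightarrow> real" and p :: real
  assumes g: "g \<in> borel_measurable unit_interval"
begin

text \<open>
  The function to which the Kruglov operator is applied: the \<open>p\<close>-th power of an
  element of \<open>X\<close>.
\<close>

abbreviation (input) term_power :: "real \<Rightarrow> real" where
  "term_power x \<equiv> \<bar>g x\<bar> powr p"

lemma term_power_measurable: "term_power \<in> borel_measurable unit_interval"
  using g by measurable

lemma shift_power_tail_mono:
  assumes "m \<le> n"
  shows "(shift_operator term_power ^^ m) (indicator {s<..}) 0 \<le> (shift_operator term_power ^^ n) (indicator {s<..}) 0"
proof -
  have F: "indicator {s<..} \<in> borel_measurable borel" by (intro borel_measurable_indicator) auto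
  have "(\<Sum>k<m. term_power (\<omega> k)) \<le> (\<Sum>k<n. term_power (\<omega> k))" for \<omega>
    using assms by (intro sum_mono2) auto
  then have le: "indicator {s<..} (0 + (\<Sum>k<m. term_power (\<omega> k))) \<le> (indicator {s<..} (0 + (\<Sum>k<n. term_power (\<omega> k))) :: ennreal)" for \<omega>
    by (auto simp: indicator_def intro: less_le_trans)
  show ?thesis
    unfolding nn_integral_sum_coordinates[OF term_power_measurable F, symmetric]
    by (intro nn_integral_mono le)
qed

text \<open>
  If a sum of \<open>2 n\<close> independent copies exceeds \<open>2 s\<close>, then one of its
  halves exceeds \<open>s\<close>.
\<close>

lemma shift_power_tail_double:
  "(shift_operator term_power ^^ (n + n)) (indicator {2 * s<..}) 0 \<le> 2 * (shift_operator term_power ^^ n) (indicator {s<..}) 0"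
proof -
  have F: "indicator {s<..} \<in> borel_measurable borel" for s :: real by (intro borel_measurable_indicator) auto
  note int = nn_integral_sum_coordinates[OF term_power_measurable]
  note Fn = shift_operator_power_measurable[OF term_power_measurable F]
  note [measurable] = measurable_compose[OF coordinate_measurable term_power_measurable]
  let ?S = "\<lambda>\<omega>. \<Sum>k<n. term_power (\<omega> k)"
  have "(shift_operator term_power ^^ (n + n)) (indicator {2 * s<..}) 0 =
      (\<integral>\<^sup>+\<omega>. \<integral>\<^sup>+\<omega>'. indicator {2 * s<..} (0 + ?S \<omega> + ?S \<omega>') \<partial>unit_product \<partial>unit_product)"
    by (simp only: funpow_add o_apply int[OF Fn, symmetric] int[OF F, symmetric])
  also have "\<dots> \<le> (\<integral>\<^sup>+\<omega>. \<integral>\<^sup>+\<omega>'. indicator {s<..} (0 + ?S \<omega>) + indicator {s<..} (0 + ?S \<omega>') \<partial>unit_product \<partial>unit_product)"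
    by (intro nn_integral_mono) (auto simp: indicator_def)
  also have "\<dots> = (\<integral>\<^sup>+\<omega>. indicator {s<..} (0 + ?S \<omega>) + (shift_operator term_power ^^ n) (indicator {s<..}) 0 \<partial>unit_product)"
  proof (rule nn_integral_cong)
    fix \<omega>
    have "(\<integral>\<^sup>+\<omega>'. indicator {s<..} (0 + ?S \<omega>) + indicator {s<..} (0 + ?S \<omega>') \<partial>unit_product) =
        (\<integral>\<^sup>+\<omega>'. indicator {s<..} (0 + ?S \<omega>) \<partial>unit_product) + (\<integral>\<^sup>+\<omega>'. indicator {s<..} (0 + ?S \<omega>') \<partial>unit_product)"
      by (rule nn_integral_add) measurable
    then show "(\<integral>\<^sup>+\<omega>'. indicator {s<..} (0 + ?S \<omega>) + indicator {s<..} (0 + ?S \<omega>') \<partial>unit_product) =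
        indicator {s<..} (0 + ?S \<omega>) + (shift_operator term_power ^^ n) (indicator {s<..}) 0"
      by (simp only: int[OF F] nn_integral_const unit_seq.emeasure_space_1 mult_1_right)
  qed
  also have "\<dots> = (\<integral>\<^sup>+\<omega>. indicator {s<..} (0 + ?S \<omega>) \<partial>unit_product) +
      (\<integral>\<^sup>+\<omega>. (shift_operator term_power ^^ n) (indicator {s<..}) 0 \<partial>unit_product)"
    by (rule nn_integral_add) measurable
  also have "\<dots> = 2 * (shift_operator term_power ^^ n) (indicator {s<..}) 0"
    by (simp only: int[OF F] nn_integral_const unit_seq.emeasure_space_1 mult_1_right mult_2)
  finally show ?thesis .
qed

text \<open>
  The event that coordinates \<open>0, \<dots>, m - 1\<close> are successes and coordinate
  \<open>m\<close> is not has probability \<open>(\<Prod>k<m. q k) * (1 - q m)\<close>, and given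
  this event the sum consists of \<open>m\<close> independent copies. The offset \<open>i\<close>
  is there for the induction, which splits off the first coordinate.
\<close>

lemma nn_integral_initial_successes:
  assumes F[measurable]: "F \<in> borel_measurable borel"
  shows "(\<integral>\<^sup>+\<omega>. (\<Prod>k<m. indicator {..<success (k + i)} (\<omega> k)) * indicator {success (m + i)..} (\<omega> m) *
      F (x + (\<Sum>k<m. \<bar>dilated g (success (k + i)) (\<omega> k)\<bar> powr p)) \<partial>unit_product) =
    ennreal ((\<Prod>k<m. success (k + i)) * (1 - success (m + i))) * (shift_operator term_power ^^ m) F x"
proof (induction m arbitrary: i x)
  case 0
  have "indicator {success i..} \<in> borel_measurable unit_interval"
    by (rule measurable_restrict_space1, rule borel_measurable_indicator) simp
  note [measurable] = measurable_compose[OF coordinate_measurable this] measurable_compose[OF coordinate_measurable borel_measurable_indicator]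
  have tail: "(\<integral>\<^sup>+y. indicator {success i..} y \<partial>unit_interval) = ennreal (1 - success i)"
  proof -
    have "(\<integral>\<^sup>+y. indicator {success i..} y \<partial>unit_interval) = (\<integral>\<^sup>+y. indicator {success i..<1} y \<partial>unit_interval)"
      by (intro nn_integral_cong) (auto simp: indicator_def)
    also have "\<dots> = emeasure unit_interval {success i..<1}"
      using success_pos[of i] by (intro nn_integral_indicator) (auto simp: sets_unit_interval_iff)
    also have "\<dots> = ennreal (1 - success i)"
      using success_pos[of i] success_le_1[of i] by (subst emeasure_unit_interval) auto
    finally show ?thesis .
  qed
  have "(\<integral>\<^sup>+\<omega>. indicator {success i..} (\<omega> 0) * F x \<partial>unit_product) =
      (\<integral>\<^sup>+y. \<integral>\<^sup>+\<omega>. indicator {success i..} y * F x \<partial>unit_product \<partial>unit_interval)"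
    by (subst nn_integral_first_coordinate) auto
  also have "\<dots> = (\<integral>\<^sup>+y. indicator {success i..} y * F x \<partial>unit_interval)"
    by (simp only: nn_integral_const unit_seq.emeasure_space_1 mult_1_right)
  also have "\<dots> = ennreal (1 - success i) * F x"
    by (subst nn_integral_multc) (auto simp: tail \<open>indicator {success i..} \<in> borel_measurable unit_interval\<close>)
  finally show ?case by simp
next
  case (Suc m)
  note gm = dilated_measurable[OF g success_pos]
  have ind: "indicator {..<success i} \<in> borel_measurable unit_interval" "indicator {success i..} \<in> borel_measurable unit_interval" for i
    by (rule measurable_restrict_space1, rule borel_measurable_indicator, simp)+
  note [measurable] = measurable_compose[OF coordinate_measurable gm] measurable_compose[OF coordinate_measurable ind(1)]
    measurable_compose[OF coordinate_measurable ind(2)] gm ind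
  let ?c = "ennreal ((\<Prod>k<m. success (k + Suc i)) * (1 - success (m + Suc i)))"
  let ?P = "(shift_operator term_power ^^ m) F"
  have Pm[measurable]: "?P \<in> borel_measurable borel" by (rule shift_operator_power_measurable[OF term_power_measurable F])
  let ?K = "\<lambda>\<omega>. (\<Prod>k<m. indicator {..<success (k + Suc i)} (\<omega> k)) * indicator {success (m + Suc i)..} (\<omega> m) :: ennreal"
  let ?S = "\<lambda>\<omega>. \<Sum>k<m. \<bar>dilated g (success (k + Suc i)) (\<omega> k)\<bar> powr p"
  have "(\<integral>\<^sup>+\<omega>. (\<Prod>k<Suc m. indicator {..<success (k + i)} (\<omega> k)) * indicator {success (Suc m + i)..} (\<omega> (Suc m)) *
      F (x + (\<Sum>k<Suc m. \<bar>dilated g (success (k + i)) (\<omega> k)\<bar> powr p)) \<partial>unit_product) =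
    (\<integral>\<^sup>+y. \<integral>\<^sup>+\<omega>. indicator {..<success i} y * (?K \<omega> * F (x + \<bar>dilated g (success i) y\<bar> powr p + ?S \<omega>)) \<partial>unit_product \<partial>unit_interval)"
    by (subst nn_integral_first_coordinate, measurable)
      (simp only: prod.lessThan_Suc_shift sum.lessThan_Suc_shift nat.case add_0 add_Suc add_Suc_right mult.assoc add.assoc)
  also have "\<dots> = (\<integral>\<^sup>+y. indicator {..<success i} y * (?c * ?P (x + \<bar>dilated g (success i) y\<bar> powr p)) \<partial>unit_interval)"
    by (intro nn_integral_cong, subst nn_integral_cmult, measurable) (simp only: Suc.IH)
  also have "\<dots> = (\<integral>\<^sup>+y. ?c * (?P (x + \<bar>dilated g (success i) y\<bar> powr p) * indicator {..<success i} y) \<partial>unit_interval)"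
    by (simp only: mult_ac)
  also have "\<dots> = ?c * (\<integral>\<^sup>+y. ?P (x + \<bar>dilated g (success i) y\<bar> powr p) * indicator {..<success i} y \<partial>unit_interval)"
    by (rule nn_integral_cmult) measurable
  also have "\<dots> = ?c * (ennreal (success i) * (\<integral>\<^sup>+y. ?P (x + \<bar>g y\<bar> powr p) \<partial>unit_interval))"
  proof -
    have "(\<lambda>z. ?P (x + \<bar>z\<bar> powr p)) \<in> borel_measurable borel"
      by (rule measurable_compose[OF _ Pm]) measurable
    from nn_integral_dilated[OF g success_pos success_le_1 this] show ?thesis by simp
  qed
  also have "\<dots> = ennreal (success i) * ?c * (shift_operator term_power ^^ Suc m) F x"
    by (simp add: shift_operator_def[of _ ?P] mult_ac)
  also have "ennreal (success i) * ?c = ennreal ((\<Prod>k<Suc m. success (k + i)) * (1 - success (Suc m + i)))"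
  proof -
    have "0 \<le> (\<Prod>k<m. success (k + Suc i)) * (1 - success (m + Suc i))"
      using success_le_1 by (intro mult_nonneg_nonneg prod_nonneg) (auto intro: less_imp_le success_pos)
    then have "ennreal (success i) * ?c = ennreal (success i * ((\<Prod>k<m. success (k + Suc i)) * (1 - success (m + Suc i))))"
      using success_pos[of i] by (subst ennreal_mult) auto
    then show ?thesis by (simp only: prod.lessThan_Suc_shift mult.assoc add_0 add_Suc add_Suc_right)
  qed
  finally show ?case .
qed

text \<open>
  The events for different numbers of initial successes are disjoint, and the terms after the
  first failure only increase the sum.
\<close>

lemma emeasure_initial_successes_le:
  assumes s: "0 \<le> s"
  shows "(\<Sum>n. ennreal ((\<Prod>k<Suc n. success k) * (1 - success (Suc n))) * (shift_operator term_power ^^ Suc n) (indicator {s<..}) 0) \<le>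
    emeasure unit_product {\<omega> \<in> space unit_product. ennreal s < (\<Sum>k. ennreal (\<bar>dilated g (success k) (\<omega> k)\<bar> powr p))}"
proof -
  note gm = dilated_measurable[OF g success_pos]
  have ind: "indicator {..<success i} \<in> borel_measurable unit_interval" "indicator {success i..} \<in> borel_measurable unit_interval" for i
    by (rule measurable_restrict_space1, rule borel_measurable_indicator, simp)+
  note [measurable] = measurable_compose[OF coordinate_measurable gm] measurable_compose[OF coordinate_measurable ind(1)]
    measurable_compose[OF coordinate_measurable ind(2)]
  have F[measurable]: "indicator {s<..} \<in> borel_measurable borel" by (intro borel_measurable_indicator) auto
  define I :: "nat \<Rightarrow> (nat \<Rightarrow> real) \<Rightarrow> ennreal" where
    "I n \<omega> = (\<Prod>k<Suc n. indicator {..<success (k + 0)} (\<omega> k)) * indicator {success (Suc n + 0)..} (\<omega> (Suc n)) *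
      indicator {s<..} (0 + (\<Sum>k<Suc n. \<bar>dilated g (success (k + 0)) (\<omega> k)\<bar> powr p))" for n \<omega>
  let ?B = "{\<omega> \<in> space unit_product. ennreal s < (\<Sum>k. ennreal (\<bar>dilated g (success k) (\<omega> k)\<bar> powr p))}"
  have pointwise: "(\<Sum>n. I n \<omega>) \<le> indicator ?B \<omega>" if \<omega>: "\<omega> \<in> space unit_product" for \<omega>
  proof (cases "\<exists>n. I n \<omega> \<noteq> 0")
    case False
    then have "(\<lambda>n. I n \<omega>) = (\<lambda>_. 0)" by blast
    then show ?thesis by simp
  next
    case True
    then obtain n where n: "I n \<omega> \<noteq> 0" by blast
    have nz: "(\<forall>k<Suc n. \<omega> k < success k) \<and> success (Suc n) \<le> \<omega> (Suc n) \<and>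
        s < (\<Sum>k<Suc n. \<bar>dilated g (success k) (\<omega> k)\<bar> powr p)" if "I n \<omega> \<noteq> 0" for n
    proof -
      have factors_nonzero: "a \<noteq> 0 \<and> b \<noteq> 0 \<and> c \<noteq> 0" if "a * b * c \<noteq> 0" for a b c :: ennreal
        using that by auto
      have 1: "(\<Prod>k<Suc n. indicator {..<success (k + 0)} (\<omega> k) :: ennreal) \<noteq> 0"
        and 2: "indicator {success (Suc n + 0)..} (\<omega> (Suc n)) \<noteq> (0::ennreal)"
        and 3: "indicator {s<..} (0 + (\<Sum>k<Suc n. \<bar>dilated g (success (k + 0)) (\<omega> k)\<bar> powr p)) \<noteq> (0::ennreal)"
        using factors_nonzero[OF that[unfolded I_def]] by blast+
      have "\<omega> k < success k" if k: "k < Suc n" for k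
      proof (rule ccontr)
        assume "\<not> \<omega> k < success k"
        then have "(\<Prod>k<Suc n. indicator {..<success (k + 0)} (\<omega> k) :: ennreal) = 0"
          using k by (intro prod_zero bexI[of _ k]) auto
        with 1 show False by blast
      qed
      then show ?thesis using 2 3 by (simp add: indicator_eq_0_iff del: sum.lessThan_Suc)
    qed
    have other: "I m \<omega> = 0" if "m \<noteq> n" for m
    proof (rule ccontr)
      assume "I m \<omega> \<noteq> 0"
      from nz[OF this] nz[OF n] that show False
        by (cases m n rule: linorder_cases) (force simp: not_less[symmetric])+
    qed
    have "(\<Sum>n. I n \<omega>) = (\<Sum>m\<in>{n}. I m \<omega>)" by (rule suminf_finite) (use other in auto)
    also have "\<dots> \<le> 1"
    proof -
      have "(\<Prod>k<Suc n. indicator {..<success (k + 0)} (\<omega> k) :: ennreal) = 1"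
        using nz[OF n] by (intro prod.neutral) auto
      then have "I n \<omega> \<le> 1" unfolding I_def by (simp add: indicator_def del: prod.lessThan_Suc sum.lessThan_Suc)
      then show ?thesis by simp
    qed
    also have "1 = (indicator ?B \<omega> :: ennreal)"
    proof -
      have "ennreal s < ennreal (\<Sum>k<Suc n. \<bar>dilated g (success k) (\<omega> k)\<bar> powr p)"
        using nz[OF n] s by (intro ennreal_lessI) (auto intro: le_less_trans)
      also have "\<dots> = (\<Sum>k<Suc n. ennreal (\<bar>dilated g (success k) (\<omega> k)\<bar> powr p))"
        by (rule sum_ennreal[symmetric]) simp
      also have "\<dots> \<le> (\<Sum>k. ennreal (\<bar>dilated g (success k) (\<omega> k)\<bar> powr p))" by (rule sum_le_suminf) auto
      finally show ?thesis using \<omega> by simp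
    qed
    finally show ?thesis .
  qed
  have "(\<Sum>n. ennreal ((\<Prod>k<Suc n. success k) * (1 - success (Suc n))) * (shift_operator term_power ^^ Suc n) (indicator {s<..}) 0) =
      (\<Sum>n. \<integral>\<^sup>+\<omega>. I n \<omega> \<partial>unit_product)"
    unfolding I_def nn_integral_initial_successes[OF F] by simp
  also have "\<dots> = (\<integral>\<^sup>+\<omega>. (\<Sum>n. I n \<omega>) \<partial>unit_product)"
    unfolding I_def by (rule nn_integral_suminf[symmetric]) measurable
  also have "\<dots> \<le> (\<integral>\<^sup>+\<omega>. indicator ?B \<omega> \<partial>unit_product)"
    by (rule nn_integral_mono) (rule pointwise)
  also have "\<dots> = emeasure unit_product ?B"
    by (rule nn_integral_indicator) measurable
  finally show ?thesis .
qed

end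

lemma distr_eq_of_nn_integral:
  assumes T: "S \<in> M \<rightarrow>\<^sub>M N" and eq: "\<And>B. B \<in> sets N \<Longrightarrow> (\<integral>\<^sup>+t. indicator B (S t) \<partial>M) = emeasure N B"
  shows "distr M N S = N"
proof (rule measure_eqI)
  fix B assume "B \<in> sets (distr M N S)"
  then have B: "B \<in> sets N" by simp
  have "emeasure (distr M N S) B = (\<integral>\<^sup>+x. indicator B x \<partial>distr M N S)" using B by simp
  also have "\<dots> = (\<integral>\<^sup>+t. indicator B (S t) \<partial>M)"
    using B by (subst nn_integral_distr[OF T]) auto
  finally show "emeasure (distr M N S) B = emeasure N B" using eq[OF B] by simp
qed simp

text \<open>
  A formula in terms of extended nonnegative sums, from which measurability can be read off.
\<close>

lemma pointwise_lp_norm: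
  "pointwise_seq_norm (lp_space p) (lp_norm p) f t =
    (if (\<Sum>k. ennreal (\<bar>f k t\<bar> powr p)) = \<infinity> then \<infinity>
     else ennreal (enn2real (\<Sum>k. ennreal (\<bar>f k t\<bar> powr p)) powr (1 / p)))"
proof (cases "summable (\<lambda>k. \<bar>f k t\<bar> powr p)")
  case True
  then have "(\<Sum>k. ennreal (\<bar>f k t\<bar> powr p)) = ennreal (\<Sum>k. \<bar>f k t\<bar> powr p)"
    by (intro suminf_ennreal2) auto
  then show ?thesis using True
    by (simp add: pointwise_seq_norm_def lp_space_def lp_norm_def suminf_nonneg)
next
  case False
  have "(\<Sum>k. ennreal (\<bar>f k t\<bar> powr p)) = \<infinity>"
  proof (rule ccontr)
    assume "\<not> ?thesis"
    then have "summable (\<lambda>k. \<bar>f k t\<bar> powr p)" by (intro summable_suminf_not_top) auto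
    with False show False by simp
  qed
  then show ?thesis using False by (simp add: pointwise_seq_norm_def lp_space_def)
qed

context kruglov_setting begin

text \<open>
  The coordinates of a measure preserving map into the product space are independent and uniformly
  distributed.
\<close>

lemma indep_coordinates:
  assumes h: "\<And>k. h k \<in> borel_measurable unit_interval"
  shows "unit.indep_vars (\<lambda>_. borel) (\<lambda>k t. h k (T t k)) UNIV"
proof -
  have Tk: "(\<lambda>t. T t k) \<in> unit_interval \<rightarrow>\<^sub>M unit_interval" for k
    by (rule measure_preserving_measurable[OF T coordinate_measurable])
  have TP: "T \<in> unit_interval \<rightarrow>\<^sub>M unit_product"
    using measure_preserving_measurable[OF T measurable_ident] by (simp add: id_def)
  have dk: "distr unit_interval unit_interval (\<lambda>t. T t k) = unit_interval" for k
  proof (rule distr_eq_of_nn_integral[OF Tk])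
    fix B assume B: "B \<in> sets unit_interval"
    have m: "indicator B \<in> borel_measurable unit_interval" using B by (rule borel_measurable_indicator)
    have "(\<integral>\<^sup>+t. indicator B (T t k) \<partial>unit_interval) = (\<integral>\<^sup>+\<omega>. indicator B (\<omega> k) \<partial>unit_product)"
      by (rule nn_integral_measure_preserving[OF T measurable_compose[OF coordinate_measurable m]])
    then show "(\<integral>\<^sup>+t. indicator B (T t k) \<partial>unit_interval) = emeasure unit_interval B"
      unfolding nn_integral_coordinate[OF m] using B by simp
  qed
  have dP: "distr unit_interval unit_product T = unit_product"
  proof (rule distr_eq_of_nn_integral[OF TP])
    fix B assume B: "B \<in> sets unit_product"
    show "(\<integral>\<^sup>+t. indicator B (T t) \<partial>unit_interval) = emeasure unit_product B"
      using nn_integral_measure_preserving[OF T borel_measurable_indicator[OF B]] B by simp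
  qed
  have "unit.indep_vars (\<lambda>_. unit_interval) (\<lambda>k t. T t k) UNIV"
    by (subst unit.indep_vars_iff_distr_eq_PiM) (simp_all only: UNIV_not_empty Tk dk restrict_UNIV dP not_False_eq_True)
  from unit.indep_vars_compose2[OF this, of h "\<lambda>_. borel"] h show ?thesis by simp
qed

text \<open>
  The inequality for \<open>\<ell>\<^sub>p\<close> shows that \<open>L = (\<Sum>k. \<bar>f'
  k\<bar>^p)^(1/p)\<close> lies in \<open>X\<close>, and \<open>P(K \<bar>f\<bar> > 2 s) \<le> 2 *
  P(L^p > s)\<close> carries this over to \<open>(K \<bar>f\<bar>)^(1/p)\<close>.
\<close>

lemma kruglov_maps_power_space:
  assumes X: "symmetric_fun_space X N" and p: "0 < p" "p < 1"
    and JS: "\<And>f'. (\<And>k. f' k \<in> X) \<Longrightarrow> unit.indep_vars (\<lambda>_. borel) f' UNIV \<Longrightarrow>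
      pointwise_seq_norm (lp_space p) (lp_norm p) f' \<in> borel_measurable unit_interval \<Longrightarrow>
      fun_norm X N (pointwise_seq_norm (lp_space p) (lp_norm p) f') \<le> ennreal C * rearrangement_norm X N (lp_space p) (lp_norm p) f'"
    and f: "f \<in> power_space X p"
  shows "(\<lambda>t. kruglov A f (T t)) \<in> power_space X p"
proof -
  interpret X: symmetric_fun_space X N by (rule X)
  have fm[measurable]: "f \<in> borel_measurable unit_interval" using f by (simp add: power_space_def)
  define g where "g x = \<bar>f x\<bar> powr (1 / p)" for x
  have gX: "g \<in> X" using f by (simp add: power_space_def g_def[abs_def])
  note gm = X.mem_measurable[OF gX]
  have gp: "\<bar>g x\<bar> powr p = \<bar>f x\<bar>" for x using p by (simp add: g_def powr_powr)
  define f' where "f' k t = dilated g (success k) (T t k)" for k t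
  note dm = dilated_measurable[OF gm success_pos]
  have ind: "unit.indep_vars (\<lambda>_. borel) f' UNIV"
    unfolding f'_def[abs_def] by (rule indep_coordinates[OF dm])
  interpret independent_sample f' by unfold_locales (rule ind)
  note f'm = sample_measurable
  note [measurable] = f'm
  have dist: "distribution_fn unit_interval (f' k) s = ennreal (success k) * distribution_fn unit_interval g s"
    if s: "0 \<le> s" for k s
  proof -
    have "{y::real. \<bar>y\<bar> > s} \<in> sets borel" by measurable
    then have "indicator {y::real. \<bar>y\<bar> > s} \<in> borel_measurable borel" by (rule borel_measurable_indicator)
    from measurable_compose[OF dm this] have m: "(\<lambda>x. indicator {y. \<bar>y\<bar> > s} (dilated g (success k) x) :: ennreal) \<in> borel_measurable unit_interval" .
    have "distribution_fn unit_interval (f' k) s = (\<integral>\<^sup>+t. indicator {y. \<bar>y\<bar> > s} (dilated g (success k) (T t k)) \<partial>unit_interval)"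
      unfolding distribution_fn_eq_nn_integral[OF f'm] by (simp only: f'_def)
    also have "\<dots> = (\<integral>\<^sup>+\<omega>. indicator {y. \<bar>y\<bar> > s} (dilated g (success k) (\<omega> k)) \<partial>unit_product)"
      by (rule nn_integral_measure_preserving[OF T measurable_compose[OF coordinate_measurable m]])
    also have "\<dots> = distribution_fn unit_interval (dilated g (success k)) s"
      unfolding nn_integral_coordinate[OF m] distribution_fn_eq_nn_integral[OF dm] ..
    finally show ?thesis by (simp only: distribution_fn_dilated[OF gm success_pos success_le_1 s])
  qed
  have f'X: "f' k \<in> X" for k
  proof -
    have "distribution_fn unit_interval (f' k) s \<le> distribution_fn unit_interval g s" if "0 \<le> s" for s
    proof -
      have "ennreal (success k) \<le> 1" using success_le_1[of k] by (simp add: ennreal_le_1)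
      then have "ennreal (success k) * distribution_fn unit_interval g s \<le> 1 * distribution_fn unit_interval g s"
        by (intro mult_right_mono) auto
      then show ?thesis by (simp add: dist[OF that])
    qed
    then show ?thesis using X.dominated[OF gX f'm] by blast
  qed
  have tail_le: "tail s \<le> ennreal 2 * distribution_fn unit_interval g s" if s: "0 \<le> s" for s
  proof -
    have "(\<Sum>k. ennreal (success k)) \<le> ennreal 2"
    proof (rule suminf_le_const[OF summableI])
      fix m
      have "(\<Sum>k<m. ennreal (success k)) = ennreal (\<Sum>k<m. success k)"
        by (rule sum_ennreal) (rule less_imp_le[OF success_pos])
      also have "\<dots> \<le> ennreal 2" by (intro ennreal_leI sum_success_le)
      finally show "(\<Sum>k<m. ennreal (success k)) \<le> ennreal 2" .
    qed
    then show ?thesis unfolding tail_eq dist[OF s] ennreal_suminf_multc by (rule mult_right_mono) simp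
  qed
  have fin: "rearrangement half_line (disjoint_sum f') t < \<infinity>" if t: "0 < t" for t
  proof -
    obtain l where l: "0 \<le> l" "distribution_fn unit_interval g l < ennreal (t / 2)"
      using distribution_fn_unit_vanishes[OF gm, of "t / 2"] t by auto
    have "tail l \<le> ennreal 2 * distribution_fn unit_interval g l" by (rule tail_le[OF l(1)])
    also have "\<dots> < ennreal 2 * ennreal (t / 2)"
      using l(2) by (intro ennreal_mult_strict_left_mono) auto
    also have "\<dots> = ennreal t" using t by (subst ennreal_mult[symmetric]) auto
    finally show ?thesis unfolding tail_def by (rule rearrangement_finiteI[OF l(1)])
  qed
  have rm: "rearr \<in> borel_measurable unit_interval" by (rule rearr_measurable) (rule fin)
  have rX: "rearr \<in> X"
  proof -
    obtain D where D: "X.dilation_bound 2 D"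
    using X.dilation by blast
    have "rearr \<in> X \<and> N rearr \<le> D * N g"
    proof (rule X.dilation_boundD[OF D gX rm])
      fix s :: real assume s: "0 \<le> s"
      have "distribution_fn unit_interval rearr s = min 1 (tail s)"
        unfolding rearr_def tail_def
        by (rule distribution_fn_decreasing_fun[OF disjoint_sum_measurable[OF f'm] fin s])
      then show "distribution_fn unit_interval rearr s \<le> ennreal 2 * distribution_fn unit_interval g s"
        using tail_le[OF s] by (simp add: min.coboundedI2)
    qed
    then show ?thesis by blast
  qed
  have r1: "fun_norm X N (\<lambda>t. rearrangement half_line (disjoint_sum f') t * indicator {0<..<1} t) = ennreal (N rearr)"
    unfolding rearr_def by (rule X.fun_norm_rearrangement[OF fin]) (use rX in \<open>auto simp: rearr_def\<close>)
  have r2: "seq_norm (lp_space p) (lp_norm p) (\<lambda>k. rearrangement half_line (disjoint_sum f') (real (Suc k))) \<noteq> \<infinity>"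
  proof -
    let ?e = "\<lambda>k. rearrangement half_line (disjoint_sum f') (real (Suc k))"
    \<comment> \<open>The disjoint sum has a support of measure at most \<open>2\<close>, so the rearrangement vanishes at \<open>3, 4, \<dots>\<close>.\<close>
    have zero: "?e k = 0" if "k \<notin> {..<2}" for k
    proof -
      have "ennreal 2 * distribution_fn unit_interval g 0 \<le> ennreal 2 * 1"
        by (intro mult_left_mono distribution_fn_le_1) simp
      then have "tail 0 \<le> ennreal 2" using order_trans[OF tail_le[of 0]] by simp
      also have "\<dots> < ennreal (real (Suc k))" using that by (intro ennreal_lessI) auto
      finally have "0 \<in> {l. 0 \<le> l \<and> distribution_fn half_line (disjoint_sum f') l < ennreal (real (Suc k))}"
        by (simp add: tail_def)
      then have "?e k \<le> ennreal 0" unfolding rearrangement_def by (rule INF_lower)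
      then show ?thesis by simp
    qed
    have "summable (\<lambda>k. \<bar>enn2real (?e k)\<bar> powr p)"
      by (rule summable_finite[of "{..<2}"]) (auto simp: zero simp del: of_nat_Suc)
    moreover have "?e k \<noteq> \<infinity>" for k using fin[of "real (Suc k)"] by (simp add: less_top)
    ultimately show ?thesis by (simp add: seq_norm_def lp_space_def)
  qed
  have pm: "pointwise_seq_norm (lp_space p) (lp_norm p) f' \<in> borel_measurable unit_interval"
    unfolding pointwise_lp_norm[abs_def] by measurable
  define S where "S t = (\<Sum>k. ennreal (\<bar>f' k t\<bar> powr p))" for t
  have [measurable]: "S \<in> borel_measurable unit_interval" unfolding S_def[abs_def] by measurable
  define L where "L t = enn2real (pointwise_seq_norm (lp_space p) (lp_norm p) f' t)" for t
  have "fun_norm X N (pointwise_seq_norm (lp_space p) (lp_norm p) f') \<noteq> \<infinity>"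
  proof -
    have "ennreal C * (ennreal (N rearr) + seq_norm (lp_space p) (lp_norm p)
        (\<lambda>k. rearrangement half_line (disjoint_sum f') (real (Suc k)))) < \<infinity>"
      using r2 by (simp add: ennreal_mult_less_top less_top)
    then show ?thesis using JS[OF f'X ind pm] unfolding rearrangement_norm_def r1 by (auto simp: top_unique)
  qed
  then have LX: "L \<in> X" and AEp: "AE t in unit_interval. pointwise_seq_norm (lp_space p) (lp_norm p) f' t \<noteq> \<infinity>"
    unfolding L_def fun_norm_def by presburger+
  have AES: "AE t in unit_interval. S t \<noteq> \<infinity>"
    using AEp by eventually_elim (auto simp: pointwise_lp_norm S_def)
  have L_eq: "L t = enn2real (S t) powr (1 / p)" if "S t \<noteq> \<infinity>" for t
    using that by (simp add: L_def pointwise_lp_norm S_def)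
  note Lm[measurable] = X.mem_measurable[OF LX]
  let ?\<phi> = "\<lambda>x. \<bar>f x\<bar>"
  have \<phi>m: "?\<phi> \<in> borel_measurable unit_interval" by measurable
  let ?G = "\<lambda>n s. (shift_operator ?\<phi> ^^ n) (indicator {s<..}) 0"
  let ?a = "\<lambda>n. ennreal (1 / (exp 1 * fact n))"
  note mono = shift_power_tail_mono[OF gm, where p = p, unfolded gp]
  note double = shift_power_tail_double[OF gm, where p = p, unfolded gp]
  note initial = emeasure_initial_successes_le[OF gm, where p = p, unfolded gp]
  have tailK: "emeasure unit_interval {t \<in> space unit_interval. 2 * s < kruglov A ?\<phi> (T t)} \<le>
      ennreal 2 * emeasure unit_interval {t \<in> space unit_interval. ennreal s < S t}" if s: "0 \<le> s" for s
  proof -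
    have "emeasure unit_interval {t \<in> space unit_interval. 2 * s < kruglov A ?\<phi> (T t)} = (\<Sum>n. ?a n * ?G n (2 * s))"
      using s by (intro kruglov_tail[OF \<phi>m]) simp
    also have "\<dots> \<le> (\<Sum>m. ?a (2 * m + 1) * ?G (2 * m + 1) (2 * s) + ?a (2 * m + 2) * ?G (2 * m + 2) (2 * s))"
      using s by (intro ennreal_suminf_pair_le) simp
    also have "\<dots> \<le> (\<Sum>m. 2 * (ennreal ((\<Prod>k<Suc m. success k) * (1 - success (Suc m))) * ?G (Suc m) s))"
    proof (intro suminf_le summableI)
      fix m
      have "?a (2 * m + 1) * ?G (2 * m + 1) (2 * s) + ?a (2 * m + 2) * ?G (2 * m + 2) (2 * s) \<le>
          ?a (2 * m + 1) * ?G (2 * m + 2) (2 * s) + ?a (2 * m + 2) * ?G (2 * m + 2) (2 * s)"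
        by (intro add_right_mono mult_left_mono mono) auto
      also have "\<dots> = (?a (2 * m + 1) + ?a (2 * m + 2)) * ?G (2 * m + 2) (2 * s)"
        by (simp only: distrib_right)
      also have "\<dots> \<le> ennreal ((\<Prod>k<Suc m. success k) * (1 - success (Suc m))) * (2 * ?G (Suc m) s)"
      proof (rule mult_mono)
        show "?a (2 * m + 1) + ?a (2 * m + 2) \<le> ennreal ((\<Prod>k<Suc m. success k) * (1 - success (Suc m)))"
        proof -
          have "?a (2 * m + 1) + ?a (2 * m + 2) =
              ennreal (1 / (exp 1 * fact (2 * m + 1)) + 1 / (exp 1 * fact (2 * m + 2)))"
            by (rule ennreal_plus[symmetric]) (intro divide_nonneg_nonneg mult_nonneg_nonneg; simp)+
          also have "\<dots> \<le> ennreal ((\<Prod>k<Suc m. success k) * (1 - success (Suc m)))"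
            by (rule ennreal_leI) (rule poisson_pair_le)
          finally show ?thesis .
        qed
        show "?G (2 * m + 2) (2 * s) \<le> 2 * ?G (Suc m) s"
          using double[of "Suc m" s] by (simp add: mult_2[symmetric] del: funpow.simps)
      qed auto
      finally show "?a (2 * m + 1) * ?G (2 * m + 1) (2 * s) + ?a (2 * m + 2) * ?G (2 * m + 2) (2 * s) \<le>
          2 * (ennreal ((\<Prod>k<Suc m. success k) * (1 - success (Suc m))) * ?G (Suc m) s)"
        by (simp only: mult_ac)
    qed
    also have "\<dots> \<le> 2 * emeasure unit_product {\<omega> \<in> space unit_product.
        ennreal s < (\<Sum>k. ennreal (\<bar>dilated g (success k) (\<omega> k)\<bar> powr p))}"
      unfolding ennreal_suminf_cmult by (intro mult_left_mono initial s) simp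
    also have "emeasure unit_product {\<omega> \<in> space unit_product.
        ennreal s < (\<Sum>k. ennreal (\<bar>dilated g (success k) (\<omega> k)\<bar> powr p))} =
        emeasure unit_interval {t \<in> space unit_interval. ennreal s < S t}"
    proof -
      note [measurable] = measurable_compose[OF coordinate_measurable dm]
      let ?F = "\<lambda>\<omega>. indicator {ennreal s<..} (\<Sum>k. ennreal (\<bar>dilated g (success k) (\<omega> k)\<bar> powr p)) :: ennreal"
      have Fm: "?F \<in> borel_measurable unit_product" by measurable
      have "emeasure unit_interval {t \<in> space unit_interval. ennreal s < S t} =
          (\<integral>\<^sup>+t. indicator {t \<in> space unit_interval. ennreal s < S t} t \<partial>unit_interval)"
        by (rule nn_integral_indicator[symmetric]) measurable
      also have "\<dots> = (\<integral>\<^sup>+t. ?F (T t) \<partial>unit_interval)"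
        by (intro nn_integral_cong) (auto simp: indicator_def S_def f'_def)
      also have "\<dots> = (\<integral>\<^sup>+\<omega>. ?F \<omega> \<partial>unit_product)"
        by (rule nn_integral_measure_preserving[OF T Fm])
      also have "\<dots> = (\<integral>\<^sup>+\<omega>. indicator {\<omega> \<in> space unit_product.
          ennreal s < (\<Sum>k. ennreal (\<bar>dilated g (success k) (\<omega> k)\<bar> powr p))} \<omega> \<partial>unit_product)"
        by (intro nn_integral_cong) (auto simp: indicator_def)
      also have "\<dots> = emeasure unit_product {\<omega> \<in> space unit_product.
          ennreal s < (\<Sum>k. ennreal (\<bar>dilated g (success k) (\<omega> k)\<bar> powr p))}"
        by (rule nn_integral_indicator) measurable
      finally show ?thesis ..
    qed
    finally show ?thesis by simp
  qed
  define V where "V t = kruglov A ?\<phi> (T t) powr (1 / p)" for t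
  note Km = kruglov_T_measurable[OF \<phi>m] kruglov_T_measurable[OF fm]
  note [measurable] = Km
  have Vm: "V \<in> borel_measurable unit_interval" unfolding V_def[abs_def] by measurable
  have K0: "0 \<le> kruglov A ?\<phi> (T t)" for t by (rule kruglov_nonneg[OF A_sets A_disjoint]) simp
  have VX: "V \<in> X"
  proof -
    obtain D where D: "X.dilation_bound 2 D"
    using X.dilation by blast
    let ?L = "\<lambda>t. 2 powr (1 / p) * L t"
    have "V \<in> X \<and> N V \<le> D * N ?L"
    proof (rule X.dilation_boundD[OF D X.scale_mem[OF LX] Vm])
      fix s :: real assume s: "0 \<le> s"
      have "distribution_fn unit_interval V s =
          emeasure unit_interval {t \<in> space unit_interval. 2 * (s powr p / 2) < kruglov A ?\<phi> (T t)}"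
        unfolding distribution_fn_def using s p K0 by (simp add: V_def less_powr_root_iff)
      also have "\<dots> \<le> ennreal 2 * emeasure unit_interval {t \<in> space unit_interval. ennreal (s powr p / 2) < S t}"
        by (rule tailK) simp
      also have "emeasure unit_interval {t \<in> space unit_interval. ennreal (s powr p / 2) < S t} \<le> distribution_fn unit_interval ?L s"
        unfolding distribution_fn_def
      proof (rule emeasure_mono_AE)
        show "AE t in unit_interval. t \<in> {t \<in> space unit_interval. ennreal (s powr p / 2) < S t} \<longrightarrow>
            t \<in> {t \<in> space unit_interval. s < \<bar>2 powr (1 / p) * L t\<bar>}"
          using AES
        proof eventually_elim
          case (elim t)
          show ?case
          proof
            assume t: "t \<in> {t \<in> space unit_interval. ennreal (s powr p / 2) < S t}"
            then have "s powr p / 2 < enn2real (S t)"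
              using elim by (cases "S t") (auto simp: ennreal_less_iff)
            then have "s < (2 * enn2real (S t)) powr (1 / p)"
              using s p by (subst less_powr_root_iff) auto
            also have "\<dots> = 2 powr (1 / p) * L t" by (simp add: powr_mult L_eq[OF elim])
            also have "\<dots> \<le> \<bar>2 powr (1 / p) * L t\<bar>" by (rule abs_ge_self)
            finally show "t \<in> {t \<in> space unit_interval. s < \<bar>2 powr (1 / p) * L t\<bar>}" using t by blast
          qed
        qed
      qed measurable
      finally show "distribution_fn unit_interval V s \<le> ennreal 2 * distribution_fn unit_interval ?L s"
        by (simp add: mult_left_mono)
    qed
    then show ?thesis by blast
  qed
  have "(\<lambda>t. \<bar>kruglov A f (T t)\<bar> powr (1 / p)) \<in> X \<and> N (\<lambda>t. \<bar>kruglov A f (T t)\<bar> powr (1 / p)) \<le> N V"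
  proof (rule X.ideal[OF VX])
    show "AE t in unit_interval. \<bar>\<bar>kruglov A f (T t)\<bar> powr (1 / p)\<bar> \<le> \<bar>V t\<bar>"
      using p abs_kruglov_le[OF A_sets A_disjoint, of f] by (auto simp: V_def intro!: powr_mono2)
  qed measurable
  then show ?thesis by (simp add: power_space_def Km)
qed

end

section \<open>The equivalence\<close>

theorem theorem1p1:
  fixes X :: "(real \<Rightarrow> real) set" and normX :: "(real \<Rightarrow> real) \<Rightarrow> real"
    and A :: "nat \<Rightarrow> real set" and T :: "real \<Rightarrow> nat \<Rightarrow> real"
  assumes X: "symmetric_fun_space X normX" and fatou: "fatou_property X normX"
    and A_sets: "\<And>n. A n \<in> sets unit_interval" and A_disjoint: "disjoint_family A"
    and A_measure: "\<And>n. measure unit_interval (A n) = 1 / (exp 1 * fact n)"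
    and T: "measure_preserving_bijection unit_interval product_space T"
  shows
    "(\<forall>E normE. symmetric_seq_space E normE \<longrightarrow>
        (\<exists>C>0. \<forall>f :: nat \<Rightarrow> real \<Rightarrow> real.
           (\<forall>k. f k \<in> X) \<longrightarrow>
           prob_space.indep_vars unit_interval (\<lambda>_. borel) f UNIV \<longrightarrow>
           pointwise_seq_norm E normE f \<in> borel_measurable unit_interval \<longrightarrow>
           (let \<mu> = rearrangement (lebesgue_on {0<..}) (disjoint_sum f);
                lhs = fun_norm X normX (pointwise_seq_norm E normE f);
                rhs = fun_norm X normX (\<lambda>t. \<mu> t * indicator {0<..<1} t)
                      + seq_norm E normE (\<lambda>k. \<mu> (real (Suc k)))
            in lhs \<le> ennreal C * rhs \<and> rhs \<le> ennreal C * lhs)))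
     \<longleftrightarrow>
     (\<forall>p. 0 < p \<and> p < 1 \<longrightarrow>
        (\<forall>f \<in> power_space X p. (\<lambda>t. kruglov A f (T t)) \<in> power_space X p))"
    (is "?equivalence \<longleftrightarrow> ?kruglov")
proof -
  interpret kruglov_setting A T
    by unfold_locales (fact A_sets A_disjoint A_measure T)+
  show ?thesis
  proof
    assume equivalence: ?equivalence
    show ?kruglov
    proof (intro allI impI ballI)
      fix p f assume p: "0 < p \<and> p < 1" and f: "f \<in> power_space X p"
      have "symmetric_seq_space (lp_space p) (lp_norm p)" using p by (intro symmetric_seq_space_lp) auto
      from equivalence[rule_format, OF this, unfolded Let_def, folded rearrangement_norm_def]
      obtain C where "\<And>f'. (\<And>k. f' k \<in> X) \<Longrightarrow> unit.indep_vars (\<lambda>_. borel) f' UNIV \<Longrightarrow>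
        pointwise_seq_norm (lp_space p) (lp_norm p) f' \<in> borel_measurable unit_interval \<Longrightarrow>
        fun_norm X normX (pointwise_seq_norm (lp_space p) (lp_norm p) f') \<le> ennreal C * rearrangement_norm X normX (lp_space p) (lp_norm p) f'"
        by blast
      then show "(\<lambda>t. kruglov A f (T t)) \<in> power_space X p"
        using p f by (intro kruglov_maps_power_space[OF X]) auto
    qed
  next
    assume kruglov: ?kruglov
    show ?equivalence
    proof (intro allI impI)
      fix E normE assume E: "symmetric_seq_space E normE"
      obtain C1 where C1: "0 < C1" "\<And>f. unit.indep_vars (\<lambda>_. borel) f UNIV \<Longrightarrow>
        rearrangement_norm X normX E normE f
        \<le> ennreal C1 * fun_norm X normX (pointwise_seq_norm E normE f)"
        using johnson_schechtman_lower[OF X E] by blast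
      obtain C2 where C2: "0 < C2" "\<And>f. unit.indep_vars (\<lambda>_. borel) f UNIV \<Longrightarrow> (\<And>k. f k \<in> X) \<Longrightarrow>
        pointwise_seq_norm E normE f \<in> borel_measurable unit_interval \<Longrightarrow>
        fun_norm X normX (pointwise_seq_norm E normE f) \<le> ennreal C2 *
         rearrangement_norm X normX E normE f"
        using johnson_schechtman_upper[OF X E] kruglov by blast
      have le: "ennreal C1 \<le> ennreal (max C1 C2)" "ennreal C2 \<le> ennreal (max C1 C2)"
        by (auto intro: ennreal_leI)
      show "\<exists>C>0. \<forall>f :: nat \<Rightarrow> real \<Rightarrow> real.
           (\<forall>k. f k \<in> X) \<longrightarrow>
           prob_space.indep_vars unit_interval (\<lambda>_. borel) f UNIV \<longrightarrow>
           pointwise_seq_norm E normE f \<in> borel_measurable unit_interval \<longrightarrow>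
           (let \<mu> = rearrangement (lebesgue_on {0<..}) (disjoint_sum f);
                lhs = fun_norm X normX (pointwise_seq_norm E normE f);
                rhs = fun_norm X normX (\<lambda>t. \<mu> t * indicator {0<..<1} t)
                      + seq_norm E normE (\<lambda>k. \<mu> (real (Suc k)))
            in lhs \<le> ennreal C * rhs \<and> rhs \<le> ennreal C * lhs)"
        unfolding Let_def rearrangement_norm_def[symmetric]
      proof (intro exI[of _ "max C1 C2"] conjI allI impI)
        show "0 < max C1 C2" using C1(1) by simp
        fix f :: "nat \<Rightarrow> real \<Rightarrow> real"
        assume f: "\<forall>k. f k \<in> X" "unit.indep_vars (\<lambda>_. borel) f UNIV"
          "pointwise_seq_norm E normE f \<in> borel_measurable unit_interval"
        let ?lhs = "fun_norm X normX (pointwise_seq_norm E normE f)"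
        let ?rhs = "rearrangement_norm X normX E normE f"
        have "?lhs \<le> ennreal C2 * ?rhs" using C2(2) f by blast
        also have "\<dots> \<le> ennreal (max C1 C2) * ?rhs" by (intro mult_right_mono le) simp
        finally show "?lhs \<le> ennreal (max C1 C2) * ?rhs" .
        have "?rhs \<le> ennreal C1 * ?lhs" using C1(2) f by blast
        also have "\<dots> \<le> ennreal (max C1 C2) * ?lhs" by (intro mult_right_mono le) simp
        finally show "?rhs \<le> ennreal (max C1 C2) * ?lhs" .
      qed
    qed
  qed
qed

end
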